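(* Let $\psi, \rho \in C_0(\mathbb{R}^n) \cap L^2(\mathbb{R}^n)$ with $\psi$ symmetric satisfy, for some constant $L_1 \ge 0$, $$\mathcal{F}[\psi]^2 \le L_1 \mathcal{F}[\rho].$$ Let $\mathcal{G} \subset \mathbb{R}^n$ be a finite set (grid), and for each $z \in \mathcal{G}$ let $0 \le \theta_z \in L^2(\mathbb{R}^n)\cap L^1(\mathbb{R}^n)$, with $L_0 \ge 0$ satisfying $$L_0 \ge \sup_{x \in \mathbb{R}^n} \sum_{z \in \mathcal{G}} \theta_z(x) \int_{\mathbb{R}^n} \theta_z(w)\,dw .$$ For a closed $\Omega \subset \mathbb{R}^n$, define for $\mu \in \mathcal{M}(\Omega)$ $$A\mu := \Bigl(\int_\Omega (\theta_z * \psi)(x)\,d\mu(x)\Bigr)_{z \in \mathcal{G}} \in \mathbb{R}^{\#\mathcal{G}} \quad\text{and}\quad \mathcal{D}\mu := \rho * \mu .$$ Then a pre-adjoint $A_* \in \mathbb{L}(\mathbb{R}^{\#\mathcal{G}}; C_0(\Omega))$ of $A$ is given by $A_* y = \sum_{z \in \mathcal{G}} y_z\, \theta_z * \psi$, and $$A_* A \le L_0 L_1 \mathcal{D},$$ i.e. $\langle A_*A\mu | \mu\rangle \le L_0L_1\langle \mathcal{D}\mu|\mu\rangle$ for all $\mu \in \mathcal{M}(\Omega)$.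
   Context: All functions are real-valued. $\mathcal{M}(\Omega)$ is the space of finite Radon measures on $\Omega$; $C_0(\Omega)$ is the sup-norm closure of the continuous compactly supported functions $C_c(\Omega)$, with $\mathcal{M}(\Omega) = C_0(\Omega)^*$ and dual product $\langle \phi|\mu\rangle = \int_\Omega \phi\,d\mu$. $\mathbb{L}(X;Y)$ denotes bounded linear operators and $\#\mathcal{G}$ the cardinality of $\mathcal{G}$. Symmetric means $\psi(-x)=\psi(x)$. $[\rho*\mu](x) = \int_\Omega\rho(x-y)\,d\mu(y)$. The Fourier transform is $[\mathcal{F}u](\xi) = \int_{\mathbb{R}^n} u(x)e^{-2\pi \mathrm{i}\langle x,\xi\rangle}\,dx$, extended to $L^2(\mathbb{R}^n)$ by continuity. For a Hilbert space $Y$, a pre-adjoint of $A \in \mathbb{L}(\mathcal{M}(\Omega); Y)$ is an operator $A_* \in \mathbb{L}(Y; C_0(\Omega))$ with $\langle A_* y | \mu\rangle = \langle A\mu, y\rangle$ for all $y \in Y$, $\mu \in \mathcal{M}(\Omega)$. *)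

theory Defs
  imports "HOL-Analysis.Analysis" "HOL-Library.Complex_Order"
begin

section \<open>Continuous functions on \<open>\<Omega>\<close>\<close>

text \<open>Functions on \<open>\<Omega>\<close> are represented by total functions whose values outside \<open>\<Omega>\<close> are irrelevant.\<close>

definition sup_norm :: "'a set \<Rightarrow> ('a \<Rightarrow> real) \<Rightarrow> real" where
  "sup_norm \<Omega> f = Sup (insert 0 ((\<lambda>x. \<bar>f x\<bar>) ` \<Omega>))"
  \<comment> \<open>the \<open>0\<close> only matters for \<open>\<Omega> = {}\<close>\<close>

definition Cc_space :: "'a::euclidean_space set \<Rightarrow> ('a \<Rightarrow> real) set" where
  "Cc_space \<Omega> = {f. continuous_on \<Omega> f \<and>
     (\<exists>K. compact K \<and> K \<subseteq> \<Omega> \<and> (\<forall>x \<in> \<Omega> - K. f x = 0))}"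

text \<open>The sup-norm closure of \<open>Cc_space\<close>, stated pointwise because \<open>sup_norm\<close> is meaningful
  only for bounded functions.\<close>

definition C0_space :: "'a::euclidean_space set \<Rightarrow> ('a \<Rightarrow> real) set" where
  "C0_space \<Omega> = {f. \<forall>e>0. \<exists>g \<in> Cc_space \<Omega>. \<forall>x \<in> \<Omega>. \<bar>f x - g x\<bar> \<le> e}"

section \<open>Finite signed Radon measures\<close>

definition borel_subsets :: "'a::euclidean_space set \<Rightarrow> 'a set set" where
  "borel_subsets \<Omega> = {B \<in> sets borel. B \<subseteq> \<Omega>}"

text \<open>The positive variation; \<open>ennreal\<close> sends negative numbers to \<open>0\<close>. The negative variation
  of \<open>\<mu>\<close> is the positive variation of \<open>-\<mu>\<close>.\<close>

definition pos_variation :: "('a::euclidean_space set \<Rightarrow> real) \<Rightarrow> 'a set \<Rightarrow> ennreal" where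
  "pos_variation \<mu> B = (SUP C \<in> borel_subsets B. ennreal (\<mu> C))"

definition total_variation :: "('a::euclidean_space set \<Rightarrow> real) \<Rightarrow> 'a set \<Rightarrow> ennreal" where
  "total_variation \<mu> B = pos_variation \<mu> B + pos_variation (\<lambda>C. - \<mu> C) B"

text \<open>\<open>\<M>(\<Omega>)\<close> for a Borel set \<open>\<Omega>\<close>: real-valued (hence finite) countably additive set functions
  on the Borel subsets of \<open>\<Omega>\<close> with inner regular total variation.\<close>

definition radon_measures :: "'a::euclidean_space set \<Rightarrow> ('a set \<Rightarrow> real) set" where
  "radon_measures \<Omega> = {\<mu>.
     (\<forall>B :: nat \<Rightarrow> 'a set. range B \<subseteq> borel_subsets \<Omega> \<and> disjoint_family B \<longrightarrow>
        (\<lambda>i. \<mu> (B i)) sums \<mu> (\<Union>i. B i)) \<and>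
     (\<forall>B \<in> borel_subsets \<Omega>. \<forall>e::real. e > 0 \<longrightarrow>
        (\<exists>K \<subseteq> B. compact K \<and> total_variation \<mu> (B - K) < ennreal e))}"

definition pos_part :: "'a::euclidean_space set \<Rightarrow> ('a set \<Rightarrow> real) \<Rightarrow> 'a measure" where
  "pos_part \<Omega> \<mu> = measure_of \<Omega> (borel_subsets \<Omega>) (pos_variation \<mu>)"

definition neg_part :: "'a::euclidean_space set \<Rightarrow> ('a set \<Rightarrow> real) \<Rightarrow> 'a measure" where
  "neg_part \<Omega> \<mu> = pos_part \<Omega> (\<lambda>B. - \<mu> B)"

text \<open>The dual product \<open>\<langle>\<phi>|\<mu>\<rangle> = \<integral>\<^sub>\<Omega> \<phi> d\<mu>\<close>, through the Jordan decomposition of \<open>\<mu>\<close>.\<close>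

definition dual_product :: "'a::euclidean_space set \<Rightarrow> ('a \<Rightarrow> real) \<Rightarrow> ('a set \<Rightarrow> real) \<Rightarrow> real" where
  "dual_product \<Omega> \<phi> \<mu> = (\<integral>x. \<phi> x \<partial>pos_part \<Omega> \<mu>) - (\<integral>x. \<phi> x \<partial>neg_part \<Omega> \<mu>)"

definition radon_norm :: "'a::euclidean_space set \<Rightarrow> ('a set \<Rightarrow> real) \<Rightarrow> real" where
  "radon_norm \<Omega> \<mu> = enn2real (total_variation \<mu> \<Omega>)"

section \<open>Bounded operators and pre-adjoints\<close>

text \<open>For a finite index set \<open>I\<close>, the Euclidean space \<open>\<real>\<^sup>I\<close> is represented by functions of which
  only the values on \<open>I\<close> matter. Its norm is \<open>L2_set y I\<close>, its inner product
  \<open>\<Sum>i\<in>I. y i * w i\<close>.\<close>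

definition bounded_op_measures ::
    "'a::euclidean_space set \<Rightarrow> 'i set \<Rightarrow> (('a set \<Rightarrow> real) \<Rightarrow> 'i \<Rightarrow> real) \<Rightarrow> bool" where
  "bounded_op_measures \<Omega> I A \<longleftrightarrow>
     (\<forall>\<mu> \<in> radon_measures \<Omega>. \<forall>\<nu> \<in> radon_measures \<Omega>. \<forall>a b. \<forall>i \<in> I.
        A (\<lambda>B. a * \<mu> B + b * \<nu> B) i = a * A \<mu> i + b * A \<nu> i) \<and>
     (\<exists>C. \<forall>\<mu> \<in> radon_measures \<Omega>. L2_set (A \<mu>) I \<le> C * radon_norm \<Omega> \<mu>)"

definition bounded_op_C0 ::
    "'i set \<Rightarrow> 'a::euclidean_space set \<Rightarrow> (('i \<Rightarrow> real) \<Rightarrow> 'a \<Rightarrow> real) \<Rightarrow> bool" where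
  "bounded_op_C0 I \<Omega> T \<longleftrightarrow>
     (\<forall>y. T y \<in> C0_space \<Omega>) \<and>
     (\<forall>y w a b. \<forall>x \<in> \<Omega>. T (\<lambda>i. a * y i + b * w i) x = a * T y x + b * T w x) \<and>
     (\<exists>C. \<forall>y. sup_norm \<Omega> (T y) \<le> C * L2_set y I)"

definition is_preadjoint ::
    "'a::euclidean_space set \<Rightarrow> 'i set \<Rightarrow> (('i \<Rightarrow> real) \<Rightarrow> 'a \<Rightarrow> real) \<Rightarrow>
     (('a set \<Rightarrow> real) \<Rightarrow> 'i \<Rightarrow> real) \<Rightarrow> bool" where
  "is_preadjoint \<Omega> I T A \<longleftrightarrow>
     bounded_op_measures \<Omega> I A \<and> bounded_op_C0 I \<Omega> T \<and>
     (\<forall>y. \<forall>\<mu> \<in> radon_measures \<Omega>. dual_product \<Omega> (T y) \<mu> = (\<Sum>i\<in>I. A \<mu> i * y i))"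

section \<open>Square-integrable functions and the Fourier transform\<close>

definition L2_fun :: "('a::euclidean_space \<Rightarrow> 'b::real_normed_vector) \<Rightarrow> bool" where
  "L2_fun u \<longleftrightarrow> u \<in> borel_measurable lebesgue \<and> integrable lebesgue (\<lambda>x. (norm (u x))\<^sup>2)"

definition L2_dist :: "('a::euclidean_space \<Rightarrow> 'b::real_normed_vector) \<Rightarrow> ('a \<Rightarrow> 'b) \<Rightarrow> real" where
  "L2_dist u v = sqrt (\<integral>x. (norm (u x - v x))\<^sup>2 \<partial>lebesgue)"

definition fourier_integral :: "('a::euclidean_space \<Rightarrow> complex) \<Rightarrow> 'a \<Rightarrow> complex" where
  "fourier_integral u \<xi> =
     (\<integral>x. u x * exp (- 2 * complex_of_real pi * \<i> * complex_of_real (x \<bullet> \<xi>)) \<partial>lebesgue)"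

definition is_fourier_L2 :: "('a::euclidean_space \<Rightarrow> complex) \<Rightarrow> ('a \<Rightarrow> complex) \<Rightarrow> bool" where
  "is_fourier_L2 u v \<longleftrightarrow> L2_fun v \<and>
     (\<exists>U :: nat \<Rightarrow> 'a \<Rightarrow> complex. (\<forall>k. integrable lebesgue (U k) \<and> L2_fun (U k)) \<and>
        (\<lambda>k. L2_dist (U k) u) \<longlonglongrightarrow> 0 \<and>
        (\<lambda>k. L2_dist (fourier_integral (U k)) v) \<longlonglongrightarrow> 0)"

text \<open>The integral on \<open>L\<^sup>1\<close>, its extension by continuity on \<open>L\<^sup>2\<close>. In the second case the
  transform is an \<open>L\<^sup>2\<close> class, of which an arbitrary representative is chosen.\<close>

definition fourier :: "('a::euclidean_space \<Rightarrow> complex) \<Rightarrow> 'a \<Rightarrow> complex" where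
  "fourier u = (if integrable lebesgue u then fourier_integral u else (SOME v. is_fourier_L2 u v))"

section \<open>Convolutions and the two operators\<close>

definition convol :: "('a::euclidean_space \<Rightarrow> real) \<Rightarrow> ('a \<Rightarrow> real) \<Rightarrow> 'a \<Rightarrow> real" where
  "convol f g x = (\<integral>y. f (x - y) * g y \<partial>lebesgue)"

definition convol_measure ::
    "'a::euclidean_space set \<Rightarrow> ('a \<Rightarrow> real) \<Rightarrow> ('a set \<Rightarrow> real) \<Rightarrow> 'a \<Rightarrow> real" where
  "convol_measure \<Omega> \<rho> \<mu> x = dual_product \<Omega> (\<lambda>y. \<rho> (x - y)) \<mu>"

definition forward_op ::
    "'a::euclidean_space set \<Rightarrow> ('a \<Rightarrow> 'a \<Rightarrow> real) \<Rightarrow> ('a \<Rightarrow> real) \<Rightarrow> ('a set \<Rightarrow> real) \<Rightarrow> 'a \<Rightarrow> real" where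
  "forward_op \<Omega> \<theta> \<psi> \<mu> z = dual_product \<Omega> (convol (\<theta> z) \<psi>) \<mu>"

definition forward_op_pre ::
    "'a::euclidean_space set \<Rightarrow> ('a \<Rightarrow> 'a \<Rightarrow> real) \<Rightarrow> ('a \<Rightarrow> real) \<Rightarrow> ('a \<Rightarrow> real) \<Rightarrow> 'a \<Rightarrow> real" where
  "forward_op_pre G \<theta> \<psi> y x = (\<Sum>z\<in>G. y z * convol (\<theta> z) \<psi> x)"

end

theory Submission
  imports Defs "HOL-Probability.Probability"
begin

text \<open>Write \<open>\<mu> = \<sigma> |\<mu>|\<close> and \<open>g = \<psi> * \<mu>\<close>. Fubini turns the components of \<open>A\<mu>\<close> into
  \<open>\<integral> \<theta>\<^sub>z g\<close>, and the Cauchy-Schwarz inequality with weight \<open>\<theta>\<^sub>z\<close> bounds the sum of their squares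
  by \<open>L\<^sub>0 \<integral> g\<^sup>2 = L\<^sub>0 \<integral>\<integral> (\<psi> * \<psi>)(x - y) d\<mu> d\<mu>\<close>. It remains to see that the kernel
  \<open>h = L\<^sub>1 \<rho> - \<psi> * \<psi>\<close> is positive definite. Its transform \<open>H = L\<^sub>1 F[\<rho>] - F[\<psi>]\<^sup>2\<close> is nonnegative
  but a priori not integrable, so \<open>h\<close> is first smoothed by a Gaussian: the smoothed kernel is the
  inverse transform of \<open>H\<close> times a Gaussian, its quadratic form is the integral of
  \<open>H |F[\<mu>]|\<^sup>2\<close> against that Gaussian, and the width of the Gaussian is sent to zero. For the transform on
  \<open>L\<^sup>2\<close> only the contraction inequality is needed, not the full Plancherel identity.\<close>

text \<open>\<open>L0\<close> has its form because weighted Cauchy-Schwarz bounds the square of the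
  integral of \<open>\<theta> z\<close> g by (integral of \<open>\<theta> z\<close>) times (integral
  of \<open>\<theta> z\<close> g^2); summed over z, the factor in front of g^2 is exactly the
  function that \<open>L0\<close> dominates. Two obstacles shape the rest. First, the measure may be
  singular, for instance a point mass, so facts that hold Lebesgue almost everywhere say nothing
  about its quadratic form: the smoothed kernels must converge to h at every point, and for this
  \<psi> * \<psi> is shown to be continuous. Second, F[\<rho>] and F[\<psi>] are mere L2 classes and
  need not be integrable, so there is no pointwise inversion formula. Its substitute is the
  multiplication formula u * F^-1[\<Phi>] = F^-1[F[u] \<Phi>] for \<Phi> in both L1 and L2, which
  survives L2 limits in u. Applied to \<psi> twice, with a Gaussian K for \<Phi> and then with
  F[\<psi>] K, it produces F[\<psi>]^2 K without any convolution theorem on L2. The same formula,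
  again with Gaussians, also yields the contraction inequality.\<close>

section \<open>Square-integrable functions\<close>

text \<open>Counterpart of \<open>L2_fun\<close> over an arbitrary measure. It is used with
  \<open>lborel\<close>, which suits product measures, whereas \<open>L2_fun\<close> is tied to the
  completion \<open>lebesgue\<close>.\<close>

definition square_integrable :: "'a measure \<Rightarrow> ('a \<Rightarrow> 'b::real_normed_vector) \<Rightarrow> bool" where
  "square_integrable M f \<longleftrightarrow> f \<in> borel_measurable M \<and> integrable M (\<lambda>x. (norm (f x))\<^sup>2)"

definition norm2 :: "'a measure \<Rightarrow> ('a \<Rightarrow> 'b::real_normed_vector) \<Rightarrow> real" where
  "norm2 M f = sqrt (\<integral>x. (norm (f x))\<^sup>2 \<partial>M)"

lemma square_integrableD:
  assumes "square_integrable M f"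
  shows "f \<in> borel_measurable M" "integrable M (\<lambda>x. (norm (f x))\<^sup>2)"
  using assms by (auto simp: square_integrable_def)

lemma norm2_nonneg [simp]: "0 \<le> norm2 M f"
  by (simp add: norm2_def)

lemma norm2_power2: "(norm2 M f)\<^sup>2 = (\<integral>x. (norm (f x))\<^sup>2 \<partial>M)"
  by (simp add: norm2_def)

lemma square_integrable_bound:
  fixes f :: "'a \<Rightarrow> 'b::{real_normed_vector,second_countable_topology}"
  assumes "integrable M w" "f \<in> borel_measurable M" "\<And>x. x \<in> space M \<Longrightarrow> (norm (f x))\<^sup>2 \<le> w x"
  shows "square_integrable M f"
proof -
  have "integrable M (\<lambda>x. (norm (f x))\<^sup>2)"
    using assms(2) order_trans[OF assms(3) abs_ge_self]
    by (intro Bochner_Integration.integrable_bound[OF assms(1)]) auto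
  then show ?thesis using assms(2) by (simp add: square_integrable_def)
qed

lemma square_integrable_norm_mult:
  fixes f :: "'a \<Rightarrow> 'b::{real_normed_vector,second_countable_topology}"
    and g :: "'a \<Rightarrow> 'c::{real_normed_vector,second_countable_topology}"
  assumes "square_integrable M f" "square_integrable M g"
  shows "integrable M (\<lambda>x. norm (f x) * norm (g x))"
proof (rule Bochner_Integration.integrable_bound)
  show "integrable M (\<lambda>x. (norm (f x))\<^sup>2 + (norm (g x))\<^sup>2)"
    using assms by (intro Bochner_Integration.integrable_add) (auto simp: square_integrable_def)
  have [measurable]: "f \<in> borel_measurable M" "g \<in> borel_measurable M"
    using assms by (auto simp: square_integrable_def)
  show "(\<lambda>x. norm (f x) * norm (g x)) \<in> borel_measurable M" by measurable
  have "a * b \<le> a\<^sup>2 + b\<^sup>2" if "a \<ge> 0" "b \<ge> 0" for a b :: real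
    using sum_squares_bound[of a b] that mult_nonneg_nonneg[of a b] by linarith
  then show "AE x in M. norm (norm (f x) * norm (g x)) \<le> norm ((norm (f x))\<^sup>2 + (norm (g x))\<^sup>2)"
    by simp
qed

text \<open>Cauchy-Schwarz by the discriminant: the integral of (s |f| - |g|)^2 is a polynomial in s
  that never becomes negative.\<close>

lemma integral_norm_mult_le_norm2:
  fixes f :: "'a \<Rightarrow> 'b::{real_normed_vector,second_countable_topology}"
    and g :: "'a \<Rightarrow> 'c::{real_normed_vector,second_countable_topology}"
  assumes f: "square_integrable M f" and g: "square_integrable M g"
  shows "(\<integral>x. norm (f x) * norm (g x) \<partial>M) \<le> norm2 M f * norm2 M g"
proof -
  define A where "A = (\<integral>x. (norm (f x))\<^sup>2 \<partial>M)"
  define B where "B = (\<integral>x. (norm (g x))\<^sup>2 \<partial>M)"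
  define I where "I = (\<integral>x. norm (f x) * norm (g x) \<partial>M)"
  have A0: "A \<ge> 0" and B0: "B \<ge> 0" and I0: "I \<ge> 0" by (auto simp: A_def B_def I_def)
  note int = square_integrable_norm_mult[OF f g] square_integrableD(2)[OF f] square_integrableD(2)[OF g]
  have quad: "0 \<le> s\<^sup>2 * A - 2 * s * I + B" for s
  proof -
    have "0 \<le> (\<integral>x. (s * norm (f x) - norm (g x))\<^sup>2 \<partial>M)" by simp
    also have "\<dots> = (\<integral>x. s\<^sup>2 * (norm (f x))\<^sup>2 - 2 * s * (norm (f x) * norm (g x)) + (norm (g x))\<^sup>2 \<partial>M)"
      by (simp add: power2_eq_square algebra_simps)
    also have "\<dots> = s\<^sup>2 * A - 2 * s * I + B"
      using int by (simp add: A_def B_def I_def)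
    finally show ?thesis .
  qed
  have "I\<^sup>2 \<le> A * B"
  proof (cases "A = 0")
    case True
    have "I = 0"
    proof (rule ccontr)
      assume "I \<noteq> 0"
      \<comment> \<open>With A = 0 the polynomial is linear in s, and at this s its value is
        -1.\<close>
      then show False using quad[of "(B + 1) / (2 * I)"] True by simp
    qed
    then show ?thesis using True by simp
  next
    case False
    then have "A > 0" using A0 by simp
    \<comment> \<open>s = I / A is the minimizer, where the value is B - I^2 / A.\<close>
    then show ?thesis using quad[of "I / A"] by (simp add: power2_eq_square field_simps)
  qed
  then show ?thesis
    using real_le_rsqrt[of I "A * B"] by (simp add: norm2_def real_sqrt_mult A_def B_def I_def)
qed

lemma square_integrable_mult:
  fixes f g :: "'a \<Rightarrow> 'b::{real_normed_field,second_countable_topology,banach}"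
  assumes f: "square_integrable M f" and g: "square_integrable M g"
  shows "integrable M (\<lambda>x. f x * g x)"
    "norm (\<integral>x. f x * g x \<partial>M) \<le> norm2 M f * norm2 M g"
proof -
  have [measurable]: "f \<in> borel_measurable M" "g \<in> borel_measurable M"
    using assms by (auto simp: square_integrable_def)
  show 1: "integrable M (\<lambda>x. f x * g x)"
    by (rule Bochner_Integration.integrable_bound[OF square_integrable_norm_mult[OF f g]])
      (auto simp: norm_mult)
  have "norm (\<integral>x. f x * g x \<partial>M) \<le> (\<integral>x. norm (f x) * norm (g x) \<partial>M)"
    using integral_norm_bound[of M "\<lambda>x. f x * g x"] by (simp add: norm_mult)
  then show "norm (\<integral>x. f x * g x \<partial>M) \<le> norm2 M f * norm2 M g"
    using integral_norm_mult_le_norm2[OF f g] by linarith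
qed

lemma square_integrable_add:
  fixes f g :: "'a \<Rightarrow> 'b::{real_normed_vector,second_countable_topology}"
  assumes f: "square_integrable M f" and g: "square_integrable M g"
  shows "square_integrable M (\<lambda>x. f x + g x)"
    "norm2 M (\<lambda>x. f x + g x) \<le> norm2 M f + norm2 M g"
proof -
  have [measurable]: "f \<in> borel_measurable M" "g \<in> borel_measurable M"
    using assms by (auto simp: square_integrable_def)
  note int = square_integrable_norm_mult[OF f g] square_integrableD(2)[OF f] square_integrableD(2)[OF g]
  let ?w = "\<lambda>x. (norm (f x))\<^sup>2 + 2 * (norm (f x) * norm (g x)) + (norm (g x))\<^sup>2"
  have w: "integrable M ?w" using int by auto
  have le: "(norm (f x + g x))\<^sup>2 \<le> ?w x" for x
    using power_mono[OF norm_triangle_ineq[of "f x" "g x"], of 2]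
    by (simp add: power2_eq_square algebra_simps)
  show 1: "square_integrable M (\<lambda>x. f x + g x)"
    by (rule square_integrable_bound[OF w]) (auto simp: le)
  have "(norm2 M (\<lambda>x. f x + g x))\<^sup>2 \<le> (\<integral>x. ?w x \<partial>M)"
    unfolding norm2_power2 using square_integrableD(2)[OF 1] w le by (intro integral_mono) auto
  also have "\<dots> = (norm2 M f)\<^sup>2 + 2 * (\<integral>x. norm (f x) * norm (g x) \<partial>M) + (norm2 M g)\<^sup>2"
    using int by (simp add: norm2_power2)
  also have "\<dots> \<le> (norm2 M f + norm2 M g)\<^sup>2"
    using integral_norm_mult_le_norm2[OF f g] by (simp add: power2_sum)
  finally show "norm2 M (\<lambda>x. f x + g x) \<le> norm2 M f + norm2 M g"
    by (rule power2_le_imp_le) simp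
qed

lemma square_integrable_uminus:
  assumes "square_integrable M f"
  shows "square_integrable M (\<lambda>x. - f x)"
proof -
  have "(\<lambda>x. - f x) \<in> borel_measurable M"
    by (rule measurable_compose[OF square_integrableD(1)[OF assms]])
      (intro borel_measurable_continuous_onI continuous_intros)
  then show ?thesis using assms by (simp add: square_integrable_def)
qed

lemma square_integrable_diff:
  fixes f g :: "'a \<Rightarrow> 'b::{real_normed_vector,second_countable_topology}"
  assumes f: "square_integrable M f" and g: "square_integrable M g"
  shows "square_integrable M (\<lambda>x. f x - g x)"
    "norm2 M (\<lambda>x. f x - g x) \<le> norm2 M f + norm2 M g"
  using square_integrable_add[OF f square_integrable_uminus[OF g]] by (auto simp: norm2_def)

lemma square_integrable_bounded_mult:
  fixes f b :: "'a \<Rightarrow> 'b::{real_normed_field,second_countable_topology,banach}"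
  assumes f: "square_integrable M f" and b [measurable]: "b \<in> borel_measurable M"
    and C: "\<And>x. norm (b x) \<le> C"
  shows "square_integrable M (\<lambda>x. f x * b x)" "norm2 M (\<lambda>x. f x * b x) \<le> C * norm2 M f"
proof -
  have [measurable]: "f \<in> borel_measurable M" using f by (auto simp: square_integrable_def)
  have C0: "C \<ge> 0" using C[of undefined] norm_ge_zero[of "b undefined"] by linarith
  have le: "(norm (f x * b x))\<^sup>2 \<le> C\<^sup>2 * (norm (f x))\<^sup>2" for x
    using mult_right_mono[OF power_mono[OF C, of x 2], of "(norm (f x))\<^sup>2"]
    by (simp add: norm_mult power_mult_distrib mult.commute)
  show 1: "square_integrable M (\<lambda>x. f x * b x)"
    by (rule square_integrable_bound[where w = "\<lambda>x. C\<^sup>2 * (norm (f x))\<^sup>2"])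
      (use square_integrableD(2)[OF f] le in auto)
  have "(norm2 M (\<lambda>x. f x * b x))\<^sup>2 \<le> (\<integral>x. C\<^sup>2 * (norm (f x))\<^sup>2 \<partial>M)"
    unfolding norm2_power2 using square_integrableD(2)[OF 1] square_integrableD(2)[OF f] le
    by (intro integral_mono) auto
  also have "\<dots> = (C * norm2 M f)\<^sup>2"
    by (simp add: norm2_power2 power_mult_distrib)
  finally show "norm2 M (\<lambda>x. f x * b x) \<le> C * norm2 M f"
    by (rule power2_le_imp_le) (simp add: C0)
qed

text \<open>Continuity of the pairing in its first factor; this is how identities for approximants
  pass to L2 limits.\<close>

lemma tendsto_integral_mult_norm2:
  fixes f g :: "'a \<Rightarrow> 'b::{real_normed_field,second_countable_topology,banach}"
  assumes f: "square_integrable M f" and F: "\<And>k. square_integrable M (F k)"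
    and g: "square_integrable M g"
    and lim: "(\<lambda>k. norm2 M (\<lambda>x. F k x - f x)) \<longlonglongrightarrow> 0"
  shows "(\<lambda>k. \<integral>x. F k x * g x \<partial>M) \<longlonglongrightarrow> (\<integral>x. f x * g x \<partial>M)"
proof (rule metric_tendsto_imp_tendsto[where f = "\<lambda>k. norm2 M (\<lambda>x. F k x - f x) * norm2 M g" and a = 0])
  show "(\<lambda>k. norm2 M (\<lambda>x. F k x - f x) * norm2 M g) \<longlonglongrightarrow> 0"
    using tendsto_mult_left_zero[OF lim] .
  have "norm ((\<integral>x. F k x * g x \<partial>M) - (\<integral>x. f x * g x \<partial>M)) \<le> norm2 M (\<lambda>x. F k x - f x) * norm2 M g" for k
  proof -
    have "(\<integral>x. F k x * g x \<partial>M) - (\<integral>x. f x * g x \<partial>M) = (\<integral>x. (F k x - f x) * g x \<partial>M)"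
      using square_integrable_mult(1)[OF F g] square_integrable_mult(1)[OF f g]
      by (simp add: left_diff_distrib)
    then show ?thesis
      using square_integrable_mult(2)[OF square_integrable_diff(1)[OF F f] g] by simp
  qed
  then show "\<forall>\<^sub>F k in sequentially. dist (\<integral>x. F k x * g x \<partial>M) (\<integral>x. f x * g x \<partial>M)
      \<le> dist (norm2 M (\<lambda>x. F k x - f x) * norm2 M g) 0"
    by (auto simp: dist_norm)
qed

text \<open>Fatou's lemma for the squared norms. It serves twice: in the completeness proof, and to
  remove the Gaussian factor from the contraction inequality.\<close>

lemma norm2_Fatou:
  fixes f :: "nat \<Rightarrow> 'a \<Rightarrow> 'b::{real_normed_vector,second_countable_topology}"
  assumes f: "\<And>j. square_integrable M (f j)" and g [measurable]: "g \<in> borel_measurable M"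
    and lim: "AE x in M. (\<lambda>j. f j x) \<longlonglongrightarrow> g x"
    and C: "\<forall>\<^sub>F j in sequentially. norm2 M (f j) \<le> C"
  shows "square_integrable M g \<and> norm2 M g \<le> C"
proof -
  have [measurable]: "f j \<in> borel_measurable M" for j using f by (auto simp: square_integrable_def)
  obtain j where "norm2 M (f j) \<le> C" using C by (auto simp: eventually_sequentially)
  then have C0: "C \<ge> 0" using norm2_nonneg[of M "f j"] by linarith
  have "(\<integral>\<^sup>+x. ennreal ((norm (g x))\<^sup>2) \<partial>M) = (\<integral>\<^sup>+x. liminf (\<lambda>j. ennreal ((norm (f j x))\<^sup>2)) \<partial>M)"
  proof (rule nn_integral_cong_AE, use lim in eventually_elim)
    case (elim x)
    have "(\<lambda>j. ennreal ((norm (f j x))\<^sup>2)) \<longlonglongrightarrow> ennreal ((norm (g x))\<^sup>2)"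
      by (intro tendsto_ennrealI tendsto_intros elim)
    from lim_imp_Liminf[OF _ this] show ?case by simp
  qed
  also have "\<dots> \<le> liminf (\<lambda>j. \<integral>\<^sup>+x. ennreal ((norm (f j x))\<^sup>2) \<partial>M)"
    by (rule nn_integral_liminf) measurable
  also have "\<dots> \<le> limsup (\<lambda>j. \<integral>\<^sup>+x. ennreal ((norm (f j x))\<^sup>2) \<partial>M)"
    by (rule Liminf_le_Limsup) simp
  also have "\<dots> \<le> limsup (\<lambda>j::nat. ennreal (C\<^sup>2))"
  proof (rule Limsup_mono, use C in eventually_elim)
    case (elim j)
    have "(\<integral>\<^sup>+x. ennreal ((norm (f j x))\<^sup>2) \<partial>M) = ennreal ((norm2 M (f j))\<^sup>2)"
      unfolding norm2_power2 using square_integrableD(2)[OF f] by (intro nn_integral_eq_integral) auto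
    also have "\<dots> \<le> ennreal (C\<^sup>2)" using elim by (intro ennreal_leI power_mono) auto
    finally show ?case .
  qed
  finally have le: "(\<integral>\<^sup>+x. ennreal ((norm (g x))\<^sup>2) \<partial>M) \<le> ennreal (C\<^sup>2)" by (simp add: Limsup_const)
  then have int: "integrable M (\<lambda>x. (norm (g x))\<^sup>2)"
    by (intro integrableI_bounded) (auto simp: order_le_less_trans)
  have "ennreal (\<integral>x. (norm (g x))\<^sup>2 \<partial>M) \<le> ennreal (C\<^sup>2)"
    using le by (subst nn_integral_eq_integral[OF int, symmetric]) auto
  then have "(norm2 M g)\<^sup>2 \<le> C\<^sup>2" by (simp add: norm2_power2)
  then show ?thesis using int C0 by (auto simp: square_integrable_def dest: power2_le_imp_le)
qed

text \<open>Riesz-Fischer. A subsequence with rapidly shrinking increments converges almost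
  everywhere, and Fatou turns the Cauchy bound for F m - F (r j) into a bound for F m minus the
  limit.\<close>

theorem norm2_complete:
  fixes F :: "nat \<Rightarrow> 'a \<Rightarrow> 'b::{real_normed_vector,second_countable_topology,banach}"
  assumes F: "\<And>k. square_integrable M (F k)"
    and cauchy: "\<And>e. e > 0 \<Longrightarrow> \<exists>N. \<forall>m\<ge>N. \<forall>n\<ge>N. norm2 M (\<lambda>x. F m x - F n x) < e"
  obtains v where "square_integrable M v" "(\<lambda>k. norm2 M (\<lambda>x. F k x - v x)) \<longlonglongrightarrow> 0"
proof -
  have [measurable]: "F k \<in> borel_measurable M" for k using F by (auto simp: square_integrable_def)
  have "\<forall>k. \<exists>N. \<forall>m\<ge>N. \<forall>n\<ge>N. norm2 M (\<lambda>x. F m x - F n x) < (1/4)^k"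
    using cauchy by simp
  then obtain N where N: "\<And>k m n. m \<ge> N k \<Longrightarrow> n \<ge> N k \<Longrightarrow> norm2 M (\<lambda>x. F m x - F n x) < (1/4)^k"
    by metis
  \<comment> \<open>The sum dominates every N i with i \<le> k, so r k and r (Suc k) both lie beyond
    N k.\<close>
  define r where "r k = (\<Sum>i\<le>k. N i) + k" for k
  have rN: "N k \<le> r j" if "k \<le> j" for k j
  proof -
    have "N k \<le> (\<Sum>i\<le>j. N i)" using that by (intro member_le_sum) auto
    then show ?thesis by (simp add: r_def)
  qed
  define d where "d k x = norm (F (r (Suc k)) x - F (r k) x)" for k x
  have [measurable]: "d k \<in> borel_measurable M" for k unfolding d_def by measurable
  have dint: "integrable M (\<lambda>x. (d k x)\<^sup>2)" for k
    using square_integrableD(2)[OF square_integrable_diff(1)[OF F F]] by (simp add: d_def)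
  have dle: "(\<integral>x. (d k x)\<^sup>2 \<partial>M) \<le> (1/16)^k" for k
  proof -
    have "norm2 M (\<lambda>x. F (r (Suc k)) x - F (r k) x) \<le> (1/4)^k"
      using N[of k "r (Suc k)" "r k"] rN by (simp add: less_imp_le)
    then have "(norm2 M (\<lambda>x. F (r (Suc k)) x - F (r k) x))\<^sup>2 \<le> ((1/4)^k)\<^sup>2"
      by (intro power_mono) auto
    then show ?thesis unfolding norm2_power2
      by (simp add: d_def power_divide power_even_eq[symmetric] flip: power_mult)
         (simp add: power_mult mult.commute[of k])
  qed
  \<comment> \<open>Weighting the squared increments by \<open>4\<^sup>k\<close> makes them summable almost everywhere, so that the
    increments themselves decay geometrically.\<close>
  have "(\<integral>\<^sup>+x. (\<Sum>k. ennreal (4^k * (d k x)\<^sup>2)) \<partial>M) = (\<Sum>k. \<integral>\<^sup>+x. ennreal (4^k * (d k x)\<^sup>2) \<partial>M)"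
    by (rule nn_integral_suminf) measurable
  also have "\<dots> = (\<Sum>k. ennreal (\<integral>x. 4^k * (d k x)\<^sup>2 \<partial>M))"
    using dint by (intro suminf_cong nn_integral_eq_integral) auto
  also have "\<dots> \<le> (\<Sum>k. ennreal ((1/4)^k))"
  proof (rule suminf_le)
    fix k
    have "(\<integral>x. 4^k * (d k x)\<^sup>2 \<partial>M) \<le> 4^k * (1/16)^k" using dle by simp
    also have "(4::real)^k * (1/16)^k = (1/4)^k" by (simp flip: power_mult_distrib)
    finally show "ennreal (\<integral>x. 4^k * (d k x)\<^sup>2 \<partial>M) \<le> ennreal ((1/4)^k)" by (simp add: ennreal_leI)
  qed auto
  also have "\<dots> = ennreal (\<Sum>k. (1/4)^k)"
    by (rule suminf_ennreal2) (auto simp: summable_geometric)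
  also have "\<dots> < \<infinity>" by simp
  finally have "AE x in M. (\<Sum>k. ennreal (4^k * (d k x)\<^sup>2)) \<noteq> \<infinity>"
    by (intro nn_integral_noteq_infinite) auto
  then have conv: "AE x in M. convergent (\<lambda>k. F (r k) x)"
  proof eventually_elim
    case (elim x)
    then have "summable (\<lambda>k. 4^k * (d k x)\<^sup>2)"
      by (intro summable_suminf_not_top) auto
    then have "(\<lambda>k. 4^k * (d k x)\<^sup>2) \<longlonglongrightarrow> 0" by (rule summable_LIMSEQ_zero)
    then have "\<forall>\<^sub>F k in sequentially. 4^k * (d k x)\<^sup>2 < 1"
      by (rule order_tendstoD) simp
    then have "\<forall>\<^sub>F k in sequentially. norm (d k x) \<le> (1/2)^k"
    proof eventually_elim
      case (elim k)
      have "(d k x)\<^sup>2 \<le> ((1/2)^k)\<^sup>2"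
        using elim by (simp add: power_divide field_simps flip: power_mult power_mult_distrib)
          (simp add: power_mult mult.commute[of k] mult.commute[of "(d k x)\<^sup>2"])
      then show ?case using abs_le_square_iff[of "d k x" "(1/2)^k"] by simp
    qed
    then have "summable (\<lambda>k. d k x)"
      by (rule summable_comparison_test_ev) (simp add: summable_geometric)
    then have "summable (\<lambda>k. F (r (Suc k)) x - F (r k) x)"
      unfolding d_def by (rule summable_norm_cancel)
    then obtain s where "(\<lambda>n. \<Sum>k<n. F (r (Suc k)) x - F (r k) x) \<longlonglongrightarrow> s"
      by (auto simp: summable_def sums_def)
    then have "(\<lambda>n. F (r n) x - F (r 0) x) \<longlonglongrightarrow> s"
      by (simp only: sum_lessThan_telescope[of "\<lambda>k. F (r k) x"])
    from tendsto_add[OF this tendsto_const[of "F (r 0) x"]] show ?case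
      by (auto simp: convergent_def)
  qed
  define v where "v x = lim (\<lambda>k. F (r k) x)" for x
  have [measurable]: "v \<in> borel_measurable M" unfolding v_def by measurable
  have lim: "AE x in M. (\<lambda>k. F (r k) x) \<longlonglongrightarrow> v x"
    using conv by eventually_elim (simp add: v_def convergent_LIMSEQ_iff)
  have key: "square_integrable M (\<lambda>x. F m x - v x) \<and> norm2 M (\<lambda>x. F m x - v x) \<le> (1/4)^k"
    if m: "m \<ge> N k" for m k
  proof -
    show ?thesis
    proof (rule norm2_Fatou[where f = "\<lambda>j x. F m x - F (r j) x"])
      show "AE x in M. (\<lambda>j. F m x - F (r j) x) \<longlonglongrightarrow> F m x - v x"
        using lim by eventually_elim (intro tendsto_intros)
      show "\<forall>\<^sub>F j in sequentially. norm2 M (\<lambda>x. F m x - F (r j) x) \<le> (1/4)^k"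
        using N[OF m rN] less_imp_le eventually_ge_at_top[of k] by (blast intro: eventually_mono)
    qed (use square_integrable_diff(1)[OF F F] in auto)
  qed
  show ?thesis
  proof
    \<comment> \<open>\<open>key\<close> controls only differences F m - v; v itself is recovered as
      F (N 0) minus such a difference.\<close>
    have "square_integrable M (\<lambda>x. F (N 0) x - (F (N 0) x - v x))"
      by (rule square_integrable_diff(1)[OF F]) (use key[of 0 "N 0"] in auto)
    then show "square_integrable M v" by simp
    show "(\<lambda>k. norm2 M (\<lambda>x. F k x - v x)) \<longlonglongrightarrow> 0"
    proof (rule LIMSEQ_I)
      fix e :: real assume "e > 0"
      then obtain k where "(1/4::real)^k < e" using real_arch_pow_inv[of e "1/4"] by auto
      then show "\<exists>no. \<forall>n\<ge>no. norm (norm2 M (\<lambda>x. F n x - v x) - 0) < e"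
        using key[of k] by (intro exI[of _ "N k"]) force
    qed
  qed
qed

section \<open>Jordan decomposition\<close>

lemma borel_subsets_eq: "\<Omega> \<in> sets borel \<Longrightarrow> borel_subsets \<Omega> = sets (restrict_space borel \<Omega>)"
  by (auto simp: borel_subsets_def sets_restrict_space_iff)

lemma borel_subsets_mono: "B \<subseteq> E \<Longrightarrow> borel_subsets B \<subseteq> borel_subsets E"
  by (auto simp: borel_subsets_def)

text \<open>Shared by the positive and the total variation. Countable additivity is proved for the
  real-valued \<open>f\<close>, where series can be compared and subtracted, and then transferred to
  the \<open>ennreal\<close>-valued \<open>v\<close>.\<close>

lemma measure_of_borel_subsets:
  fixes v :: "'a::euclidean_space set \<Rightarrow> ennreal"
  assumes borel: "\<Omega> \<in> sets borel"
    and v: "\<And>B. B \<in> borel_subsets \<Omega> \<Longrightarrow> v B = ennreal (f B)"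
    and f: "\<And>B. 0 \<le> f B" "f {} = 0"
    and sums: "\<And>B :: nat \<Rightarrow> 'a set. range B \<subseteq> borel_subsets \<Omega> \<Longrightarrow> disjoint_family B \<Longrightarrow>
        (\<lambda>i. f (B i)) sums f (\<Union>i. B i)"
  shows "space (measure_of \<Omega> (borel_subsets \<Omega>) v) = \<Omega>"
    and "sets (measure_of \<Omega> (borel_subsets \<Omega>) v) = borel_subsets \<Omega>"
    and "B \<in> borel_subsets \<Omega> \<Longrightarrow> emeasure (measure_of \<Omega> (borel_subsets \<Omega>) v) B = ennreal (f B)"
proof -
  interpret sigma_algebra \<Omega> "borel_subsets \<Omega>"
    using sets.sigma_algebra_axioms[of "restrict_space borel \<Omega>"]
    by (simp add: borel_subsets_eq[OF borel] space_restrict_space)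
  show "space (measure_of \<Omega> (borel_subsets \<Omega>) v) = \<Omega>"
    using space_closed by (simp add: space_measure_of)
  show sets: "sets (measure_of \<Omega> (borel_subsets \<Omega>) v) = borel_subsets \<Omega>"
    using space_closed by (simp add: sets_measure_of sigma_sets_eq)
  show "emeasure (measure_of \<Omega> (borel_subsets \<Omega>) v) B = ennreal (f B)" if B: "B \<in> borel_subsets \<Omega>"
    unfolding v[OF B, symmetric]
  proof (rule emeasure_measure_of[OF refl])
    show "borel_subsets \<Omega> \<subseteq> Pow \<Omega>" by (rule space_closed)
    show "positive (sets (measure_of \<Omega> (borel_subsets \<Omega>) v)) v"
      unfolding sets positive_def using v[OF empty_sets] f(2) by simp
    show "countably_additive (sets (measure_of \<Omega> (borel_subsets \<Omega>) v)) v"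
    proof (rule countably_additiveI, unfold sets)
      fix A :: "nat \<Rightarrow> 'a set"
      assume A: "range A \<subseteq> borel_subsets \<Omega>" "disjoint_family A" "(\<Union>i. A i) \<in> borel_subsets \<Omega>"
      have "(\<Sum>i. v (A i)) = (\<Sum>i. ennreal (f (A i)))"
        using A(1) by (intro suminf_cong v) auto
      also have "\<dots> = ennreal (f (\<Union>i. A i))"
        using sums[OF A(1,2)] f(1) by (intro suminf_ennreal_eq) auto
      finally show "(\<Sum>i. v (A i)) = v (\<Union>i. A i)"
        using v[OF A(3)] by simp
    qed
  qed (simp add: B sets)
qed

text \<open>Countable additivity passes at once to negatives and linear combinations, so the Jordan
  decomposition is developed on this class; the negative variation is then the positive variation of
  another instance of the same locale.\<close>

locale signed_borel_measure =
  fixes \<Omega> :: "'a::euclidean_space set" and \<mu> :: "'a set \<Rightarrow> real"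
  assumes borel: "\<Omega> \<in> sets borel"
    and sums: "\<And>B :: nat \<Rightarrow> 'a set. range B \<subseteq> borel_subsets \<Omega> \<Longrightarrow> disjoint_family B \<Longrightarrow>
        (\<lambda>i. \<mu> (B i)) sums \<mu> (\<Union>i. B i)"
begin

text \<open>Infinitely many copies of the empty set form a disjoint family, and a constant series
  converges only if its terms vanish.\<close>

lemma empty [simp]: "\<mu> {} = 0"
proof -
  have "(\<lambda>i::nat. \<mu> {}) sums \<mu> {}"
    using sums[of "\<lambda>_. {}"] by (simp add: borel_subsets_def disjoint_family_on_def)
  then show ?thesis using summable_const_iff sums_summable by blast
qed

lemma Un:
  assumes "A \<in> borel_subsets \<Omega>" "B \<in> borel_subsets \<Omega>" "A \<inter> B = {}"
  shows "\<mu> (A \<union> B) = \<mu> A + \<mu> B"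
proof -
  have "range (binaryset A B) \<subseteq> borel_subsets \<Omega>"
    using assms by (auto simp: range_binaryset_eq borel_subsets_def)
  moreover have "disjoint_family (binaryset A B)"
    using assms(3) by (auto simp: disjoint_family_on_def binaryset_def)
  ultimately have "(\<lambda>i. \<mu> (binaryset A B i)) sums \<mu> (\<Union>i. binaryset A B i)"
    by (rule sums)
  then show ?thesis using binaryset_sums[of \<mu> A B] sums_unique2 by (fastforce simp: UN_binaryset_eq)
qed

lemma Diff:
  assumes "A \<in> borel_subsets \<Omega>" "B \<in> borel_subsets A"
  shows "\<mu> (A - B) = \<mu> A - \<mu> B"
proof -
  have "\<mu> (B \<union> (A - B)) = \<mu> B + \<mu> (A - B)"
    using assms by (intro Un) (auto simp: borel_subsets_def)
  moreover have "B \<union> (A - B) = A" using assms(2) by (auto simp: borel_subsets_def)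
  ultimately show ?thesis by simp
qed

section \<open>Boundedness of a signed measure and its positive variation\<close>

definition unbounded_on :: "'a set \<Rightarrow> bool" where
  "unbounded_on E \<longleftrightarrow> (\<forall>K. \<exists>C \<in> borel_subsets E. \<bar>\<mu> C\<bar> > K)"

lemma unbounded_on_split:
  assumes E: "E \<in> borel_subsets \<Omega>" and unb: "unbounded_on E"
  obtains E' where "E' \<in> borel_subsets E" "unbounded_on E'" "\<bar>\<mu> (E - E')\<bar> > 1"
proof -
  \<comment> \<open>The threshold makes both C and E - C larger than 1 in absolute measure.
    Whichever of the two remains unbounded is kept, and the part split off is large in either
    case.\<close>
  obtain C where C: "C \<in> borel_subsets E" "\<bar>\<mu> C\<bar> > 1 + \<bar>\<mu> E\<bar>"
    using unb by (auto simp: unbounded_on_def)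
  have C': "E - C \<in> borel_subsets E" using E C by (auto simp: borel_subsets_def)
  have mu: "\<mu> (E - C) = \<mu> E - \<mu> C" using Diff[OF E C(1)] .
  have "unbounded_on C \<or> unbounded_on (E - C)"
  proof (rule ccontr)
    assume "\<not> ?thesis"
    then obtain K1 K2 where K: "\<And>D. D \<in> borel_subsets C \<Longrightarrow> \<bar>\<mu> D\<bar> \<le> K1"
      "\<And>D. D \<in> borel_subsets (E - C) \<Longrightarrow> \<bar>\<mu> D\<bar> \<le> K2"
      unfolding unbounded_on_def by (meson not_less)
    have "\<bar>\<mu> D\<bar> \<le> K1 + K2" if "D \<in> borel_subsets E" for D
    proof -
      have "\<mu> ((D \<inter> C) \<union> (D - C)) = \<mu> (D \<inter> C) + \<mu> (D - C)"
        using that C(1) E by (intro Un) (auto simp: borel_subsets_def)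
      moreover have "(D \<inter> C) \<union> (D - C) = D" by auto
      moreover have "\<bar>\<mu> (D \<inter> C)\<bar> \<le> K1" "\<bar>\<mu> (D - C)\<bar> \<le> K2"
        using that C(1) E by (auto intro!: K simp: borel_subsets_def)
      ultimately show ?thesis by auto
    qed
    then show False using unb by (auto simp: unbounded_on_def not_less[symmetric])
  qed
  then show ?thesis
  proof
    assume "unbounded_on C"
    then show ?thesis using C mu by (intro that[of C]) auto
  next
    assume "unbounded_on (E - C)"
    moreover have "E - (E - C) = C" using C(1) by (auto simp: borel_subsets_def)
    ultimately show ?thesis using C C' by (intro that[of "E - C"]) auto
  qed
qed

text \<open>Otherwise one can split off infinitely many disjoint pieces of measure larger than \<open>1\<close>
  in absolute value.\<close>

lemma bounded: "\<exists>K. \<forall>C \<in> borel_subsets \<Omega>. \<bar>\<mu> C\<bar> \<le> K"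
proof (rule ccontr)
  assume "\<not> ?thesis"
  then have unb: "unbounded_on \<Omega>" by (auto simp: unbounded_on_def not_le)
  have "\<exists>E. \<forall>n. (E n \<in> borel_subsets \<Omega> \<and> unbounded_on (E n)) \<and>
      (E (Suc n) \<subseteq> E n \<and> \<bar>\<mu> (E n - E (Suc n))\<bar> > 1)"
  proof (rule dependent_nat_choice)
    show "\<exists>E. E \<in> borel_subsets \<Omega> \<and> unbounded_on E"
      using unb borel by (auto simp: borel_subsets_def)
    show "\<exists>y. (y \<in> borel_subsets \<Omega> \<and> unbounded_on y) \<and> y \<subseteq> x \<and> 1 < \<bar>\<mu> (x - y)\<bar>"
      if "x \<in> borel_subsets \<Omega> \<and> unbounded_on x" for x and n :: nat
      using that unbounded_on_split[of x] unfolding borel_subsets_def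
      by (smt (verit) mem_Collect_eq order_trans)
  qed
  then obtain E where E: "\<And>n. E n \<in> borel_subsets \<Omega>" "\<And>n. E (Suc n) \<subseteq> E n"
    "\<And>n. \<bar>\<mu> (E n - E (Suc n))\<bar> > 1" by blast
  have dec: "decseq E" using E(2) by (rule decseq_SucI)
  have "disjoint_family (\<lambda>n. E n - E (Suc n))"
  proof -
    have "(E m - E (Suc m)) \<inter> (E n - E (Suc n)) = {}" if "m < n" for m n
      using decseqD[OF dec, of "Suc m" n] that by auto
    then show ?thesis unfolding disjoint_family_on_def by (metis Int_commute linorder_neqE_nat)
  qed
  moreover have "range (\<lambda>n. E n - E (Suc n)) \<subseteq> borel_subsets \<Omega>"
    using E(1) by (auto simp: borel_subsets_def)
  ultimately have "summable (\<lambda>n. \<mu> (E n - E (Suc n)))"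
    using sums by (blast intro: sums_summable)
  then have "(\<lambda>n. \<mu> (E n - E (Suc n))) \<longlonglongrightarrow> 0" by (rule summable_LIMSEQ_zero)
  then have "\<forall>\<^sub>F n in sequentially. \<bar>\<mu> (E n - E (Suc n))\<bar> < 1"
    by (auto dest!: tendstoD[where e=1])
  then show False using E(3) by (auto simp: eventually_sequentially) (meson less_asym order_refl)
qed

text \<open>By \<open>bounded\<close> nothing is lost on Borel subsets of \<Omega>, and with real
  values the two variations can be subtracted.\<close>

definition pvar :: "'a set \<Rightarrow> real" where "pvar B = enn2real (pos_variation \<mu> B)"

lemma pos_variation_finite:
  assumes "B \<in> borel_subsets \<Omega>"
  shows "pos_variation \<mu> B = ennreal (pvar B)"
proof -
  obtain K where K: "\<And>C. C \<in> borel_subsets \<Omega> \<Longrightarrow> \<bar>\<mu> C\<bar> \<le> K" using bounded by auto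
  have "pos_variation \<mu> B \<le> ennreal K" unfolding pos_variation_def
    using assms by (intro SUP_least ennreal_leI) (metis K abs_le_D1 borel_subsets_def borel_subsets_mono mem_Collect_eq subsetD)
  then have "pos_variation \<mu> B < top" by (simp add: order_le_less_trans)
  then show ?thesis unfolding pvar_def by simp
qed

lemma le_pvar:
  assumes "B \<in> borel_subsets \<Omega>" "C \<in> borel_subsets B"
  shows "\<mu> C \<le> pvar B"
proof -
  have "ennreal (\<mu> C) \<le> ennreal (pvar B)"
    unfolding pos_variation_finite[OF assms(1), symmetric] pos_variation_def
    by (rule SUP_upper) fact
  then show ?thesis by (simp add: pvar_def ennreal_le_iff)
qed

lemma pvar_nonneg: "0 \<le> pvar B" by (simp add: pvar_def)

lemma pvar_le:
  assumes "B \<in> borel_subsets \<Omega>" "0 \<le> K" "\<And>C. C \<in> borel_subsets B \<Longrightarrow> \<mu> C \<le> K"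
  shows "pvar B \<le> K"
proof -
  have "pos_variation \<mu> B \<le> ennreal K" unfolding pos_variation_def
    using assms(3) by (intro SUP_least ennreal_leI) auto
  then show ?thesis using assms by (simp add: pos_variation_finite ennreal_le_iff)
qed

text \<open>Superadditivity comes from taking the supremum over C with D fixed, and then over D.
  Since \<open>pvar_le\<close> asks for a nonnegative bound, the competitor {} has to be tried as
  well.\<close>

lemma pvar_Un_ge:
  assumes A: "A \<in> borel_subsets \<Omega>" and B: "B \<in> borel_subsets \<Omega>" and "A \<inter> B = {}"
  shows "pvar A + pvar B \<le> pvar (A \<union> B)"
proof -
  have AB: "A \<union> B \<in> borel_subsets \<Omega>" using A B by (auto simp: borel_subsets_def)
  have *: "\<mu> C + \<mu> D \<le> pvar (A \<union> B)" if "C \<in> borel_subsets A" "D \<in> borel_subsets B" for C D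
  proof -
    have "\<mu> C + \<mu> D = \<mu> (C \<union> D)"
      using that assms by (intro Un[symmetric]) (auto simp: borel_subsets_def)
    also have "\<dots> \<le> pvar (A \<union> B)"
      using that by (intro le_pvar[OF AB]) (auto simp: borel_subsets_def)
    finally show ?thesis .
  qed
  have "pvar A \<le> pvar (A \<union> B) - \<mu> D" if D: "D \<in> borel_subsets B" for D
  proof (rule pvar_le[OF A])
    show "0 \<le> pvar (A \<union> B) - \<mu> D" using *[OF _ D, of "{}"] by (simp add: borel_subsets_def)
    show "\<mu> C \<le> pvar (A \<union> B) - \<mu> D" if "C \<in> borel_subsets A" for C using *[OF that D] by simp
  qed
  moreover have "pvar A \<le> pvar (A \<union> B)"
  proof (rule pvar_le[OF A pvar_nonneg])
    show "\<mu> C \<le> pvar (A \<union> B)" if "C \<in> borel_subsets A" for C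
      using *[OF that, of "{}"] by (simp add: borel_subsets_def)
  qed
  ultimately have "pvar B \<le> pvar (A \<union> B) - pvar A"
    by (intro pvar_le[OF B]) (auto simp: algebra_simps)
  then show ?thesis by simp
qed

lemma sum_pvar_le:
  fixes B :: "nat \<Rightarrow> 'a set"
  assumes B: "range B \<subseteq> borel_subsets \<Omega>" "disjoint_family B"
  shows "(\<Sum>i<n. pvar (B i)) \<le> pvar (\<Union>i<n. B i)"
proof (induction n)
  case 0
  then show ?case by (simp add: pvar_nonneg)
next
  case (Suc n)
  have "pvar (\<Union>i<n. B i) + pvar (B n) \<le> pvar ((\<Union>i<n. B i) \<union> B n)"
  proof (rule pvar_Un_ge)
    show "(\<Union>i<n. B i) \<in> borel_subsets \<Omega>" using B(1) by (auto simp: borel_subsets_def)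
    show "B n \<in> borel_subsets \<Omega>" using B(1) by auto
    have "B i \<inter> B n = {}" if "i < n" for i
      using B(2) that unfolding disjoint_family_on_def by (metis UNIV_I less_irrefl)
    then show "(\<Union>i<n. B i) \<inter> B n = {}" by blast
  qed
  also have "(\<Union>i<n. B i) \<union> B n = (\<Union>i<Suc n. B i)" by (auto simp: lessThan_Suc)
  finally show ?case using Suc by simp
qed

lemma pvar_mono:
  assumes "A \<in> borel_subsets \<Omega>" "B \<in> borel_subsets A"
  shows "pvar B \<le> pvar A"
proof (rule pvar_le[OF _ pvar_nonneg])
  show "B \<in> borel_subsets \<Omega>" using assms by (auto simp: borel_subsets_def)
  show "\<mu> C \<le> pvar A" if "C \<in> borel_subsets B" for C
    using that assms by (intro le_pvar) (auto simp: borel_subsets_def)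
qed

text \<open>Superadditivity bounds the partial sums from above. For the converse, a competitor C of
  the union is cut into the pieces C \<inter> B i, each of which competes for
  \<open>pvar (B i)\<close>.\<close>

lemma pvar_sums:
  fixes B :: "nat \<Rightarrow> 'a set"
  assumes B: "range B \<subseteq> borel_subsets \<Omega>" "disjoint_family B"
  shows "(\<lambda>i. pvar (B i)) sums pvar (\<Union>i. B i)"
proof -
  have U: "(\<Union>i. B i) \<in> borel_subsets \<Omega>" using B by (auto simp: borel_subsets_def)
  have le: "(\<Sum>i<n. pvar (B i)) \<le> pvar (\<Union>i. B i)" for n
    by (rule order_trans[OF sum_pvar_le[OF B] pvar_mono[OF U]])
      (use B in \<open>auto simp: borel_subsets_def\<close>)
  have summ: "summable (\<lambda>i. pvar (B i))"
    by (rule bounded_imp_summable[OF pvar_nonneg, of _ "pvar (\<Union>i. B i)"])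
      (metis le lessThan_Suc_atMost)
  have "pvar (\<Union>i. B i) \<le> (\<Sum>i. pvar (B i))"
  proof (rule pvar_le[OF U suminf_nonneg[OF summ pvar_nonneg]])
    fix C assume C: "C \<in> borel_subsets (\<Union>i. B i)"
    have "(\<lambda>i. \<mu> (C \<inter> B i)) sums \<mu> (\<Union>i. C \<inter> B i)"
      using B C by (intro sums disjoint_family_on_bisimulation[OF B(2)]) (auto simp: borel_subsets_def)
    moreover have "(\<Union>i. C \<inter> B i) = C" using C by (auto simp: borel_subsets_def)
    ultimately have s: "(\<lambda>i. \<mu> (C \<inter> B i)) sums \<mu> C" by simp
    show "\<mu> C \<le> (\<Sum>i. pvar (B i))"
      using B C by (intro sums_le[OF _ s summable_sums[OF summ]] le_pvar) (auto simp: borel_subsets_def)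
  qed
  moreover have "(\<Sum>i. pvar (B i)) \<le> pvar (\<Union>i. B i)"
    by (rule suminf_le_const[OF summ le])
  ultimately have "pvar (\<Union>i. B i) = (\<Sum>i. pvar (B i))" by (rule order_antisym)
  then show ?thesis using summable_sums[OF summ] by simp
qed

lemma pos_variation_empty: "pvar {} = 0"
proof -
  have "borel_subsets {} = {{}::'a set}" by (auto simp: borel_subsets_def)
  then show ?thesis by (simp add: pvar_def pos_variation_def)
qed

lemma emeasure_space_sets_pos_part:
  shows space_pos_part: "space (pos_part \<Omega> \<mu>) = \<Omega>"
    and sets_pos_part: "sets (pos_part \<Omega> \<mu>) = borel_subsets \<Omega>"
    and emeasure_pos_part: "B \<in> borel_subsets \<Omega> \<Longrightarrow> emeasure (pos_part \<Omega> \<mu>) B = ennreal (pvar B)"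
  unfolding pos_part_def
  using measure_of_borel_subsets[OF borel, of "pos_variation \<mu>" pvar,
      OF pos_variation_finite pvar_nonneg pos_variation_empty pvar_sums]
  by blast+

lemma measure_pos_part: "B \<in> borel_subsets \<Omega> \<Longrightarrow> measure (pos_part \<Omega> \<mu>) B = pvar B"
  using emeasure_pos_part by (simp add: measure_def pvar_nonneg)

lemma finite_measure_pos_part: "finite_measure (pos_part \<Omega> \<mu>)"
proof
  have "\<Omega> \<in> borel_subsets \<Omega>" using borel by (simp add: borel_subsets_def)
  then show "emeasure (pos_part \<Omega> \<mu>) (space (pos_part \<Omega> \<mu>)) \<noteq> \<infinity>"
    by (simp add: emeasure_space_sets_pos_part)
qed

end

lemma signed_borel_measure_lincomb:
  assumes "signed_borel_measure \<Omega> \<mu>" "signed_borel_measure \<Omega> \<nu>"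
  shows "signed_borel_measure \<Omega> (\<lambda>B. a * \<mu> B + b * \<nu> B)"
proof
  show "\<Omega> \<in> sets borel" using assms(1) by (simp add: signed_borel_measure_def)
  show "(\<lambda>i. a * \<mu> (B i) + b * \<nu> (B i)) sums (a * \<mu> (\<Union>i. B i) + b * \<nu> (\<Union>i. B i))"
    if "range B \<subseteq> borel_subsets \<Omega>" "disjoint_family B" for B :: "nat \<Rightarrow> 'a set"
    by (intro sums_add sums_mult signed_borel_measure.sums[OF assms(1)]
        signed_borel_measure.sums[OF assms(2)] that)
qed

lemma signed_borel_measure_uminus:
  assumes "signed_borel_measure \<Omega> \<mu>"
  shows "signed_borel_measure \<Omega> (\<lambda>B. - \<mu> B)"
  using signed_borel_measure_lincomb[OF assms assms, of "-1" 0] by simp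

lemma measurable_pos_part:
  assumes "signed_borel_measure \<Omega> \<mu>" "\<phi> \<in> borel_measurable borel"
  shows "\<phi> \<in> borel_measurable (pos_part \<Omega> \<mu>)"
proof -
  interpret signed_borel_measure \<Omega> \<mu> by fact
  have "sets (pos_part \<Omega> \<mu>) = sets (restrict_space borel \<Omega>)"
    by (simp add: sets_pos_part borel_subsets_eq[OF borel])
  then show ?thesis
    using measurable_restrict_space1[OF assms(2), of \<Omega>] measurable_cong_sets by blast
qed

section \<open>The Jordan identity and linearity of the dual product in the measure\<close>

context signed_borel_measure
begin

interpretation neg: signed_borel_measure \<Omega> "\<lambda>B. - \<mu> B"
  by (rule signed_borel_measure_uminus) unfold_locales

text \<open>Complementation exchanges the two suprema: a competitor C for \<mu> corresponds to B - C
  for -\<mu>, because \<mu> C = \<mu> B - \<mu> (B - C).\<close>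

lemma pvar_diff:
  assumes B: "B \<in> borel_subsets \<Omega>"
  shows "pvar B - neg.pvar B = \<mu> B"
proof -
  have *: "B - C \<in> borel_subsets B" if "C \<in> borel_subsets B" for C
    using that B by (auto simp: borel_subsets_def)
  have BB: "B \<in> borel_subsets B" using B by (auto simp: borel_subsets_def)
  have "pvar B \<le> \<mu> B + neg.pvar B"
  proof (rule pvar_le[OF B])
    show "0 \<le> \<mu> B + neg.pvar B" using neg.le_pvar[OF B BB] by simp
    show "\<mu> C \<le> \<mu> B + neg.pvar B" if "C \<in> borel_subsets B" for C
      using neg.le_pvar[OF B *[OF that]] Diff[OF B that] by simp
  qed
  moreover have "neg.pvar B \<le> pvar B - \<mu> B"
  proof (rule neg.pvar_le[OF B])
    show "0 \<le> pvar B - \<mu> B" using le_pvar[OF B BB] by simp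
    show "- \<mu> C \<le> pvar B - \<mu> B" if "C \<in> borel_subsets B" for C
      using le_pvar[OF B *[OF that]] Diff[OF B that] by simp
  qed
  ultimately show ?thesis by simp
qed

lemma integrable_pos_part:
  fixes \<phi> :: "'a \<Rightarrow> real"
  assumes \<phi>: "\<phi> \<in> borel_measurable borel" and K: "\<And>x. \<bar>\<phi> x\<bar> \<le> K"
  shows "integrable (pos_part \<Omega> \<mu>) \<phi>"
  using K measurable_pos_part[OF signed_borel_measure_axioms \<phi>]
  by (intro finite_measure.integrable_const_bound[OF finite_measure_pos_part, of _ K]) auto

lemma integral_pos_part_bound:
  fixes \<phi> :: "'a \<Rightarrow> real"
  assumes \<phi>: "\<phi> \<in> borel_measurable borel" and K: "\<And>x. \<bar>\<phi> x\<bar> \<le> K"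
  shows "\<bar>\<integral>x. \<phi> x \<partial>pos_part \<Omega> \<mu>\<bar> \<le> K * pvar \<Omega>"
proof -
  have "norm (\<integral>x. \<phi> x \<partial>pos_part \<Omega> \<mu>) \<le> (\<integral>x. K \<partial>pos_part \<Omega> \<mu>)"
    by (rule Bochner_Integration.integral_norm_bound_integral[OF integrable_pos_part[OF assms]
          finite_measure.integrable_const[OF finite_measure_pos_part]]) (simp add: K)
  then show ?thesis
    using borel by (simp add: space_pos_part measure_pos_part borel_subsets_def mult.commute)
qed

lemma radon_norm_eq: "radon_norm \<Omega> \<mu> = pvar \<Omega> + neg.pvar \<Omega>"
proof -
  have "\<Omega> \<in> borel_subsets \<Omega>" using borel by (simp add: borel_subsets_def)
  then have "total_variation \<mu> \<Omega> = ennreal (pvar \<Omega> + neg.pvar \<Omega>)"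
    unfolding total_variation_def ennreal_plus[OF pvar_nonneg neg.pvar_nonneg]
    using pos_variation_finite neg.pos_variation_finite by simp
  then show ?thesis
    by (simp add: radon_norm_def pvar_nonneg neg.pvar_nonneg del: ennreal_plus)
qed

lemma dual_product_bound:
  fixes \<phi> :: "'a \<Rightarrow> real"
  assumes \<phi>: "\<phi> \<in> borel_measurable borel" and K: "\<And>x. \<bar>\<phi> x\<bar> \<le> K"
  shows "\<bar>dual_product \<Omega> \<phi> \<mu>\<bar> \<le> K * radon_norm \<Omega> \<mu>"
  using integral_pos_part_bound[OF assms] signed_borel_measure.integral_pos_part_bound[OF neg.signed_borel_measure_axioms assms]
  by (simp add: dual_product_def neg_part_def radon_norm_eq distrib_left)

text \<open>For simple functions the Jordan parts recombine into \<mu> itself, which makes the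
  dependence on \<mu> visibly linear.\<close>

lemma dual_product_simple:
  assumes s: "simple_function (restrict_space borel \<Omega>) s"
  shows "dual_product \<Omega> s \<mu> = (\<Sum>y\<in>s ` \<Omega>. \<mu> {x \<in> \<Omega>. s x = y} * y)"
proof -
  have sets: "sets (restrict_space borel \<Omega>) = borel_subsets \<Omega>"
    by (simp add: borel_subsets_eq[OF borel])
  have *: "(\<integral>x. s x \<partial>pos_part \<Omega> \<nu>) = (\<Sum>y\<in>s ` \<Omega>. measure (pos_part \<Omega> \<nu>) {x \<in> \<Omega>. s x = y} * y)"
    if "signed_borel_measure \<Omega> \<nu>" for \<nu>
  proof -
    interpret \<nu>: signed_borel_measure \<Omega> \<nu> by fact
    interpret finite_measure "pos_part \<Omega> \<nu>" by (rule \<nu>.finite_measure_pos_part)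
    have "simple_function (pos_part \<Omega> \<nu>) s"
      using s by (simp add: simple_function_def \<nu>.sets_pos_part \<nu>.space_pos_part sets space_restrict_space)
    then have "Bochner_Integration.simple_bochner_integrable (pos_part \<Omega> \<nu>) s"
      by (rule simple_bochner_integrable.intros) simp
    then have "Bochner_Integration.simple_bochner_integral (pos_part \<Omega> \<nu>) s = (\<integral>x. s x \<partial>pos_part \<Omega> \<nu>)"
      by (rule simple_bochner_integrable_eq_integral)
    from this[symmetric] show ?thesis
      by (simp add: Bochner_Integration.simple_bochner_integral_def \<nu>.space_pos_part)
  qed
  have m: "{x \<in> \<Omega>. s x = y} \<in> borel_subsets \<Omega>" if "y \<in> s ` \<Omega>" for y
  proof -
    have "s -` {y} \<inter> \<Omega> \<in> borel_subsets \<Omega>"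
      using s that by (auto simp: simple_function_def sets space_restrict_space)
    also have "s -` {y} \<inter> \<Omega> = {x \<in> \<Omega>. s x = y}" by auto
    finally show ?thesis .
  qed
  have "dual_product \<Omega> s \<mu> = (\<Sum>y\<in>s ` \<Omega>. (pvar {x \<in> \<Omega>. s x = y} - neg.pvar {x \<in> \<Omega>. s x = y}) * y)"
    unfolding dual_product_def neg_part_def *[OF signed_borel_measure_axioms]
      *[OF neg.signed_borel_measure_axioms]
    using m by (simp add: left_diff_distrib sum_subtractf measure_pos_part neg.measure_pos_part)
  then show ?thesis using m by (simp add: pvar_diff)
qed

lemma dual_product_tendsto:
  assumes s: "\<And>i. simple_function (restrict_space borel \<Omega>) (s i)"
    and lim: "\<And>x. x \<in> \<Omega> \<Longrightarrow> (\<lambda>i. s i x) \<longlonglongrightarrow> \<phi> x"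
    and K: "\<And>i x. x \<in> \<Omega> \<Longrightarrow> \<bar>s i x\<bar> \<le> K" and \<phi>: "\<phi> \<in> borel_measurable borel"
  shows "(\<lambda>i. dual_product \<Omega> (s i) \<mu>) \<longlonglongrightarrow> dual_product \<Omega> \<phi> \<mu>"
proof -
  have *: "(\<lambda>i. \<integral>x. s i x \<partial>pos_part \<Omega> \<nu>) \<longlonglongrightarrow> (\<integral>x. \<phi> x \<partial>pos_part \<Omega> \<nu>)"
    if "signed_borel_measure \<Omega> \<nu>" for \<nu>
  proof -
    interpret \<nu>: signed_borel_measure \<Omega> \<nu> by fact
    interpret finite_measure "pos_part \<Omega> \<nu>" by (rule \<nu>.finite_measure_pos_part)
    have "simple_function (pos_part \<Omega> \<nu>) (s i)" for i
      using s[of i] by (simp add: simple_function_def \<nu>.sets_pos_part \<nu>.space_pos_part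
          borel_subsets_eq[OF borel] space_restrict_space)
    then have "s i \<in> borel_measurable (pos_part \<Omega> \<nu>)" for i by (rule borel_measurable_simple_function)
    then show ?thesis
      using measurable_pos_part[OF that \<phi>] lim K
      by (intro integral_dominated_convergence[where w = "\<lambda>_. K"]) (auto simp: \<nu>.space_pos_part)
  qed
  show ?thesis unfolding dual_product_def neg_part_def
    by (rule tendsto_diff[OF *[OF signed_borel_measure_axioms] *[OF neg.signed_borel_measure_axioms]])
qed

end

text \<open>The Jordan parts of a linear combination are in general not the linear combinations of
  the Jordan parts. Linearity is therefore read off for simple functions, where only values of the
  measure occur, and carried over to \<phi> by dominated convergence.\<close>

lemma dual_product_lincomb:
  assumes \<mu>: "signed_borel_measure \<Omega> \<mu>" and \<nu>: "signed_borel_measure \<Omega> \<nu>"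
    and \<phi>: "\<phi> \<in> borel_measurable borel" and K: "\<And>x. \<bar>\<phi> x\<bar> \<le> K"
  shows "dual_product \<Omega> \<phi> (\<lambda>B. a * \<mu> B + b * \<nu> B)
    = a * dual_product \<Omega> \<phi> \<mu> + b * dual_product \<Omega> \<phi> \<nu>"
proof -
  interpret \<mu>: signed_borel_measure \<Omega> \<mu> by fact
  interpret \<nu>: signed_borel_measure \<Omega> \<nu> by fact
  interpret l: signed_borel_measure \<Omega> "\<lambda>B. a * \<mu> B + b * \<nu> B"
    by (rule signed_borel_measure_lincomb) fact+
  obtain s where s': "\<forall>i. simple_function (restrict_space borel \<Omega>) (s i)"
    "\<forall>x\<in>\<Omega>. (\<lambda>i. s i x) \<longlonglongrightarrow> \<phi> x" "\<forall>i. \<forall>x\<in>\<Omega>. dist (s i x) 0 \<le> 2 * dist (\<phi> x) 0"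
    using borel_measurable_implies_sequence_metric[OF measurable_restrict_space1[OF \<phi>, of \<Omega>], of 0]
    unfolding space_restrict_space space_borel Int_UNIV_right by blast
  have s: "\<And>i. simple_function (restrict_space borel \<Omega>) (s i)"
    "\<And>x. x \<in> \<Omega> \<Longrightarrow> (\<lambda>i. s i x) \<longlonglongrightarrow> \<phi> x" "\<And>i x. x \<in> \<Omega> \<Longrightarrow> dist (s i x) 0 \<le> 2 * dist (\<phi> x) 0"
    using s' by blast+
  have sK: "\<bar>s i x\<bar> \<le> 2 * K" if "x \<in> \<Omega>" for i x using s(3)[OF that, of i] K[of x] by simp
  have eq: "dual_product \<Omega> (s i) (\<lambda>B. a * \<mu> B + b * \<nu> B)
      = a * dual_product \<Omega> (s i) \<mu> + b * dual_product \<Omega> (s i) \<nu>" for i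
    unfolding l.dual_product_simple[OF s(1)] \<mu>.dual_product_simple[OF s(1)] \<nu>.dual_product_simple[OF s(1)]
    by (simp add: distrib_right sum.distrib sum_distrib_left mult.assoc)
  have "(\<lambda>i. a * dual_product \<Omega> (s i) \<mu> + b * dual_product \<Omega> (s i) \<nu>)
      \<longlonglongrightarrow> a * dual_product \<Omega> \<phi> \<mu> + b * dual_product \<Omega> \<phi> \<nu>"
    using s(1,2) sK \<phi> by (intro tendsto_intros \<mu>.dual_product_tendsto \<nu>.dual_product_tendsto)
  moreover have "(\<lambda>i. dual_product \<Omega> (s i) (\<lambda>B. a * \<mu> B + b * \<nu> B))
      \<longlonglongrightarrow> dual_product \<Omega> \<phi> (\<lambda>B. a * \<mu> B + b * \<nu> B)"
    using s(1,2) sK \<phi> by (rule l.dual_product_tendsto)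
  ultimately show ?thesis unfolding eq by (rule LIMSEQ_unique[symmetric])
qed

text \<open>The polar decomposition \<open>\<mu> = \<sigma> |\<mu>|\<close>; the sign \<open>\<sigma>\<close> comes from a Hahn decomposition.\<close>

lemma (in signed_borel_measure) polar_decomposition:
  obtains M \<sigma> where "finite_measure M" "sets M = sets (restrict_space borel \<Omega>)"
    "\<sigma> \<in> borel_measurable M" "\<And>x. \<bar>\<sigma> x\<bar> \<le> (1::real)"
    "\<And>\<phi> K. \<phi> \<in> borel_measurable borel \<Longrightarrow> (\<And>x. \<bar>\<phi> x\<bar> \<le> K) \<Longrightarrow>
       dual_product \<Omega> \<phi> \<mu> = (\<integral>x. \<phi> x * \<sigma> x \<partial>M)"
proof -
  interpret neg: signed_borel_measure \<Omega> "\<lambda>B. - \<mu> B"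
    by (rule signed_borel_measure_uminus) unfold_locales
  define P where "P = pos_part \<Omega> \<mu>"
  define N where "N = pos_part \<Omega> (\<lambda>B. - \<mu> B)"
  have sets: "sets P = borel_subsets \<Omega>" "sets N = borel_subsets \<Omega>"
    by (simp_all add: P_def N_def sets_pos_part neg.sets_pos_part)
  have fin: "finite_measure P" "finite_measure N"
    by (simp_all add: P_def N_def finite_measure_pos_part neg.finite_measure_pos_part)
  have em: "emeasure P B = ennreal (pvar B)" "emeasure N B = ennreal (neg.pvar B)"
    if "B \<in> borel_subsets \<Omega>" for B
    using that by (simp_all add: P_def N_def emeasure_pos_part neg.emeasure_pos_part)
  obtain Y where Y: "Y \<in> borel_subsets \<Omega>"
    "\<And>X. X \<in> borel_subsets \<Omega> \<Longrightarrow> X \<subseteq> Y \<Longrightarrow> emeasure N X \<le> emeasure P X"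
    "\<And>X. X \<in> borel_subsets \<Omega> \<Longrightarrow> X \<inter> Y = {} \<Longrightarrow> emeasure P X \<le> emeasure N X"
    using finite_unsigned_Hahn_decomposition[OF fin] unfolding sets by auto
  \<comment> \<open>Subsets C of Y satisfy N C \<le> P C, that is \<mu> C \<ge> 0, so the supremum
    of -\<mu> below X is attained at the empty set. Outside Y the roles are exchanged.\<close>
  have ON: "neg.pvar X = 0" if X: "X \<in> borel_subsets \<Omega>" "X \<subseteq> Y" for X
  proof -
    have "- \<mu> C \<le> 0" if C: "C \<in> borel_subsets X" for C
    proof -
      have C': "C \<in> borel_subsets \<Omega>" "C \<subseteq> Y" using X C by (auto simp: borel_subsets_def)
      from Y(2)[OF C'] show ?thesis
        using pvar_diff[OF C'(1)] pvar_nonneg by (simp add: em C'(1) ennreal_le_iff)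
    qed
    then have "neg.pvar X \<le> 0" by (intro neg.pvar_le[OF X(1)]) auto
    then show ?thesis using neg.pvar_nonneg[of X] by linarith
  qed
  have OP: "pvar X = 0" if X: "X \<in> borel_subsets \<Omega>" "X \<inter> Y = {}" for X
  proof -
    have "\<mu> C \<le> 0" if C: "C \<in> borel_subsets X" for C
    proof -
      have C': "C \<in> borel_subsets \<Omega>" "C \<inter> Y = {}" using X C by (auto simp: borel_subsets_def)
      from Y(3)[OF C'] show ?thesis
        using pvar_diff[OF C'(1)] neg.pvar_nonneg by (simp add: em C'(1) ennreal_le_iff)
    qed
    then have "pvar X \<le> 0" by (intro pvar_le[OF X(1)]) auto
    then show ?thesis using pvar_nonneg[of X] by linarith
  qed
  define M where "M = measure_of \<Omega> (borel_subsets \<Omega>) (total_variation \<mu>)"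
  have M: "space M = \<Omega>" "sets M = borel_subsets \<Omega>"
    "B \<in> borel_subsets \<Omega> \<Longrightarrow> emeasure M B = ennreal (pvar B + neg.pvar B)" for B
    unfolding M_def
    by (rule measure_of_borel_subsets[OF borel, where f = "\<lambda>B. pvar B + neg.pvar B"];
      simp add: total_variation_def pos_variation_finite neg.pos_variation_finite pvar_nonneg
        neg.pvar_nonneg pos_variation_empty neg.pos_variation_empty sums_add pvar_sums neg.pvar_sums)+
  have OO: "\<Omega> \<in> borel_subsets \<Omega>" using borel by (simp add: borel_subsets_def)
  have fM: "finite_measure M" by standard (simp add: M OO)
  define Z where "Z = \<Omega> - Y"
  have YZ: "Y \<in> sets M" "Z \<in> sets M" using Y(1) borel by (auto simp: M borel_subsets_def Z_def)
  \<comment> \<open>P lives on Y and N on the complement Z, so both are restrictions of the total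
    variation M; hence the sign is the difference of the two indicators.\<close>
  have PD: "P = density M (indicator Y)"
  proof (rule measure_eqI)
    fix B assume "B \<in> sets P"
    then have B: "B \<in> borel_subsets \<Omega>" by (simp add: sets)
    have B': "Y \<inter> B \<in> borel_subsets \<Omega>" "B - Y \<in> borel_subsets \<Omega>"
      using B Y(1) by (auto simp: borel_subsets_def)
    have "pvar B = pvar (Y \<inter> B) + neg.pvar (Y \<inter> B)"
    proof -
      have "Y \<inter> B \<union> (B - Y) = B" by auto
      then have "\<mu> B = \<mu> (Y \<inter> B) + \<mu> (B - Y)" using Un[OF B'] by fastforce
      \<comment> \<open>A competitor for -\<mu> loses nothing when its part inside Y, where \<mu> is
        nonnegative, is removed.\<close>
      moreover have "neg.pvar B \<le> neg.pvar (B - Y)"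
      proof (rule neg.pvar_le[OF B neg.pvar_nonneg])
        fix C assume C: "C \<in> borel_subsets B"
        have CC: "C \<inter> Y \<in> borel_subsets \<Omega>" "C - Y \<in> borel_subsets \<Omega>" "C - Y \<in> borel_subsets (B - Y)"
          using C B Y(1) by (auto simp: borel_subsets_def)
        have "\<mu> (C \<inter> Y \<union> (C - Y)) = \<mu> (C \<inter> Y) + \<mu> (C - Y)" using CC by (intro Un) auto
        moreover have "C \<inter> Y \<union> (C - Y) = C" by auto
        moreover have "\<mu> (C \<inter> Y) \<ge> 0"
          using pvar_diff[OF CC(1)] ON[OF CC(1)] pvar_nonneg[of "C \<inter> Y"] by simp
        ultimately show "- \<mu> C \<le> neg.pvar (B - Y)" using neg.le_pvar[OF B'(2) CC(3)] by simp
      qed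
      moreover have "neg.pvar (B - Y) \<le> neg.pvar B"
        using B'(2) by (intro neg.pvar_mono[OF B]) (auto simp: borel_subsets_def)
      moreover have "pvar (B - Y) = 0" by (rule OP[OF B'(2)]) auto
      ultimately show ?thesis
        using pvar_diff[OF B] pvar_diff[OF B'(1)] pvar_diff[OF B'(2)] ON[OF B'(1), OF Int_lower1]
        by linarith
    qed
    then show "emeasure P B = emeasure (density M (indicator Y)) B"
      using B B' YZ by (simp add: em emeasure_restricted M)
  qed (simp add: sets M)
  have ND: "N = density M (indicator Z)"
  proof (rule measure_eqI)
    fix B assume "B \<in> sets N"
    then have B: "B \<in> borel_subsets \<Omega>" by (simp add: sets)
    then have B': "Z \<inter> B \<in> borel_subsets \<Omega>" "Y \<inter> B \<in> borel_subsets \<Omega>"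
      using Y(1) borel by (auto simp: borel_subsets_def Z_def)
    have "emeasure N B = emeasure N (Z \<inter> B) + emeasure N (Y \<inter> B)"
    proof -
      have "B = (Z \<inter> B) \<union> (Y \<inter> B)" using B by (auto simp: Z_def borel_subsets_def)
      moreover have "emeasure N ((Z \<inter> B) \<union> (Y \<inter> B)) = emeasure N (Z \<inter> B) + emeasure N (Y \<inter> B)"
        using B' by (intro plus_emeasure[symmetric]) (auto simp: sets Z_def)
      ultimately show ?thesis by simp
    qed
    moreover have "Z \<inter> B \<inter> Y = {}" by (auto simp: Z_def)
    ultimately show "emeasure N B = emeasure (density M (indicator Z)) B"
      using B B' YZ ON[OF B'(2)] OP[OF B'(1)] \<open>Z \<inter> B \<inter> Y = {}\<close> by (simp add: em emeasure_restricted M Z_def)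
  qed (simp add: sets M)
  define \<sigma> :: "'a \<Rightarrow> real" where "\<sigma> x = indicator Y x - indicator Z x" for x
  interpret finite_measure M by fact
  show ?thesis
  proof
    show "finite_measure M" by fact
    show sM: "sets M = sets (restrict_space borel \<Omega>)" by (simp add: M borel_subsets_eq[OF borel])
    show "\<sigma> \<in> borel_measurable M" unfolding \<sigma>_def using YZ by measurable
    show "\<bar>\<sigma> x\<bar> \<le> 1" for x by (auto simp: \<sigma>_def indicator_def)
    fix \<phi> :: "'a \<Rightarrow> real" and K assume \<phi>: "\<phi> \<in> borel_measurable borel" "\<And>x. \<bar>\<phi> x\<bar> \<le> K"
    have [measurable]: "\<phi> \<in> borel_measurable M"
      using measurable_restrict_space1[OF \<phi>(1), of \<Omega>] sM measurable_cong_sets by blast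
    have int: "integrable M \<phi>" using \<phi>(2) by (intro integrable_const_bound[of _ K]) auto
    have *: "(\<integral>x. \<phi> x \<partial>density M (indicator A)) = (\<integral>x. indicator A x * \<phi> x \<partial>M)" if "A \<in> sets M" for A
      using integral_density[of \<phi> M "indicator A"] that by (simp add: ennreal_indicator)
    have "dual_product \<Omega> \<phi> \<mu> = (\<integral>x. indicator Y x * \<phi> x \<partial>M) - (\<integral>x. indicator Z x * \<phi> x \<partial>M)"
      unfolding dual_product_def neg_part_def P_def[symmetric] N_def[symmetric] PD ND
      using YZ by (simp add: *)
    also have "\<dots> = (\<integral>x. indicator Y x * \<phi> x - indicator Z x * \<phi> x \<partial>M)"
      using integrable_mult_indicator[OF YZ(1) int] integrable_mult_indicator[OF YZ(2) int]
      by (intro Bochner_Integration.integral_diff[symmetric]) simp_all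
    also have "\<dots> = (\<integral>x. \<phi> x * \<sigma> x \<partial>M)"
      unfolding \<sigma>_def by (intro Bochner_Integration.integral_cong) (simp_all add: algebra_simps)
    finally show "dual_product \<Omega> \<phi> \<mu> = (\<integral>x. \<phi> x * \<sigma> x \<partial>M)" .
  qed
qed

section \<open>Gaussian kernels\<close>

definition wave :: "'a::euclidean_space \<Rightarrow> 'a \<Rightarrow> complex" where
  "wave x \<xi> = cis (2 * pi * (x \<bullet> \<xi>))"

text \<open>The one transform used with \<open>lborel\<close>: the forward transform at \<xi> is
  \<open>inv_fourier\<close> at -\<xi>, see \<open>fourier_integral_eq\<close>, so each bound serves
  both directions after a reflection.\<close>

definition inv_fourier :: "('a::euclidean_space \<Rightarrow> complex) \<Rightarrow> 'a \<Rightarrow> complex" where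
  "inv_fourier \<Phi> x = (\<integral>\<xi>. \<Phi> \<xi> * wave x \<xi> \<partial>lborel)"

definition gauss :: "real \<Rightarrow> 'a::euclidean_space \<Rightarrow> real" where
  "gauss \<epsilon> \<xi> = exp (- pi * \<epsilon>\<^sup>2 * (\<xi> \<bullet> \<xi>))"

text \<open>For \<epsilon> > 0 this is the inverse transform of \<open>gauss \<epsilon>\<close>: a
  probability density proportional to exp (- pi |x|^2 / \<epsilon>^2), which concentrates at 0 as
  \<epsilon> tends to 0.\<close>

definition gauss_kernel :: "real \<Rightarrow> 'a::euclidean_space \<Rightarrow> real" where
  "gauss_kernel \<epsilon> x = gauss (1 / \<epsilon>) x / \<epsilon> ^ DIM('a)"

lemma norm_wave [simp]: "norm (wave x \<xi>) = 1"
  by (simp add: wave_def)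

lemma wave_add: "wave (x + y) \<xi> = wave x \<xi> * wave y \<xi>"
  by (simp add: wave_def inner_add_left distrib_left cis_mult)

lemma wave_minus: "wave (- x) \<xi> = cnj (wave x \<xi>)"
  by (simp add: wave_def cis_cnj)

lemma wave_diff: "wave (x - y) \<xi> = wave x \<xi> * wave (- y) \<xi>"
  using wave_add[of x "- y"] by simp

lemma wave_zero [simp]: "wave 0 \<xi> = 1"
  by (simp add: wave_def)

lemma measurable_wave [measurable (raw)]:
  assumes "f \<in> borel_measurable M" "g \<in> borel_measurable M"
  shows "(\<lambda>z. wave (f z) (g z)) \<in> borel_measurable M"
proof -
  have "(\<lambda>t. cis (2 * pi * t)) \<in> borel_measurable borel"
    by (intro borel_measurable_continuous_onI continuous_intros)
  from measurable_compose[OF borel_measurable_inner[OF assms] this] show ?thesis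
    by (simp add: wave_def)
qed

lemma measurable_gauss [measurable]: "gauss \<epsilon> \<in> borel_measurable borel"
  unfolding gauss_def[abs_def] by measurable

lemma measurable_gauss_kernel [measurable]: "gauss_kernel \<epsilon> \<in> borel_measurable borel"
  unfolding gauss_kernel_def[abs_def] by measurable

lemma gauss_pos: "0 < gauss \<epsilon> \<xi>" and gauss_le_1: "gauss \<epsilon> \<xi> \<le> 1" and gauss_minus: "gauss \<epsilon> (- \<xi>) = gauss \<epsilon> \<xi>"
  by (auto simp: gauss_def)

lemma gauss_kernel_nonneg: "0 < \<epsilon> \<Longrightarrow> 0 \<le> gauss_kernel \<epsilon> x" 
  and gauss_kernel_minus: "gauss_kernel \<epsilon> (- x) = gauss_kernel \<epsilon> x"
  by (auto simp: gauss_kernel_def gauss_minus less_imp_le[OF gauss_pos])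

lemma has_integral_gauss_real:
  fixes x \<epsilon> :: real
  assumes \<epsilon>: "\<epsilon> > 0"
  shows "integrable lborel (\<lambda>s. cis (2 * pi * (x * s)) * complex_of_real (exp (- pi * \<epsilon>\<^sup>2 * s\<^sup>2)))"
    and "(\<integral>s. cis (2 * pi * (x * s)) * complex_of_real (exp (- pi * \<epsilon>\<^sup>2 * s\<^sup>2)) \<partial>lborel)
      = complex_of_real (exp (- pi * (1 / \<epsilon>)\<^sup>2 * x\<^sup>2) / \<epsilon>)"
proof -
  \<comment> \<open>The substitution y = c s turns y^2 / 2 into pi \<epsilon>^2 s^2, and t is chosen
    so that t y = 2 pi x s. The integral thus becomes the characteristic function of the standard
    normal distribution at t.\<close>
  define c where "c = sqrt (2 * pi) * \<epsilon>"
  have c: "c > 0" "c\<^sup>2 = 2 * pi * \<epsilon>\<^sup>2" using \<epsilon> by (auto simp: c_def power_mult_distrib)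
  define t where "t = sqrt (2 * pi) * x / \<epsilon>"
  have t: "t * c = 2 * pi * x" "t\<^sup>2 = 2 * pi * x\<^sup>2 / \<epsilon>\<^sup>2" using \<epsilon>
    by (auto simp: t_def c_def power_mult_distrib power_divide)
  let ?f = "\<lambda>s. cis (2 * pi * (x * s)) * complex_of_real (exp (- pi * \<epsilon>\<^sup>2 * s\<^sup>2))"
  let ?g = "\<lambda>y. std_normal_density y *\<^sub>R iexp (t * y)"
  have eq: "?g (0 + c * s) = (1 / sqrt (2 * pi)) *\<^sub>R ?f s" for s
  proof -
    have "t * (0 + c * s) = 2 * pi * (x * s)" using t(1) by (simp add: mult.assoc[symmetric])
    then have "iexp (t * (0 + c * s)) = cis (2 * pi * (x * s))" by (simp only: cis_conv_exp)
    moreover have "(c * s)\<^sup>2 / 2 = pi * \<epsilon>\<^sup>2 * s\<^sup>2" using c(2) by (simp add: power_mult_distrib)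
    ultimately show ?thesis
      unfolding std_normal_density_def by (simp add: scaleR_conv_of_real mult.commute)
  qed
  have int: "integrable lborel ?g"
  proof (rule Bochner_Integration.integrable_bound)
    show "integrable lborel (std_normal_density)" by (rule integrable_normal_density) simp
    show "AE y in lborel. norm (?g y) \<le> norm (std_normal_density y)" by simp
  qed measurable
  have "integrable lborel (\<lambda>s. ?g (0 + c * s))"
    using lborel_integrable_real_affine[OF int, of c 0] c by simp
  from integrable_scaleR_right[OF this, of "sqrt (2 * pi)"] show "integrable lborel ?f"
    unfolding eq by simp
  have "complex_of_real (exp (- (t\<^sup>2) / 2)) = char std_normal_distribution t"
    by (simp add: char_std_normal_distribution)
  also have "\<dots> = (\<integral>y. ?g y \<partial>lborel)"
    unfolding char_def by (subst integral_density) (auto simp: normal_density_nonneg)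
  also have "\<dots> = c *\<^sub>R (\<integral>s. ?g (0 + c * s) \<partial>lborel)"
    using lborel_integral_real_affine[of c ?g 0] c by simp
  also have "\<dots> = (c / sqrt (2 * pi)) *\<^sub>R (\<integral>s. ?f s \<partial>lborel)"
    unfolding eq by simp
  also have "c / sqrt (2 * pi) = \<epsilon>" by (simp add: c_def)
  finally have "(\<integral>s. ?f s \<partial>lborel) = (1 / \<epsilon>) *\<^sub>R complex_of_real (exp (- (t\<^sup>2) / 2))"
    using \<epsilon> by simp
  also have "- (t\<^sup>2) / 2 = - pi * (1 / \<epsilon>)\<^sup>2 * x\<^sup>2" by (simp add: t(2) power_divide)
  finally show "(\<integral>s. ?f s \<partial>lborel) = complex_of_real (exp (- pi * (1 / \<epsilon>)\<^sup>2 * x\<^sup>2) / \<epsilon>)"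
    by (simp add: scaleR_conv_of_real)
qed

text \<open>\<open>lborel\<close> is the image of a product of one-dimensional measures under the
  coordinate map, so Fubini factors the integral. It reduces the Gaussian transform to the real
  line.\<close>

lemma lborel_integral_prod_Basis:
  fixes f :: "'a::euclidean_space \<Rightarrow> real \<Rightarrow> complex"
  assumes f: "\<And>b. b \<in> Basis \<Longrightarrow> integrable lborel (f b)"
  shows "integrable lborel (\<lambda>x::'a. \<Prod>b\<in>Basis. f b (x \<bullet> b))"
    and "integral\<^sup>L lborel (\<lambda>x::'a. \<Prod>b\<in>Basis. f b (x \<bullet> b)) = (\<Prod>b\<in>Basis. \<integral>s. f b s \<partial>lborel)"
proof -
  interpret product_sigma_finite "\<lambda>_::'a. lborel :: real measure" by standard
  have [measurable]: "f b \<in> borel_measurable borel" if "b \<in> Basis" for b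
    using borel_measurable_integrable[OF f[OF that]] by simp
  let ?T = "\<lambda>z::'a \<Rightarrow> real. \<Sum>b\<in>Basis. z b *\<^sub>R b"
  have eq: "(\<Prod>b\<in>Basis. f b (?T z \<bullet> b)) = (\<Prod>b\<in>Basis. f b (z b))" for z
    by (intro prod.cong) (auto simp: inner_sum_left_Basis)
  have T: "?T \<in> (\<Pi>\<^sub>M b\<in>Basis. lborel) \<rightarrow>\<^sub>M borel" by measurable
  have m: "(\<lambda>x::'a. \<Prod>b\<in>Basis. f b (x \<bullet> b)) \<in> borel_measurable borel" by measurable
  show "integrable lborel (\<lambda>x::'a. \<Prod>b\<in>Basis. f b (x \<bullet> b))"
    unfolding lborel_eq[where 'a='a] integrable_distr_eq[OF T m] eq
    by (rule product_integrable_prod) (auto simp: f)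
  show "integral\<^sup>L lborel (\<lambda>x::'a. \<Prod>b\<in>Basis. f b (x \<bullet> b)) = (\<Prod>b\<in>Basis. \<integral>s. f b s \<partial>lborel)"
    unfolding lborel_eq[where 'a='a] integral_distr[OF T m] eq
    by (subst product_integral_prod) (auto simp: f lborel_eq[symmetric])
qed

lemma
  fixes x :: "'a::euclidean_space"
  assumes \<epsilon>: "\<epsilon> > 0"
  shows integrable_gauss_wave: "integrable lborel (\<lambda>\<xi>. complex_of_real (gauss \<epsilon> \<xi>) * wave x \<xi>)"
    and inv_fourier_gauss: "inv_fourier (\<lambda>\<xi>. complex_of_real (gauss \<epsilon> \<xi>)) x = complex_of_real (gauss_kernel \<epsilon> x)"
proof -
  let ?f = "\<lambda>b s. cis (2 * pi * ((x \<bullet> b) * s)) * complex_of_real (exp (- pi * \<epsilon>\<^sup>2 * s\<^sup>2))"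
  have cis_sum: "cis (\<Sum>b\<in>B. h b) = (\<Prod>b\<in>B. cis (h b))" if "finite B" for B and h :: "'a \<Rightarrow> real"
    using that by induction (auto simp flip: cis_mult)
  have wave: "wave x \<xi> = (\<Prod>b\<in>Basis. cis (2 * pi * ((x \<bullet> b) * (\<xi> \<bullet> b))))" for \<xi>
    unfolding wave_def euclidean_inner[of x \<xi>] by (simp add: sum_distrib_left cis_sum)
  have gauss: "gauss \<delta> \<xi> = (\<Prod>b\<in>Basis. exp (- pi * \<delta>\<^sup>2 * (\<xi> \<bullet> b)\<^sup>2))" for \<xi> :: 'a and \<delta>
    unfolding gauss_def euclidean_inner[of \<xi> \<xi>]
    by (simp add: sum_distrib_left exp_sum power2_eq_square flip: sum_negf)
  have eq: "complex_of_real (gauss \<epsilon> \<xi>) * wave x \<xi> = (\<Prod>b\<in>Basis. ?f b (\<xi> \<bullet> b))" for \<xi>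
    unfolding wave gauss prod.distrib of_real_prod by (rule mult.commute)
  show "integrable lborel (\<lambda>\<xi>. complex_of_real (gauss \<epsilon> \<xi>) * wave x \<xi>)"
    unfolding eq by (rule lborel_integral_prod_Basis(1)) (rule has_integral_gauss_real(1)[OF \<epsilon>])
  have "inv_fourier (\<lambda>\<xi>. complex_of_real (gauss \<epsilon> \<xi>)) x = (\<Prod>b\<in>Basis. \<integral>s. ?f b s \<partial>lborel)"
    unfolding inv_fourier_def eq
    by (rule lborel_integral_prod_Basis(2)) (rule has_integral_gauss_real(1)[OF \<epsilon>])
  also have "\<dots> = (\<Prod>b\<in>Basis. complex_of_real (exp (- pi * (1 / \<epsilon>)\<^sup>2 * (x \<bullet> b)\<^sup>2) / \<epsilon>))"
    by (simp only: has_integral_gauss_real(2)[OF \<epsilon>])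
  also have "\<dots> = complex_of_real (gauss_kernel \<epsilon> x)"
    unfolding gauss_kernel_def gauss of_real_prod[symmetric] by (simp add: prod_dividef)
  finally show "inv_fourier (\<lambda>\<xi>. complex_of_real (gauss \<epsilon> \<xi>)) x = complex_of_real (gauss_kernel \<epsilon> x)" .
qed

lemma integrable_gauss:
  assumes "\<epsilon> > 0"
  shows "integrable lborel (gauss \<epsilon> :: 'a::euclidean_space \<Rightarrow> real)"
  using integrable_gauss_wave[OF assms, of "0::'a"] by (simp add: complex_of_real_integrable_eq)

lemma
  fixes \<epsilon> :: real
  assumes \<epsilon>: "\<epsilon> > 0"
  shows integrable_gauss_kernel: "integrable lborel (gauss_kernel \<epsilon> :: 'a::euclidean_space \<Rightarrow> real)"
    and integral_gauss_kernel: "integral\<^sup>L lborel (gauss_kernel \<epsilon> :: 'a::euclidean_space \<Rightarrow> real) = 1"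
proof -
  show "integrable lborel (gauss_kernel \<epsilon> :: 'a \<Rightarrow> real)"
    unfolding gauss_kernel_def[abs_def] using integrable_gauss[of "1 / \<epsilon>", where 'a='a] \<epsilon> by simp
  \<comment> \<open>The mass of a Gaussian is its inverse transform at 0.\<close>
  have "complex_of_real (integral\<^sup>L lborel (gauss (1 / \<epsilon>) :: 'a \<Rightarrow> real)) = complex_of_real (gauss_kernel (1 / \<epsilon>) (0::'a))"
    using inv_fourier_gauss[of "1 / \<epsilon>" "0::'a"] \<epsilon> by (simp add: inv_fourier_def)
  then have "(integral\<^sup>L lborel (gauss (1 / \<epsilon>) :: 'a \<Rightarrow> real)) = \<epsilon> ^ DIM('a)"
    unfolding of_real_eq_iff by (simp add: gauss_kernel_def gauss_def power_one_over)
  then show "integral\<^sup>L lborel (gauss_kernel \<epsilon> :: 'a::euclidean_space \<Rightarrow> real) = 1"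
    unfolding gauss_kernel_def[abs_def] using \<epsilon> by simp
qed

lemma gauss_power2: "(gauss \<epsilon> \<xi>)\<^sup>2 = gauss (sqrt 2 * \<epsilon>) \<xi>"
  by (simp add: gauss_def power_mult_distrib flip: exp_double)

lemma gauss_tendsto_1:
  assumes "\<epsilon> \<longlonglongrightarrow> 0"
  shows "(\<lambda>k. gauss (\<epsilon> k) \<xi>) \<longlonglongrightarrow> 1"
proof -
  have "(\<lambda>k. exp (- pi * (\<epsilon> k)\<^sup>2 * (\<xi> \<bullet> \<xi>))) \<longlonglongrightarrow> exp (- pi * 0\<^sup>2 * (\<xi> \<bullet> \<xi>))"
    by (intro tendsto_intros assms)
  then show ?thesis by (simp add: gauss_def)
qed

section \<open>Reflections and Fubini\<close>

lemma lborel_distr_reflect: "distr lborel borel (\<lambda>y. x - y) = (lborel :: 'a::euclidean_space measure)"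
proof -
  have "density (distr lborel borel (\<lambda>y::'a. x + (-1) *\<^sub>R y)) (\<lambda>_. 1) = (lborel :: 'a measure)"
    using lborel_affine[of "-1" x] by simp
  then show ?thesis by (simp add: density_1)
qed

lemma
  fixes f :: "'a::euclidean_space \<Rightarrow> 'b::{banach,second_countable_topology}"
  assumes f [measurable]: "f \<in> borel_measurable borel"
  shows integral_reflect: "(\<integral>y. f (x - y) \<partial>lborel) = (\<integral>y. f y \<partial>lborel)"
    and integrable_reflect: "integrable lborel (\<lambda>y. f (x - y)) \<longleftrightarrow> integrable lborel f"
proof -
  have m: "(\<lambda>y. x - y) \<in> lborel \<rightarrow>\<^sub>M borel" by measurable
  show "(\<integral>y. f (x - y) \<partial>lborel) = (\<integral>y. f y \<partial>lborel)"
    using integral_distr[OF m f] unfolding lborel_distr_reflect by simp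
  show "integrable lborel (\<lambda>y. f (x - y)) \<longleftrightarrow> integrable lborel f"
    using integrable_distr_eq[OF m f] unfolding lborel_distr_reflect by simp
qed

lemma AE_reflect:
  fixes x :: "'a::euclidean_space"
  assumes "AE y in lborel. P y"
  shows "AE y in lborel. P (x - y)"
proof -
  have m: "(\<lambda>y. x - y) \<in> lborel \<rightarrow>\<^sub>M borel" by measurable
  have "AE y in distr lborel borel (\<lambda>y. x - y). P y"
    unfolding lborel_distr_reflect by (rule assms)
  from AE_distrD[OF m this] show ?thesis .
qed

lemma
  fixes f :: "'a::euclidean_space \<Rightarrow> 'b::{real_normed_vector,second_countable_topology}"
  assumes "square_integrable lborel f"
  shows square_integrable_reflect: "square_integrable lborel (\<lambda>y. f (x - y))"
    and norm2_reflect: "norm2 lborel (\<lambda>y. f (x - y)) = norm2 lborel f"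
proof -
  have [measurable]: "f \<in> borel_measurable borel" using square_integrableD(1)[OF assms] by simp
  have m: "(\<lambda>y. (norm (f y))\<^sup>2) \<in> borel_measurable borel" by measurable
  show "square_integrable lborel (\<lambda>y. f (x - y))"
    using assms integrable_reflect[OF m, of x] by (simp add: square_integrable_def)
  show "norm2 lborel (\<lambda>y. f (x - y)) = norm2 lborel f"
    using integral_reflect[OF m, of x] by (simp add: norm2_def)
qed

lemma (in pair_sigma_finite) integrable_pair_mult_bounded:
  fixes f g h :: "_ \<Rightarrow> 'c::{real_normed_field,banach,second_countable_topology}"
  assumes f: "integrable M1 f" and g: "integrable M2 g"
    and h [measurable]: "h \<in> borel_measurable (M1 \<Otimes>\<^sub>M M2)" and C: "\<And>z. norm (h z) \<le> C"
  shows "integrable (M1 \<Otimes>\<^sub>M M2) (\<lambda>(x, y). f x * g y * h (x, y))"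
proof -
  have [measurable]: "f \<in> borel_measurable M1" "g \<in> borel_measurable M2" using f g by auto
  have "integrable (M1 \<Otimes>\<^sub>M M2) (\<lambda>(x, y). f x * g y)"
  proof (rule Fubini_integrable)
    show "integrable M1 (\<lambda>x. \<integral>y. norm (case (x, y) of (x, y) \<Rightarrow> f x * g y) \<partial>M2)"
      using f by (simp add: norm_mult)
    show "AE x in M1. integrable M2 (\<lambda>y. case (x, y) of (x, y) \<Rightarrow> f x * g y)"
      using g by simp
  qed measurable
  then have "integrable (M1 \<Otimes>\<^sub>M M2) (\<lambda>z. C *\<^sub>R (case z of (x, y) \<Rightarrow> f x * g y))" by simp
  then show ?thesis
  proof (rule Bochner_Integration.integrable_bound)
    show "AE z in M1 \<Otimes>\<^sub>M M2. norm (case z of (x, y) \<Rightarrow> f x * g y * h (x, y))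
        \<le> norm (C *\<^sub>R (case z of (x, y) \<Rightarrow> f x * g y))"
    proof (rule AE_I2)
      fix z
      show "norm (case z of (x, y) \<Rightarrow> f x * g y * h (x, y))
          \<le> norm (C *\<^sub>R (case z of (x, y) \<Rightarrow> f x * g y))"
        using mult_left_mono[OF order_trans[OF C[of z] abs_ge_self], of "norm (f (fst z) * g (snd z))"]
        by (simp add: split_beta norm_mult mult.commute mult.left_commute)
    qed
  qed measurable
qed

text \<open>The form of Fubini used whenever two integrable functions are coupled by a bounded
  kernel: a \<open>wave\<close> for the transforms, or \<psi> (x - w) for the components of A
  \<mu>.\<close>

lemma (in pair_sigma_finite) Fubini_mult_bounded:
  fixes f g :: "_ \<Rightarrow> 'c::{real_normed_field,banach,second_countable_topology}"
  assumes f: "integrable M1 f" and g: "integrable M2 g"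
    and h [measurable]: "(\<lambda>(x, y). h x y) \<in> borel_measurable (M1 \<Otimes>\<^sub>M M2)" and C: "\<And>x y. norm (h x y) \<le> C"
  shows "(\<integral>x. f x * (\<integral>y. g y * h x y \<partial>M2) \<partial>M1) = (\<integral>y. g y * (\<integral>x. f x * h x y \<partial>M1) \<partial>M2)"
proof -
  have "integrable (M1 \<Otimes>\<^sub>M M2) (\<lambda>(x, y). f x * g y * h x y)"
    using integrable_pair_mult_bounded[OF f g h, of C] C by auto
  from Fubini_integral[OF this]
  have "(\<integral>y. (\<integral>x. g y * (f x * h x y) \<partial>M1) \<partial>M2) = (\<integral>x. (\<integral>y. f x * (g y * h x y) \<partial>M2) \<partial>M1)"
    by (simp only: mult_ac)
  then show ?thesis by simp
qed

section \<open>The Fourier transform on square-integrable functions\<close>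

lemma integrable_mult_wave:
  assumes "integrable lborel \<Phi>"
  shows "integrable lborel (\<lambda>\<xi>. \<Phi> \<xi> * wave x \<xi>)"
proof (rule Bochner_Integration.integrable_bound[OF assms])
  have [measurable]: "\<Phi> \<in> borel_measurable borel" using borel_measurable_integrable[OF assms] by simp
  show "(\<lambda>\<xi>. \<Phi> \<xi> * wave x \<xi>) \<in> borel_measurable lborel" by measurable
qed (simp add: norm_mult)

lemma norm_inv_fourier_le:
  assumes "integrable lborel \<Phi>"
  shows "norm (inv_fourier \<Phi> x) \<le> (\<integral>\<xi>. norm (\<Phi> \<xi>) \<partial>lborel)"
  unfolding inv_fourier_def
  using integral_norm_bound[of lborel "\<lambda>\<xi>. \<Phi> \<xi> * wave x \<xi>"] by (simp add: norm_mult)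

lemma measurable_inv_fourier [measurable]:
  assumes [measurable]: "\<Phi> \<in> borel_measurable borel"
  shows "inv_fourier \<Phi> \<in> borel_measurable borel"
proof -
  have "(\<lambda>x. \<integral>\<xi>. \<Phi> \<xi> * wave x \<xi> \<partial>lborel) \<in> borel_measurable borel" by measurable
  then show ?thesis by (simp add: inv_fourier_def[abs_def])
qed

lemma inv_fourier_diff:
  assumes "integrable lborel \<Phi>" "integrable lborel \<Psi>"
  shows "inv_fourier (\<lambda>\<xi>. \<Phi> \<xi> - \<Psi> \<xi>) x = inv_fourier \<Phi> x - inv_fourier \<Psi> x"
  using integrable_mult_wave[OF assms(1), of x] integrable_mult_wave[OF assms(2), of x]
  by (simp add: inv_fourier_def left_diff_distrib)

lemma cnj_inv_fourier: "cnj (inv_fourier \<Phi> x) = inv_fourier (\<lambda>\<xi>. cnj (\<Phi> \<xi>)) (- x)"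
  using Bochner_Integration.integral_cnj[of lborel "\<lambda>\<xi>. \<Phi> \<xi> * wave x \<xi>"]
  by (simp add: inv_fourier_def wave_minus)

text \<open>The multiplication formula: both sides are the double integral of U y \<Phi> \<xi>
  \<open>wave (x - y) \<xi>\<close>, and integrating over y first produces the forward transform of
  U.\<close>

lemma integral_mult_inv_fourier:
  fixes U \<Phi> :: "'a::euclidean_space \<Rightarrow> complex"
  assumes U: "integrable lborel U" and \<Phi>: "integrable lborel \<Phi>"
  shows "(\<integral>y. U y * inv_fourier \<Phi> (x - y) \<partial>lborel) = inv_fourier (\<lambda>\<xi>. inv_fourier U (- \<xi>) * \<Phi> \<xi>) x"
proof -
  have w: "(\<integral>y. U y * wave (x - y) \<xi> \<partial>lborel) = inv_fourier U (- \<xi>) * wave x \<xi>" for \<xi>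
    unfolding wave_diff inv_fourier_def
    by (simp add: mult.left_commute[of "U _"] mult.commute[of _ "wave x \<xi>"])
      (simp add: wave_def inner_commute)
  have "(\<integral>y. U y * inv_fourier \<Phi> (x - y) \<partial>lborel)
      = (\<integral>\<xi>. \<Phi> \<xi> * (\<integral>y. U y * wave (x - y) \<xi> \<partial>lborel) \<partial>lborel)"
    unfolding inv_fourier_def
    by (rule lborel_pair.Fubini_mult_bounded[OF U \<Phi>, of _ 1]) auto
  also have "\<dots> = inv_fourier (\<lambda>\<xi>. inv_fourier U (- \<xi>) * \<Phi> \<xi>) x"
    unfolding w inv_fourier_def[of _ x] by (simp add: mult_ac)
  finally show ?thesis .
qed

text \<open>The quadratic form of convolution with a probability density is bounded by the squared norm:
  this is \<open>2ab \<le> a\<^sup>2 + b\<^sup>2\<close> and symmetry.\<close>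

lemma integral_gauss_kernel_mult_le:
  fixes V :: "'a::euclidean_space \<Rightarrow> real"
  assumes \<epsilon>: "\<epsilon> > 0" and V: "square_integrable lborel V" "integrable lborel V"
  shows "(\<integral>y. V y * (\<integral>s. V s * gauss_kernel \<epsilon> (y - s) \<partial>lborel) \<partial>lborel) \<le> (norm2 lborel V)\<^sup>2"
proof -
  let ?G = "gauss_kernel \<epsilon> :: 'a \<Rightarrow> real"
  have [measurable]: "V \<in> borel_measurable borel" using square_integrableD(1)[OF V(1)] by simp
  have V2: "integrable lborel (\<lambda>y. (V y)\<^sup>2)" using square_integrableD(2)[OF V(1)] by simp
  have G: "integrable lborel ?G" "integral\<^sup>L lborel ?G = 1"
    using integrable_gauss_kernel[OF \<epsilon>] integral_gauss_kernel[OF \<epsilon>] by auto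
  have Gr: "integrable lborel (\<lambda>s. ?G (y - s))" "(\<integral>s. ?G (y - s) \<partial>lborel) = 1" for y
    using G integrable_reflect[of ?G y] integral_reflect[of ?G y] by auto
  have A: "integrable (lborel \<Otimes>\<^sub>M lborel) (\<lambda>(y, s). (V y)\<^sup>2 * ?G (y - s))"
  proof (rule lborel_pair.Fubini_integrable)
    show "integrable lborel (\<lambda>y. \<integral>s. norm (case (y, s) of (y, s) \<Rightarrow> (V y)\<^sup>2 * ?G (y - s)) \<partial>lborel)"
      using V2 Gr gauss_kernel_nonneg[OF \<epsilon>, where 'a='a] by (simp add: abs_mult)
    show "AE y in lborel. integrable lborel (\<lambda>s. case (y, s) of (y, s) \<Rightarrow> (V y)\<^sup>2 * ?G (y - s))"
      using Gr by simp
  qed measurable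
  have Aval: "integral\<^sup>L (lborel \<Otimes>\<^sub>M lborel) (\<lambda>(y, s). (V y)\<^sup>2 * ?G (y - s)) = (norm2 lborel V)\<^sup>2"
    using lborel_pair.integral_fst[OF A] by (simp add: Gr norm2_power2)
  have sym: "?G (y - s) = ?G (s - y)" for y s using gauss_kernel_minus[of \<epsilon> "y - s"] by simp
  have B: "integrable (lborel \<Otimes>\<^sub>M lborel) (\<lambda>(y, s). (V s)\<^sup>2 * ?G (y - s))"
    using lborel_pair.integrable_product_swap[OF A] by (simp add: split_beta sym)
  have Bval: "integral\<^sup>L (lborel \<Otimes>\<^sub>M lborel) (\<lambda>(y, s). (V s)\<^sup>2 * ?G (y - s)) = (norm2 lborel V)\<^sup>2"
    using lborel_pair.integral_snd[OF B] by (subst (asm) (1 2) sym) (simp add: Gr norm2_power2 sym[symmetric])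
  let ?w = "\<lambda>(y, s). ((V y)\<^sup>2 * ?G (y - s) + (V s)\<^sup>2 * ?G (y - s)) / 2"
  have w: "integrable (lborel \<Otimes>\<^sub>M lborel) ?w"
    using Bochner_Integration.integrable_divide[OF Bochner_Integration.integrable_add[OF A B], of 2]
    by (simp add: case_prod_unfold)
  have le: "\<bar>V y * (V s * ?G (y - s))\<bar> \<le> ?w (y, s)" for y s
  proof -
    have "\<bar>V y * V s\<bar> \<le> ((V y)\<^sup>2 + (V s)\<^sup>2) / 2"
      using sum_squares_bound[of "\<bar>V y\<bar>" "\<bar>V s\<bar>"] by (simp add: abs_mult)
    from mult_right_mono[OF this gauss_kernel_nonneg[OF \<epsilon>, of "y - s"]] show ?thesis
      using gauss_kernel_nonneg[OF \<epsilon>, of "y - s"] by (simp add: abs_mult algebra_simps)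
  qed
  have C: "integrable (lborel \<Otimes>\<^sub>M lborel) (\<lambda>(y, s). V y * (V s * ?G (y - s)))"
  proof (rule Bochner_Integration.integrable_bound[OF w])
    show "AE z in lborel \<Otimes>\<^sub>M lborel. norm (case z of (y, s) \<Rightarrow> V y * (V s * ?G (y - s))) \<le> norm (?w z)"
      using order_trans[OF le abs_ge_self] by (intro AE_I2) (auto split: prod.splits)
  qed measurable
  have "(\<integral>y. V y * (\<integral>s. V s * ?G (y - s) \<partial>lborel) \<partial>lborel)
      = integral\<^sup>L (lborel \<Otimes>\<^sub>M lborel) (\<lambda>(y, s). V y * (V s * ?G (y - s)))"
    using lborel_pair.integral_fst[OF C] by simp
  also have "\<dots> \<le> integral\<^sup>L (lborel \<Otimes>\<^sub>M lborel) ?w"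
    using order_trans[OF abs_ge_self le] by (intro integral_mono[OF C w]) (simp add: case_prod_unfold)
  also have "\<dots> = (integral\<^sup>L (lborel \<Otimes>\<^sub>M lborel) (\<lambda>(y, s). (V y)\<^sup>2 * ?G (y - s))
      + integral\<^sup>L (lborel \<Otimes>\<^sub>M lborel) (\<lambda>(y, s). (V s)\<^sup>2 * ?G (y - s))) / 2"
    using Bochner_Integration.integral_add[OF A B] by (simp add: case_prod_unfold)
  also have "\<dots> = (norm2 lborel V)\<^sup>2" by (simp add: Aval Bval)
  finally show ?thesis .
qed

lemma square_integrable_gauss: "\<epsilon> > 0 \<Longrightarrow> square_integrable lborel (\<lambda>\<xi>. complex_of_real (gauss \<epsilon> \<xi>))"
  using integrable_gauss[of "sqrt 2 * \<epsilon>"]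
  by (simp add: square_integrable_def gauss_power2 abs_of_pos[OF gauss_pos])

text \<open>With F the transform of U and K = \<open>gauss \<delta>\<close>, the squared norm on the
  left is the integral of F times the conjugate of F K. The multiplication formula at 0 rewrites it
  as the integral of U times the conjugate of F^-1[F K], and a second use identifies F^-1[F K] with
  U * \<open>gauss_kernel \<delta>\<close>. The quadratic form of that kernel is bounded by
  \<open>integral_gauss_kernel_mult_le\<close>. The Gaussian is what makes these integrals converge,
  since F is so far known only to be bounded.\<close>

lemma norm2_fourier_gauss_le:
  fixes U :: "'a::euclidean_space \<Rightarrow> complex"
  assumes U: "integrable lborel U" "square_integrable lborel U" and \<epsilon>: "\<epsilon> > 0"
  shows "square_integrable lborel (\<lambda>\<xi>. inv_fourier U (- \<xi>) * complex_of_real (gauss \<epsilon> \<xi>))"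
    and "norm2 lborel (\<lambda>\<xi>. inv_fourier U (- \<xi>) * complex_of_real (gauss \<epsilon> \<xi>)) \<le> norm2 lborel U"
proof -
  have [measurable]: "U \<in> borel_measurable borel" using borel_measurable_integrable[OF U(1)] by simp
  \<comment> \<open>By \<open>gauss_power2\<close>, the square of \<open>gauss \<epsilon>\<close> is
    \<open>gauss \<delta>\<close>.\<close>
  define \<delta> where "\<delta> = sqrt 2 * \<epsilon>"
  have \<delta>: "\<delta> > 0" using \<epsilon> by (simp add: \<delta>_def)
  let ?F = "\<lambda>\<xi>. inv_fourier U (- \<xi>)"
  let ?K = "\<lambda>\<xi>::'a. complex_of_real (gauss \<delta> \<xi>)"
  define C where "C = (\<integral>\<xi>. norm (U \<xi>) \<partial>lborel)"
  have FC: "norm (?F \<xi>) \<le> C" for \<xi> unfolding C_def by (rule norm_inv_fourier_le[OF U(1)])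
  have Fm [measurable]: "?F \<in> borel_measurable borel" by measurable
  show sq: "square_integrable lborel (\<lambda>\<xi>. ?F \<xi> * complex_of_real (gauss \<epsilon> \<xi>))"
    using square_integrable_bounded_mult(1)[OF square_integrable_gauss[OF \<epsilon>], of ?F C] FC Fm
    by (simp add: mult.commute)
  have K: "integrable lborel ?K" using integrable_gauss[OF \<delta>, where 'a='a] by (simp add: complex_of_real_integrable_eq)
  have FK: "integrable lborel (\<lambda>\<xi>. ?F \<xi> * ?K \<xi>)"
  proof (rule Bochner_Integration.integrable_bound)
    show "integrable lborel (\<lambda>\<xi>. C *\<^sub>R ?K \<xi>)" using K by simp
    have "cmod (?F \<xi>) * gauss \<delta> \<xi> \<le> \<bar>C\<bar> * gauss \<delta> \<xi>" for \<xi>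
      by (rule mult_right_mono[OF order_trans[OF FC abs_ge_self] less_imp_le[OF gauss_pos]])
    then show "AE \<xi> in lborel. norm (?F \<xi> * ?K \<xi>) \<le> norm (C *\<^sub>R ?K \<xi>)"
      by (simp add: norm_mult abs_of_pos[OF gauss_pos])
  qed measurable
  have FK': "integrable lborel (\<lambda>\<xi>. cnj (?F \<xi> * ?K \<xi>))" using FK by (rule integrable_cnj)
  have conv: "inv_fourier (\<lambda>\<xi>. ?F \<xi> * ?K \<xi>) y = (\<integral>s. U s * complex_of_real (gauss_kernel \<delta> (y - s)) \<partial>lborel)" for y
    using integral_mult_inv_fourier[OF U(1) K, of y] by (simp add: inv_fourier_gauss[OF \<delta>])
  let ?V = "\<lambda>s. norm (U s)"
  have V: "square_integrable lborel ?V" "integrable lborel ?V" "norm2 lborel ?V = norm2 lborel U"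
    using U by (auto simp: square_integrable_def norm2_def)
  have convle: "norm (inv_fourier (\<lambda>\<xi>. ?F \<xi> * ?K \<xi>) y) \<le> (\<integral>s. ?V s * gauss_kernel \<delta> (y - s) \<partial>lborel)" for y
    unfolding conv
    using integral_norm_bound[of lborel "\<lambda>s. U s * complex_of_real (gauss_kernel \<delta> (y - s))"]
    by (simp add: norm_mult gauss_kernel_nonneg[OF \<delta>])
  have pt: "complex_of_real ((norm (?F \<xi> * complex_of_real (gauss \<epsilon> \<xi>)))\<^sup>2) = ?F \<xi> * cnj (?F \<xi> * ?K \<xi>)" for \<xi>
  proof -
    have "(norm (?F \<xi> * complex_of_real (gauss \<epsilon> \<xi>)))\<^sup>2 = (norm (?F \<xi>))\<^sup>2 * gauss \<delta> \<xi>"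
      by (simp add: norm_mult power_mult_distrib gauss_power2 \<delta>_def)
    then show ?thesis
      by (simp only: of_real_mult complex_norm_square complex_cnj_mult complex_cnj_complex_of_real mult.assoc)
  qed
  have "complex_of_real ((norm2 lborel (\<lambda>\<xi>. ?F \<xi> * complex_of_real (gauss \<epsilon> \<xi>)))\<^sup>2)
      = (\<integral>\<xi>. ?F \<xi> * cnj (?F \<xi> * ?K \<xi>) \<partial>lborel)"
    unfolding norm2_power2 integral_complex_of_real[symmetric] pt ..
  also have "\<dots> = inv_fourier (\<lambda>\<xi>. ?F \<xi> * cnj (?F \<xi> * ?K \<xi>)) 0"
    by (simp add: inv_fourier_def)
  also have "\<dots> = (\<integral>y. U y * inv_fourier (\<lambda>\<xi>. cnj (?F \<xi> * ?K \<xi>)) (- y) \<partial>lborel)"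
    using integral_mult_inv_fourier[OF U(1) FK', of 0] by simp
  also have "\<dots> = (\<integral>y. U y * cnj (inv_fourier (\<lambda>\<xi>. ?F \<xi> * ?K \<xi>) y) \<partial>lborel)"
    by (simp add: cnj_inv_fourier)
  finally have eq: "complex_of_real ((norm2 lborel (\<lambda>\<xi>. ?F \<xi> * complex_of_real (gauss \<epsilon> \<xi>)))\<^sup>2)
      = (\<integral>y. U y * cnj (inv_fourier (\<lambda>\<xi>. ?F \<xi> * ?K \<xi>) y) \<partial>lborel)" .
  have "(norm2 lborel (\<lambda>\<xi>. ?F \<xi> * complex_of_real (gauss \<epsilon> \<xi>)))\<^sup>2
      = norm (\<integral>y. U y * cnj (inv_fourier (\<lambda>\<xi>. ?F \<xi> * ?K \<xi>) y) \<partial>lborel)"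
    unfolding eq[symmetric] norm_of_real by simp
  also have "\<dots> \<le> (\<integral>y. ?V y * norm (inv_fourier (\<lambda>\<xi>. ?F \<xi> * ?K \<xi>) y) \<partial>lborel)"
    using integral_norm_bound[of lborel "\<lambda>y. U y * cnj (inv_fourier (\<lambda>\<xi>. ?F \<xi> * ?K \<xi>) y)"]
    by (simp add: norm_mult)
  also have "\<dots> \<le> (\<integral>y. ?V y * (\<integral>s. ?V s * gauss_kernel \<delta> (y - s) \<partial>lborel) \<partial>lborel)"
  proof (rule integral_mono_AE)
    \<comment> \<open>The value of the kernel at 0, which is its maximum.\<close>
    define D where "D = (1 / \<delta>) ^ DIM('a)"
    have GD: "\<bar>gauss_kernel \<delta> x\<bar> \<le> D" for x :: 'a
      unfolding gauss_kernel_def D_def using gauss_le_1[of "1/\<delta>" x] \<delta>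
      by (simp add: power_one_over divide_simps abs_of_pos[OF gauss_pos])
    have "integrable lborel (\<lambda>y. \<integral>s. ?V y * ?V s * gauss_kernel \<delta> (y - s) \<partial>lborel)"
      using lborel_pair.integrable_fst'[OF lborel_pair.integrable_pair_mult_bounded[OF V(2) V(2),
          of "\<lambda>z. gauss_kernel \<delta> (fst z - snd z)" D]] GD by simp
    then show I: "integrable lborel (\<lambda>y. ?V y * (\<integral>s. ?V s * gauss_kernel \<delta> (y - s) \<partial>lborel))"
      by (simp add: mult.assoc)
    show le: "AE y in lborel. ?V y * norm (inv_fourier (\<lambda>\<xi>. ?F \<xi> * ?K \<xi>) y)
        \<le> ?V y * (\<integral>s. ?V s * gauss_kernel \<delta> (y - s) \<partial>lborel)"
      using convle by (simp add: mult_left_mono)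
    show "integrable lborel (\<lambda>y. ?V y * norm (inv_fourier (\<lambda>\<xi>. ?F \<xi> * ?K \<xi>) y))"
    proof (rule Bochner_Integration.integrable_bound[OF I])
      show "AE y in lborel. norm (?V y * norm (inv_fourier (\<lambda>\<xi>. ?F \<xi> * ?K \<xi>) y))
          \<le> norm (?V y * (\<integral>s. ?V s * gauss_kernel \<delta> (y - s) \<partial>lborel))"
        using mult_left_mono[OF order_trans[OF convle abs_ge_self] norm_ge_zero]
        by (intro AE_I2) (simp add: abs_mult)
    qed measurable
  qed
  also have "\<dots> \<le> (norm2 lborel U)\<^sup>2"
    using integral_gauss_kernel_mult_le[OF \<delta> V(1,2)] V(3) by simp
  finally show "norm2 lborel (\<lambda>\<xi>. ?F \<xi> * complex_of_real (gauss \<epsilon> \<xi>)) \<le> norm2 lborel U"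
    by (rule power2_le_imp_le) simp
qed

text \<open>The contraction inequality. As the width tends to 0 the Gaussian factor tends to 1 at
  every point, and Fatou keeps the bound.\<close>

lemma norm2_fourier_le:
  fixes U :: "'a::euclidean_space \<Rightarrow> complex"
  assumes U: "integrable lborel U" "square_integrable lborel U"
  shows "square_integrable lborel (\<lambda>\<xi>. inv_fourier U (- \<xi>))"
    and "norm2 lborel (\<lambda>\<xi>. inv_fourier U (- \<xi>)) \<le> norm2 lborel U"
proof -
  have [measurable]: "U \<in> borel_measurable borel" using borel_measurable_integrable[OF U(1)] by simp
  define \<epsilon> where "\<epsilon> k = 1 / real (Suc k)" for k
  have \<epsilon>: "\<epsilon> k > 0" "\<epsilon> \<longlonglongrightarrow> 0" for k
    unfolding \<epsilon>_def using LIMSEQ_Suc[OF lim_1_over_n] by auto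
  have "square_integrable lborel (\<lambda>\<xi>. inv_fourier U (- \<xi>)) \<and>
      norm2 lborel (\<lambda>\<xi>. inv_fourier U (- \<xi>)) \<le> norm2 lborel U"
  proof (rule norm2_Fatou)
    show "square_integrable lborel (\<lambda>\<xi>. inv_fourier U (- \<xi>) * complex_of_real (gauss (\<epsilon> k) \<xi>))" for k
      by (rule norm2_fourier_gauss_le(1)[OF U \<epsilon>(1)])
    show "\<forall>\<^sub>F k in sequentially. norm2 lborel (\<lambda>\<xi>. inv_fourier U (- \<xi>) * complex_of_real (gauss (\<epsilon> k) \<xi>))
        \<le> norm2 lborel U"
      using norm2_fourier_gauss_le(2)[OF U \<epsilon>(1)] by simp
    have "(\<lambda>k. inv_fourier U (- \<xi>) * complex_of_real (gauss (\<epsilon> k) \<xi>)) \<longlonglongrightarrow> inv_fourier U (- \<xi>) * complex_of_real 1" for \<xi>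
      by (intro tendsto_mult tendsto_const tendsto_of_real gauss_tendsto_1 \<epsilon>(2))
    then show "AE \<xi> in lborel. (\<lambda>k. inv_fourier U (- \<xi>) * complex_of_real (gauss (\<epsilon> k) \<xi>)) \<longlonglongrightarrow> inv_fourier U (- \<xi>)"
      by simp
  qed measurable
  then show "square_integrable lborel (\<lambda>\<xi>. inv_fourier U (- \<xi>))"
    "norm2 lborel (\<lambda>\<xi>. inv_fourier U (- \<xi>)) \<le> norm2 lborel U" by auto
qed

lemma square_integrable_inv_fourier:
  assumes "integrable lborel U" "square_integrable lborel U"
  shows "square_integrable lborel (inv_fourier U)"
  using square_integrable_reflect[OF norm2_fourier_le(1)[OF assms], of 0] by simp

text \<open>The \<open>lborel\<close> form of \<open>is_fourier_L2\<close>. It is a relation because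
  a transform on L2 is determined only up to null sets.\<close>

definition fourier_pair :: "('a::euclidean_space \<Rightarrow> complex) \<Rightarrow> ('a \<Rightarrow> complex) \<Rightarrow> bool" where
  "fourier_pair u v \<longleftrightarrow> square_integrable lborel u \<and> square_integrable lborel v \<and>
     (\<exists>U. (\<forall>k::nat. integrable lborel (U k) \<and> square_integrable lborel (U k)) \<and>
       (\<lambda>k. norm2 lborel (\<lambda>x. U k x - u x)) \<longlonglongrightarrow> 0 \<and>
       (\<lambda>k. norm2 lborel (\<lambda>\<xi>. inv_fourier (U k) (- \<xi>) - v \<xi>)) \<longlonglongrightarrow> 0)"

text \<open>The left side is continuous in u and the right side in v, both for the L2 norm, so the
  multiplication formula for the approximants passes to the limit. Square integrability of \<Phi>
  provides the second factor of each pairing.\<close>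

lemma fourier_pair_integral_mult_inv_fourier:
  assumes uv: "fourier_pair u v" and \<Phi>: "integrable lborel \<Phi>" "square_integrable lborel \<Phi>"
  shows "(\<integral>y. u y * inv_fourier \<Phi> (x - y) \<partial>lborel) = inv_fourier (\<lambda>\<xi>. v \<xi> * \<Phi> \<xi>) x"
proof -
  obtain U where U: "\<And>k::nat. integrable lborel (U k)" "\<And>k. square_integrable lborel (U k)"
    "(\<lambda>k. norm2 lborel (\<lambda>x. U k x - u x)) \<longlonglongrightarrow> 0"
    "(\<lambda>k. norm2 lborel (\<lambda>\<xi>. inv_fourier (U k) (- \<xi>) - v \<xi>)) \<longlonglongrightarrow> 0"
    and u: "square_integrable lborel u" and v: "square_integrable lborel v"
    using uv unfolding fourier_pair_def by blast
  have \<Phi>w: "square_integrable lborel (\<lambda>\<xi>. \<Phi> \<xi> * wave x \<xi>)"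
    by (rule square_integrable_bounded_mult(1)[OF \<Phi>(2), of _ 1]) auto
  have "(\<lambda>k. \<integral>y. U k y * inv_fourier \<Phi> (x - y) \<partial>lborel) \<longlonglongrightarrow> (\<integral>y. u y * inv_fourier \<Phi> (x - y) \<partial>lborel)"
    by (rule tendsto_integral_mult_norm2[OF u U(2) square_integrable_reflect U(3)])
      (rule square_integrable_inv_fourier[OF \<Phi>])
  moreover have "(\<lambda>k. \<integral>\<xi>. inv_fourier (U k) (- \<xi>) * (\<Phi> \<xi> * wave x \<xi>) \<partial>lborel)
      \<longlonglongrightarrow> (\<integral>\<xi>. v \<xi> * (\<Phi> \<xi> * wave x \<xi>) \<partial>lborel)"
    by (rule tendsto_integral_mult_norm2[OF v norm2_fourier_le(1)[OF U(1,2)] \<Phi>w U(4)])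
  moreover have "(\<integral>y. U k y * inv_fourier \<Phi> (x - y) \<partial>lborel)
      = (\<integral>\<xi>. inv_fourier (U k) (- \<xi>) * (\<Phi> \<xi> * wave x \<xi>) \<partial>lborel)" for k
    unfolding integral_mult_inv_fourier[OF U(1) \<Phi>(1)] by (simp add: inv_fourier_def mult.assoc)
  ultimately show ?thesis
    using LIMSEQ_unique by (fastforce simp: inv_fourier_def mult.assoc)
qed

text \<open>Cutting off to balls gives approximants in both L1 and L2: on a set of finite measure,
  |u| \<le> |u|^2 + 1 yields integrability. The scalar type is left general because complex
  functions are truncated for the transform and real ones for the autocorrelation.\<close>

lemma
  fixes u :: "'a::euclidean_space \<Rightarrow> 'b::{real_normed_field,second_countable_topology,banach}"
  assumes u: "square_integrable lborel u"
  defines "U \<equiv> \<lambda>(k::nat) x. u x * indicator (ball 0 (real k)) x"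
  shows integrable_truncation: "integrable lborel (U k)"
    and square_integrable_truncation: "square_integrable lborel (U k)"
    and norm2_truncation_tendsto: "(\<lambda>k. norm2 lborel (\<lambda>x. U k x - u x)) \<longlonglongrightarrow> 0"
proof -
  have [measurable]: "u \<in> borel_measurable borel" using square_integrableD(1)[OF u] by simp
  have [measurable]: "ball 0 r \<in> sets (borel :: 'a measure)" for r by simp
  have [measurable]: "U k \<in> borel_measurable borel" for k unfolding U_def by measurable
  show "square_integrable lborel (U k)" for k
    unfolding U_def by (rule square_integrable_bounded_mult(1)[OF u, of _ 1]) (auto simp: indicator_def)
  show "integrable lborel (U k)" for k
  proof (rule Bochner_Integration.integrable_bound)
    have "integrable lborel (\<lambda>x::'a. indicator (ball 0 (real k)) x :: real)"
      using emeasure_lborel_ball_finite[of "0::'a" "real k"] by (intro integrable_real_indicator) simp_all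
    then show "integrable lborel (\<lambda>x. (norm (u x))\<^sup>2 + indicator (ball 0 (real k)) x)"
      using square_integrableD(2)[OF u] by simp
    have "norm (u x) \<le> (norm (u x))\<^sup>2 + 1" for x
      using sum_squares_bound[of "norm (u x)" 1] norm_ge_zero[of "u x"] unfolding one_power2 by linarith
    then show "AE x in lborel. norm (U k x) \<le> norm ((norm (u x))\<^sup>2 + indicator (ball 0 (real k)) x)"
      by (auto simp: U_def indicator_def)
  qed measurable
  have "(\<lambda>k. \<integral>x. (norm (U k x - u x))\<^sup>2 \<partial>lborel) \<longlonglongrightarrow> integral\<^sup>L lborel (\<lambda>x::'a. 0)"
  proof (rule integral_dominated_convergence[where w = "\<lambda>x. (norm (u x))\<^sup>2"])
    show "integrable lborel (\<lambda>x. (norm (u x))\<^sup>2)" by (rule square_integrableD(2)[OF u])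
    show "AE x in lborel. (\<lambda>k. (norm (U k x - u x))\<^sup>2) \<longlonglongrightarrow> 0"
    proof (rule AE_I2)
      fix x :: 'a
      have "\<forall>\<^sub>F k in sequentially. (norm (U k x - u x))\<^sup>2 = 0"
        using eventually_gt_at_top[of "nat \<lceil>norm x\<rceil>"]
      proof eventually_elim
        case (elim k)
        then have "norm x < real k" by linarith
        then show ?case by (simp add: U_def)
      qed
      then show "(\<lambda>k. (norm (U k x - u x))\<^sup>2) \<longlonglongrightarrow> 0" by (rule tendsto_eventually)
    qed
    show "AE x in lborel. norm ((norm (U k x - u x))\<^sup>2) \<le> (norm (u x))\<^sup>2" for k
      by (auto simp: U_def indicator_def)
  qed measurable
  then have "(\<lambda>k. sqrt (\<integral>x. (norm (U k x - u x))\<^sup>2 \<partial>lborel)) \<longlonglongrightarrow> sqrt 0"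
    by (intro tendsto_real_sqrt) simp
  then show "(\<lambda>k. norm2 lborel (\<lambda>x. U k x - u x)) \<longlonglongrightarrow> 0" by (simp add: norm2_def)
qed

text \<open>The truncations are Cauchy in L2; by contraction so are their transforms, and
  completeness supplies the limit.\<close>

lemma fourier_pair_exists:
  fixes u :: "'a::euclidean_space \<Rightarrow> complex"
  assumes u: "square_integrable lborel u"
  obtains v where "fourier_pair u v"
proof -
  define U where "U k x = u x * indicator (ball 0 (real k)) x" for k x
  have U1: "\<And>k. integrable lborel (U k)" and U2: "\<And>k. square_integrable lborel (U k)"
    and lim: "(\<lambda>k. norm2 lborel (\<lambda>x. U k x - u x)) \<longlonglongrightarrow> 0"
    unfolding U_def using integrable_truncation[OF u] square_integrable_truncation[OF u]
      norm2_truncation_tendsto[OF u] by auto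
  have F: "square_integrable lborel (\<lambda>\<xi>. inv_fourier (U k) (- \<xi>))" for k
    by (rule norm2_fourier_le(1)[OF U1 U2])
  have Fdiff: "norm2 lborel (\<lambda>\<xi>. inv_fourier (U m) (- \<xi>) - inv_fourier (U n) (- \<xi>))
      \<le> norm2 lborel (\<lambda>x. U m x - u x) + norm2 lborel (\<lambda>x. U n x - u x)" for m n
  proof -
    have "norm2 lborel (\<lambda>\<xi>. inv_fourier (U m) (- \<xi>) - inv_fourier (U n) (- \<xi>))
        \<le> norm2 lborel (\<lambda>x. U m x - U n x)"
      unfolding inv_fourier_diff[OF U1 U1, symmetric]
      by (rule norm2_fourier_le(2)) (use U1 square_integrable_diff(1)[OF U2 U2] in auto)
    also have "\<dots> \<le> norm2 lborel (\<lambda>x. U m x - u x) + norm2 lborel (\<lambda>x. U n x - u x)"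
      using square_integrable_diff(2)[OF square_integrable_diff(1)[OF U2 u] square_integrable_diff(1)[OF U2 u], of m n]
      by simp
    finally show ?thesis .
  qed
  have "\<exists>N. \<forall>m\<ge>N. \<forall>n\<ge>N. norm2 lborel (\<lambda>\<xi>. inv_fourier (U m) (- \<xi>) - inv_fourier (U n) (- \<xi>)) < e"
    if e: "e > 0" for e
  proof -
    obtain N where "\<forall>m\<ge>N. norm2 lborel (\<lambda>x. U m x - u x) < e / 2"
      using LIMSEQ_D[OF lim, of "e / 2"] e by auto
    then show ?thesis using Fdiff by (intro exI[of _ N]) (smt (verit) field_sum_of_halves)
  qed
  from norm2_complete[OF F this] obtain v where "square_integrable lborel v"
    "(\<lambda>k. norm2 lborel (\<lambda>\<xi>. inv_fourier (U k) (- \<xi>) - v \<xi>)) \<longlonglongrightarrow> 0" by blast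
  then have "fourier_pair u v" using u U1 U2 lim unfolding fourier_pair_def by blast
  then show ?thesis by (rule that)
qed

section \<open>Quadratic forms of convolution kernels\<close>

text \<open>Here \<Omega> is gone: M stands for the total variation, defined on the Borel subsets of
  \<Omega>, and measurability of the identity lets Borel functions on the whole space be integrated
  against it.\<close>

locale polar_measure = finite_measure M for M :: "'a::euclidean_space measure" +
  fixes \<sigma> :: "'a \<Rightarrow> real"
  assumes id_measurable [measurable]: "(\<lambda>x. x) \<in> M \<rightarrow>\<^sub>M borel"
    and sign_measurable [measurable]: "\<sigma> \<in> borel_measurable M"
    and sign_bound: "\<bar>\<sigma> x\<bar> \<le> 1"
begin

lemma integrable_mult_sign:
  assumes [measurable]: "h \<in> borel_measurable M" and C: "\<And>x. \<bar>h x\<bar> \<le> C"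
  shows "integrable M (\<lambda>x. h x * \<sigma> x)"
proof (rule integrable_const_bound[of _ C])
  have "\<bar>h x * \<sigma> x\<bar> \<le> C" for x
    using mult_mono[OF C[of x] sign_bound[of x]] C[of x] by (simp add: abs_mult)
  then show "AE x in M. norm (h x * \<sigma> x) \<le> C" by simp
qed measurable

lemma integrable_sign: "integrable M \<sigma>"
  using integrable_mult_sign[of "\<lambda>_. 1" 1] by simp

lemma integral_mult_sign_bound:
  assumes [measurable]: "h \<in> borel_measurable M" and C: "\<And>x. \<bar>h x\<bar> \<le> C"
  shows "\<bar>\<integral>x. h x * \<sigma> x \<partial>M\<bar> \<le> C * measure M (space M)"
proof -
  have le: "\<bar>h x * \<sigma> x\<bar> \<le> C" for x
    using mult_mono[OF C[of x] sign_bound[of x]] C[of x] by (simp add: abs_mult)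
  have "norm (\<integral>x. h x * \<sigma> x \<partial>M) \<le> (\<integral>x. C \<partial>M)"
    by (rule Bochner_Integration.integral_norm_bound_integral[OF integrable_mult_sign[OF assms] integrable_const])
      (simp add: le)
  then show ?thesis by (simp add: mult.commute)
qed

text \<open>For the signed measure \<mu> = \<sigma> M, \<open>potential h\<close> is h * \<mu>, and
  \<open>energy h\<close> below is the quadratic form <h * \<mu>|\<mu>>.\<close>

definition potential :: "('a \<Rightarrow> real) \<Rightarrow> 'a \<Rightarrow> real" where
  "potential h x = (\<integral>y. h (x - y) * \<sigma> y \<partial>M)"

definition energy :: "('a \<Rightarrow> real) \<Rightarrow> real" where
  "energy h = (\<integral>x. potential h x * \<sigma> x \<partial>M)"

lemma measurable_potential [measurable]:
  assumes [measurable]: "h \<in> borel_measurable borel"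
  shows "potential h \<in> borel_measurable borel"
proof -
  have "(\<lambda>x. \<integral>y. h (x - y) * \<sigma> y \<partial>M) \<in> borel_measurable borel" by measurable
  then show ?thesis by (simp add: potential_def[abs_def])
qed

lemma measurable_comp_id: "h \<in> borel_measurable borel \<Longrightarrow> h \<in> borel_measurable M"
  using measurable_compose[OF id_measurable] by simp

lemma potential_bound:
  assumes [measurable]: "h \<in> borel_measurable borel" and C: "\<And>x. \<bar>h x\<bar> \<le> C"
  shows "\<bar>potential h x\<bar> \<le> C * measure M (space M)"
  unfolding potential_def by (rule integral_mult_sign_bound) (use C in auto)

lemma energy_diff:
  assumes [measurable]: "h \<in> borel_measurable borel" "k \<in> borel_measurable borel"
    and C: "\<And>x. \<bar>h x\<bar> \<le> C" and D: "\<And>x. \<bar>k x\<bar> \<le> D"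
  shows "energy (\<lambda>x. c * h x - k x) = c * energy h - energy k"
proof -
  have "integrable M (\<lambda>y. h (x - y) * \<sigma> y)" "integrable M (\<lambda>y. k (x - y) * \<sigma> y)" for x
    using C D by (auto intro!: integrable_mult_sign)
  then have pot: "potential (\<lambda>x. c * h x - k x) x = c * potential h x - potential k x" for x
    by (simp add: potential_def left_diff_distrib mult.assoc)
  have "integrable M (\<lambda>x. potential h x * \<sigma> x)"
    by (rule integrable_mult_sign[OF measurable_comp_id potential_bound[of h C]]) (use C in auto)
  moreover have "integrable M (\<lambda>x. potential k x * \<sigma> x)"
    by (rule integrable_mult_sign[OF measurable_comp_id potential_bound[of k D]]) (use D in auto)
  ultimately show ?thesis
    by (simp add: energy_def pot left_diff_distrib mult.assoc)
qed

text \<open>Dominated convergence in the inner and then in the outer integral. Convergence is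
  required at every point because M may charge Lebesgue null sets.\<close>

lemma energy_tendsto:
  fixes h :: "nat \<Rightarrow> 'a \<Rightarrow> real"
  assumes [measurable]: "\<And>k. h k \<in> borel_measurable borel" "g \<in> borel_measurable borel"
    and C: "\<And>k x. \<bar>h k x\<bar> \<le> C" and lim: "\<And>x. (\<lambda>k. h k x) \<longlonglongrightarrow> g x"
  shows "(\<lambda>k. energy (h k)) \<longlonglongrightarrow> energy g"
proof -
  have dom: "\<bar>f x * \<sigma> x\<bar> \<le> D" if "\<And>x. \<bar>f x\<bar> \<le> D" for f :: "'a \<Rightarrow> real" and D x
    using mult_mono[OF that[of x] sign_bound[of x]] that[of x] by (simp add: abs_mult)
  have pot: "(\<lambda>k. potential (h k) x) \<longlonglongrightarrow> potential g x" for x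
    unfolding potential_def
  proof (rule integral_dominated_convergence[where w = "\<lambda>_. C"])
    show "AE y in M. (\<lambda>k. h k (x - y) * \<sigma> y) \<longlonglongrightarrow> g (x - y) * \<sigma> y"
      by (intro AE_I2 tendsto_mult lim tendsto_const)
    show "AE y in M. norm (h k (x - y) * \<sigma> y) \<le> C" for k
      using dom[of "\<lambda>y. h k (x - y)" C] C by simp
  qed (auto simp: integrable_const)
  show ?thesis unfolding energy_def
  proof (rule integral_dominated_convergence[where w = "\<lambda>_. C * measure M (space M)"])
    show "(\<lambda>x. potential g x * \<sigma> x) \<in> borel_measurable M"
      "\<And>k. (\<lambda>x. potential (h k) x * \<sigma> x) \<in> borel_measurable M"
      by (auto intro!: borel_measurable_times measurable_comp_id)
    show "AE x in M. (\<lambda>k. potential (h k) x * \<sigma> x) \<longlonglongrightarrow> potential g x * \<sigma> x"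
      by (intro AE_I2 tendsto_mult pot tendsto_const)
    show "AE x in M. norm (potential (h k) x * \<sigma> x) \<le> C * measure M (space M)" for k
      using dom[of "potential (h k)", OF potential_bound[of "h k" C]] C by simp
  qed (rule integrable_const)
qed

text \<open>The easy half of Bochner's theorem: by Fubini the energy is the integral of H |m|^2,
  where m is the transform of \<sigma> M, bounded because M is finite.\<close>

lemma energy_nonneg:
  fixes h :: "'a \<Rightarrow> real" and H :: "'a \<Rightarrow> complex"
  assumes H: "integrable lborel H" and pos: "AE \<xi> in lborel. Im (H \<xi>) = 0 \<and> 0 \<le> Re (H \<xi>)"
    and h: "\<And>x. complex_of_real (h x) = inv_fourier H x"
  shows "0 \<le> energy h"
proof -
  interpret pair_sigma_finite M "lborel :: 'a measure" by standard
  have [measurable]: "H \<in> borel_measurable borel" using borel_measurable_integrable[OF H] by simp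
  define m where "m \<xi> = (\<integral>x. complex_of_real (\<sigma> x) * wave x \<xi> \<partial>M)" for \<xi>
  have m [measurable]: "m \<in> borel_measurable borel" unfolding m_def by measurable
  have cm: "(\<lambda>\<xi>. cnj (m \<xi>)) \<in> borel_measurable borel"
    by (rule measurable_compose[OF m]) (intro borel_measurable_continuous_onI continuous_intros)
  have \<sigma>: "integrable M (\<lambda>x. complex_of_real (\<sigma> x))" using integrable_sign by (simp add: complex_of_real_integrable_eq)
  have mb: "norm (m \<xi>) \<le> (\<integral>x. \<bar>\<sigma> x\<bar> \<partial>M)" for \<xi>
    unfolding m_def using integral_norm_bound[of M "\<lambda>x. complex_of_real (\<sigma> x) * wave x \<xi>"]
    by (simp add: norm_mult)
  have w: "(\<integral>y. complex_of_real (\<sigma> y) * wave (x - y) \<xi> \<partial>M) = cnj (m \<xi>) * wave x \<xi>" for x \<xi>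
  proof -
    have "(\<integral>y. complex_of_real (\<sigma> y) * wave (x - y) \<xi> \<partial>M)
        = (\<integral>y. cnj (complex_of_real (\<sigma> y) * wave y \<xi>) * wave x \<xi> \<partial>M)"
      by (simp add: wave_diff wave_minus mult_ac)
    then show ?thesis unfolding m_def
      using Bochner_Integration.integral_cnj[of M "\<lambda>y. complex_of_real (\<sigma> y) * wave y \<xi>"] by simp
  qed
  have pot: "complex_of_real (potential h x) = (\<integral>\<xi>. (H \<xi> * cnj (m \<xi>)) * wave x \<xi> \<partial>lborel)" for x
  proof -
    have "complex_of_real (potential h x) = (\<integral>y. complex_of_real (\<sigma> y) * inv_fourier H (x - y) \<partial>M)"
      unfolding potential_def integral_complex_of_real[symmetric] by (simp add: h mult.commute)
    also have "\<dots> = (\<integral>\<xi>. H \<xi> * (\<integral>y. complex_of_real (\<sigma> y) * wave (x - y) \<xi> \<partial>M) \<partial>lborel)"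
      unfolding inv_fourier_def by (rule Fubini_mult_bounded[OF \<sigma> H, of _ 1]) auto
    finally show ?thesis by (simp add: w mult.assoc)
  qed
  have Hm: "integrable lborel (\<lambda>\<xi>. H \<xi> * cnj (m \<xi>))"
  proof (rule Bochner_Integration.integrable_bound)
    show "integrable lborel (\<lambda>\<xi>. H \<xi> * complex_of_real (\<integral>x. \<bar>\<sigma> x\<bar> \<partial>M))" using H by simp
    show "AE \<xi> in lborel. norm (H \<xi> * cnj (m \<xi>)) \<le> norm (H \<xi> * complex_of_real (\<integral>x. \<bar>\<sigma> x\<bar> \<partial>M))"
      using order_trans[OF mb abs_ge_self] by (auto simp: norm_mult intro!: mult_left_mono)
    show "(\<lambda>\<xi>. H \<xi> * cnj (m \<xi>)) \<in> borel_measurable lborel"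
      using cm borel_measurable_integrable[OF H] by (intro borel_measurable_times) simp_all
  qed
  have "complex_of_real (energy h) = (\<integral>x. complex_of_real (\<sigma> x) * (\<integral>\<xi>. (H \<xi> * cnj (m \<xi>)) * wave x \<xi> \<partial>lborel) \<partial>M)"
    unfolding energy_def integral_complex_of_real[symmetric] of_real_mult pot by (simp add: mult.commute)
  also have "\<dots> = (\<integral>\<xi>. (H \<xi> * cnj (m \<xi>)) * m \<xi> \<partial>lborel)"
    by (subst (2) m_def) (rule Fubini_mult_bounded[OF \<sigma> Hm, of _ 1], auto)
  also have "\<dots> = (\<integral>\<xi>. complex_of_real (Re (H \<xi>) * (norm (m \<xi>))\<^sup>2) \<partial>lborel)"
  proof (rule integral_cong_AE)
    show "AE \<xi> in lborel. (H \<xi> * cnj (m \<xi>)) * m \<xi> = complex_of_real (Re (H \<xi>) * (norm (m \<xi>))\<^sup>2)"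
      using pos
    proof eventually_elim
      case (elim \<xi>)
      then have "H \<xi> = complex_of_real (Re (H \<xi>))" by (simp add: complex_eq_iff)
      then show ?case by (simp add: complex_norm_square mult_ac del: of_real_power)
    qed
    show "(\<lambda>\<xi>. (H \<xi> * cnj (m \<xi>)) * m \<xi>) \<in> borel_measurable lborel"
      using borel_measurable_times[OF borel_measurable_integrable[OF Hm], of m] m by simp
    have "(\<lambda>\<xi>. Re (H \<xi>) * (norm (m \<xi>))\<^sup>2) \<in> borel_measurable borel"
      using m by (intro borel_measurable_times borel_measurable_power borel_measurable_norm) measurable
    then show "(\<lambda>\<xi>. complex_of_real (Re (H \<xi>) * (norm (m \<xi>))\<^sup>2)) \<in> borel_measurable lborel"
      using measurable_compose[OF _ borel_measurable_of_real] by simp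
  qed
  finally have "energy h = (\<integral>\<xi>. Re (H \<xi>) * (norm (m \<xi>))\<^sup>2 \<partial>lborel)"
    unfolding integral_complex_of_real of_real_eq_iff .
  also have "\<dots> \<ge> 0" by (rule integral_nonneg_AE) (use pos in auto)
  finally show ?thesis .
qed

end

text \<open>This is \<psi> * \<psi>; for symmetric \<psi> it equals the integral of \<psi> (t + s)
  \<psi> s, whence the name.\<close>

definition autocorrelation :: "('a::euclidean_space \<Rightarrow> real) \<Rightarrow> 'a \<Rightarrow> real" where
  "autocorrelation \<psi> t = (\<integral>s. \<psi> (t - s) * \<psi> s \<partial>lborel)"

lemma measurable_autocorrelation [measurable]:
  assumes [measurable]: "\<psi> \<in> borel_measurable borel"
  shows "autocorrelation \<psi> \<in> borel_measurable borel"
proof -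
  have "(\<lambda>t. \<integral>s. \<psi> (t - s) * \<psi> s \<partial>lborel) \<in> borel_measurable borel" by measurable
  then show ?thesis by (simp add: autocorrelation_def[abs_def])
qed

lemma autocorrelation_bound:
  assumes "square_integrable lborel \<psi>"
  shows "\<bar>autocorrelation \<psi> t\<bar> \<le> (norm2 lborel \<psi>)\<^sup>2"
  unfolding autocorrelation_def
  using square_integrable_mult(2)[OF square_integrable_reflect[OF assms, of t] assms]
  by (simp add: norm2_reflect[OF assms] power2_eq_square)

text \<open>Expand (g w)^2 as an integral over pairs (x, y) and integrate over w first. Fubini
  applies because Cauchy-Schwarz in w bounds the inner integral of the modulus uniformly in the
  pair, and the product of M with itself is finite. By symmetry of \<psi>, g is \<psi> *
  \<mu>.\<close>

lemma (in polar_measure) energy_autocorrelation: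
  fixes \<psi> :: "'a \<Rightarrow> real"
  assumes \<psi>: "square_integrable lborel \<psi>" and sym: "\<And>x. \<psi> (- x) = \<psi> x" and C: "\<And>x. \<bar>\<psi> x\<bar> \<le> C"
  defines "g \<equiv> (\<lambda>w. \<integral>x. \<psi> (x - w) * \<sigma> x \<partial>M)"
  shows "integrable lborel (\<lambda>w. (g w)\<^sup>2)" and "(\<integral>w. (g w)\<^sup>2 \<partial>lborel) = energy (autocorrelation \<psi>)"
proof -
  have [measurable]: "\<psi> \<in> borel_measurable borel" using square_integrableD(1)[OF \<psi>] by simp
  interpret MM: finite_measure "M \<Otimes>\<^sub>M M"
    by (rule finite_measure_pair_measure) unfold_locales
  interpret MM: pair_sigma_finite M M by standard
  interpret MML: pair_sigma_finite "M \<Otimes>\<^sub>M M" "lborel :: 'a measure" by standard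
  define F where "F z w = \<psi> (fst z - w) * \<psi> (snd z - w) * (\<sigma> (fst z) * \<sigma> (snd z))" for z w
  have Fm [measurable]: "(\<lambda>(z, w). F z w) \<in> borel_measurable ((M \<Otimes>\<^sub>M M) \<Otimes>\<^sub>M lborel)"
    unfolding F_def by measurable
  have shift: "square_integrable lborel (\<lambda>w. \<psi> (x - w))" "norm2 lborel (\<lambda>w. \<psi> (x - w)) = norm2 lborel \<psi>" for x
    using square_integrable_reflect[OF \<psi>] norm2_reflect[OF \<psi>] by auto
  have int: "integrable lborel (\<lambda>w. F z w)" for z
    unfolding F_def using square_integrable_mult(1)[OF shift(1) shift(1)] by simp
  have kappa: "(\<integral>w. \<psi> (x - w) * \<psi> (y - w) \<partial>lborel) = autocorrelation \<psi> (x - y)" for x y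
  proof -
    let ?F = "\<lambda>w. \<psi> (x - w) * \<psi> (y - w)"
    \<comment> \<open>Two reflections compose to the translation w = y + s. The second factor
      becomes \<psi> (- s), where the symmetry enters.\<close>
    have "(\<integral>w. ?F w \<partial>lborel) = (\<integral>s. ?F (y - s) \<partial>lborel)"
      by (rule integral_reflect[symmetric]) measurable
    also have "\<dots> = (\<integral>s. ?F (y - (0 - s)) \<partial>lborel)"
      by (rule integral_reflect[symmetric]) measurable
    also have "\<dots> = autocorrelation \<psi> (x - y)"
      unfolding autocorrelation_def by (simp add: algebra_simps sym)
    finally show ?thesis .
  qed
  have nb: "(\<integral>w. norm (F z w) \<partial>lborel) \<le> (norm2 lborel \<psi>)\<^sup>2" for z
  proof -
    have s: "\<bar>\<sigma> (fst z) * \<sigma> (snd z)\<bar> \<le> 1"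
      using mult_mono[OF sign_bound[of "fst z"] sign_bound[of "snd z"]] by (simp add: abs_mult)
    have i: "(\<integral>w. \<bar>\<psi> (fst z - w)\<bar> * \<bar>\<psi> (snd z - w)\<bar> \<partial>lborel) \<le> (norm2 lborel \<psi>)\<^sup>2"
      using integral_norm_mult_le_norm2[OF shift(1)[of "fst z"] shift(1)[of "snd z"]]
      by (simp add: shift(2) power2_eq_square)
    have "(\<integral>w. norm (F z w) \<partial>lborel) = (\<integral>w. \<bar>\<psi> (fst z - w)\<bar> * \<bar>\<psi> (snd z - w)\<bar> \<partial>lborel) * \<bar>\<sigma> (fst z) * \<sigma> (snd z)\<bar>"
      by (simp add: F_def abs_mult mult.assoc flip: integral_mult_left_zero)
    also have "\<dots> \<le> (norm2 lborel \<psi>)\<^sup>2 * 1"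
      by (rule mult_mono[OF i s]) auto
    finally show ?thesis by simp
  qed
  have Fint: "integrable ((M \<Otimes>\<^sub>M M) \<Otimes>\<^sub>M lborel) (\<lambda>(z, w). F z w)"
  proof (rule MML.Fubini_integrable[OF Fm])
    show "integrable (M \<Otimes>\<^sub>M M) (\<lambda>z. \<integral>w. norm (case (z, w) of (z, w) \<Rightarrow> F z w) \<partial>lborel)"
      using nb by (intro MM.integrable_const_bound[of _ "(norm2 lborel \<psi>)\<^sup>2"]) auto
    show "AE z in M \<Otimes>\<^sub>M M. integrable lborel (\<lambda>w. case (z, w) of (z, w) \<Rightarrow> F z w)"
      using int by simp
  qed
  have Fw: "(\<integral>w. F z w \<partial>lborel) = autocorrelation \<psi> (fst z - snd z) * (\<sigma> (fst z) * \<sigma> (snd z))" for z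
    using kappa[of "fst z" "snd z"] by (simp add: F_def)
  have Fz: "(\<integral>z. F z w \<partial>(M \<Otimes>\<^sub>M M)) = (g w)\<^sup>2" for w
  proof -
    have i: "integrable M (\<lambda>x. \<psi> (x - w) * \<sigma> x)" using C by (intro integrable_mult_sign[of _ C]) auto
    have "integrable (M \<Otimes>\<^sub>M M) (\<lambda>(x, y). (\<psi> (x - w) * \<sigma> x) * (\<psi> (y - w) * \<sigma> y))"
      using MM.integrable_pair_mult_bounded[OF i i, of "\<lambda>_. 1" 1] by simp
    from MM.integral_fst[OF this]
    have "(\<integral>x. (\<integral>y. (\<psi> (x - w) * \<sigma> x) * (\<psi> (y - w) * \<sigma> y) \<partial>M) \<partial>M) = (\<integral>z. F z w \<partial>(M \<Otimes>\<^sub>M M))"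
      by (simp add: F_def case_prod_unfold mult_ac)
    then show ?thesis by (simp add: g_def power2_eq_square)
  qed
  show "integrable lborel (\<lambda>w. (g w)\<^sup>2)"
    using MML.integrable_snd[OF Fint] by (simp add: Fz)
  have "(\<integral>w. (g w)\<^sup>2 \<partial>lborel) = (\<integral>z. (\<integral>w. F z w \<partial>lborel) \<partial>(M \<Otimes>\<^sub>M M))"
    using MML.Fubini_integral[OF Fint] by (simp add: Fz)
  also have "\<dots> = integral\<^sup>L (M \<Otimes>\<^sub>M M) (\<lambda>(x, y). autocorrelation \<psi> (x - y) * (\<sigma> x * \<sigma> y))"
    by (simp add: Fw case_prod_unfold)
  also have "\<dots> = (\<integral>x. \<integral>y. autocorrelation \<psi> (x - y) * (\<sigma> x * \<sigma> y) \<partial>M \<partial>M)"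
  proof (rule MM.integral_fst[symmetric])
    have "integrable (M \<Otimes>\<^sub>M M) (\<lambda>z. autocorrelation \<psi> (fst z - snd z) * (\<sigma> (fst z) * \<sigma> (snd z)))"
      using MML.integrable_fst[OF Fint] by (simp add: Fw)
    then show "integrable (M \<Otimes>\<^sub>M M) (\<lambda>(x, y). autocorrelation \<psi> (x - y) * (\<sigma> x * \<sigma> y))"
      by (simp add: case_prod_unfold)
  qed
  also have "\<dots> = energy (autocorrelation \<psi>)"
    unfolding energy_def potential_def by (simp add: mult_ac flip: integral_mult_left_zero integral_mult_right_zero)
  finally show "(\<integral>w. (g w)\<^sup>2 \<partial>lborel) = energy (autocorrelation \<psi>)" .
qed

section \<open>Gaussian regularization\<close>

text \<open>A translation is the composition of two reflections.\<close>

lemma integral_translate: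
  fixes f :: "'a::euclidean_space \<Rightarrow> 'b::{banach,second_countable_topology}"
  assumes [measurable]: "f \<in> borel_measurable borel"
  shows "(\<integral>y. f (x + y) \<partial>lborel) = (\<integral>y. f y \<partial>lborel)"
proof -
  have "(\<integral>y. f (x - (0 - y)) \<partial>lborel) = (\<integral>y. f (x - y) \<partial>lborel)"
    by (rule integral_reflect[of "\<lambda>y. f (x - y)"]) measurable
  then show ?thesis by (simp add: integral_reflect)
qed

lemma integral_scale:
  fixes f :: "'a::euclidean_space \<Rightarrow> 'b::{banach,second_countable_topology}"
  assumes [measurable]: "f \<in> borel_measurable borel" and c: "c > 0"
  shows "(\<integral>y. f y \<partial>lborel) = c ^ DIM('a) *\<^sub>R (\<integral>y. f (c *\<^sub>R y) \<partial>lborel)"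
proof -
  have "(\<integral>y. f y \<partial>lborel) = (\<integral>y. f y \<partial>density (distr lborel borel (\<lambda>x. 0 + c *\<^sub>R x)) (\<lambda>_. \<bar>c\<bar> ^ DIM('a)))"
    using c by (subst lborel_affine[of c 0]) simp_all
  also have "\<dots> = c ^ DIM('a) *\<^sub>R (\<integral>y. f (c *\<^sub>R y) \<partial>lborel)"
    using c by (subst integral_density) (auto simp: integral_distr)
  finally show ?thesis .
qed

text \<open>After the substitution y = x - \<delta> z the width sits in the argument of h, so
  continuity gives convergence at every x, with C times \<open>gauss 1\<close> as majorant.\<close>

lemma gauss_kernel_convolution_tendsto:
  fixes h :: "'a::euclidean_space \<Rightarrow> real"
  assumes h: "continuous_on UNIV h" and C: "\<And>x. \<bar>h x\<bar> \<le> C"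
    and \<epsilon>: "\<And>k. \<epsilon> k > 0" "\<epsilon> \<longlonglongrightarrow> 0"
  shows "(\<lambda>k. \<integral>y. h y * gauss_kernel (\<epsilon> k) (x - y) \<partial>lborel) \<longlonglongrightarrow> h x"
proof -
  have [measurable]: "h \<in> borel_measurable borel" using h by (rule borel_measurable_continuous_onI)
  have eq: "(\<integral>y. h y * gauss_kernel \<delta> (x - y) \<partial>lborel) = (\<integral>z. h (x - \<delta> *\<^sub>R z) * gauss 1 z \<partial>lborel)"
    if \<delta>: "\<delta> > 0" for \<delta>
  proof -
    have "(\<integral>y. h y * gauss_kernel \<delta> (x - y) \<partial>lborel) = (\<integral>y. h (x - y) * gauss_kernel \<delta> (x - (x - y)) \<partial>lborel)"
      by (rule integral_reflect[symmetric]) measurable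
    also have "\<dots> = \<delta> ^ DIM('a) *\<^sub>R (\<integral>z. h (x - \<delta> *\<^sub>R z) * gauss_kernel \<delta> (x - (x - \<delta> *\<^sub>R z)) \<partial>lborel)"
      by (rule integral_scale[OF _ \<delta>]) measurable
    also have "\<dots> = (\<integral>z. h (x - \<delta> *\<^sub>R z) * gauss 1 z \<partial>lborel)"
    proof -
      have "gauss_kernel \<delta> (\<delta> *\<^sub>R z) = gauss 1 z / \<delta> ^ DIM('a)" for z :: 'a
        using \<delta> by (simp add: gauss_kernel_def gauss_def power_one_over power2_eq_square field_simps)
      then show ?thesis using \<delta> by simp
    qed
    finally show ?thesis .
  qed
  have g1: "gauss_kernel 1 = (gauss 1 :: 'a \<Rightarrow> real)" by (simp add: gauss_kernel_def fun_eq_iff)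
  have "(\<lambda>k. \<integral>z. h (x - \<epsilon> k *\<^sub>R z) * gauss 1 z \<partial>lborel) \<longlonglongrightarrow> (\<integral>z. h x * gauss 1 (z::'a) \<partial>lborel)"
  proof (rule integral_dominated_convergence[where w = "\<lambda>z. C * gauss 1 z"])
    show "integrable lborel (\<lambda>z::'a. C * gauss 1 z)" using integrable_gauss[of 1, where 'a='a] by simp
    show "AE z in lborel. (\<lambda>k. h (x - \<epsilon> k *\<^sub>R z) * gauss 1 z) \<longlonglongrightarrow> h x * gauss 1 z"
    proof (rule AE_I2)
      fix z :: 'a
      have "(\<lambda>k. x - \<epsilon> k *\<^sub>R z) \<longlonglongrightarrow> x - 0 *\<^sub>R z" by (intro tendsto_intros \<epsilon>)
      then have "(\<lambda>k. h (x - \<epsilon> k *\<^sub>R z)) \<longlonglongrightarrow> h x"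
        using continuous_on_tendsto_compose[OF h, of "\<lambda>k. x - \<epsilon> k *\<^sub>R z" x sequentially] by simp
      then show "(\<lambda>k. h (x - \<epsilon> k *\<^sub>R z) * gauss 1 z) \<longlonglongrightarrow> h x * gauss 1 z"
        by (intro tendsto_mult tendsto_const)
    qed
    show "AE z in lborel. norm (h (x - \<epsilon> k *\<^sub>R z) * gauss 1 z) \<le> C * gauss 1 z" for k
      using C by (intro AE_I2) (simp add: abs_mult abs_of_pos[OF gauss_pos] mult_right_mono less_imp_le[OF gauss_pos])
  qed measurable
  also have "(\<integral>z. h x * gauss 1 (z::'a) \<partial>lborel) = h x"
    using integral_gauss_kernel[of 1, where 'a='a] by (simp add: g1)
  finally show ?thesis by (simp add: eq \<epsilon>)
qed

lemma gauss_kernel_convolution_bound: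
  fixes h :: "'a::euclidean_space \<Rightarrow> real"
  assumes [measurable]: "h \<in> borel_measurable borel" and C: "\<And>x. \<bar>h x\<bar> \<le> C" and \<epsilon>: "\<epsilon> > 0"
  shows "integrable lborel (\<lambda>y. h y * gauss_kernel \<epsilon> (x - y))"
    and "\<bar>\<integral>y. h y * gauss_kernel \<epsilon> (x - y) \<partial>lborel\<bar> \<le> C"
proof -
  have G: "integrable lborel (\<lambda>y. gauss_kernel \<epsilon> (x - y))" "(\<integral>y. gauss_kernel \<epsilon> (x - y) \<partial>lborel) = 1"
    using integrable_gauss_kernel[OF \<epsilon>, where 'a='a] integral_gauss_kernel[OF \<epsilon>, where 'a='a]
    by (auto simp: integrable_reflect integral_reflect)
  then have CG: "integrable lborel (\<lambda>y. C * gauss_kernel \<epsilon> (x - y))" by simp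
  have le: "norm (h y * gauss_kernel \<epsilon> (x - y)) \<le> C * gauss_kernel \<epsilon> (x - y)" for y
    using C[of y] gauss_kernel_nonneg[OF \<epsilon>, of "x - y"] by (simp add: abs_mult mult_right_mono)
  show int: "integrable lborel (\<lambda>y. h y * gauss_kernel \<epsilon> (x - y))"
    by (rule Bochner_Integration.integrable_bound[OF CG])
      (use order_trans[OF le abs_ge_self] in auto)
  show "\<bar>\<integral>y. h y * gauss_kernel \<epsilon> (x - y) \<partial>lborel\<bar> \<le> C"
    using Bochner_Integration.integral_norm_bound_integral[OF int CG le] G by simp
qed

lemma continuous_convolution:
  fixes \<theta> \<psi> :: "'a::euclidean_space \<Rightarrow> real"
  assumes \<theta>: "integrable lborel \<theta>" and \<psi>: "continuous_on UNIV \<psi>" and C: "\<And>x. \<bar>\<psi> x\<bar> \<le> C"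
  shows "continuous_on UNIV (\<lambda>x. \<integral>w. \<theta> w * \<psi> (x - w) \<partial>lborel)"
proof (rule continuous_on_sequentiallyI)
  have [measurable]: "\<psi> \<in> borel_measurable borel" using \<psi> by (rule borel_measurable_continuous_onI)
  have [measurable]: "\<theta> \<in> borel_measurable borel" using borel_measurable_integrable[OF \<theta>] by simp
  fix u :: "nat \<Rightarrow> 'a" and a assume u: "u \<longlonglongrightarrow> a"
  show "(\<lambda>n. \<integral>w. \<theta> w * \<psi> (u n - w) \<partial>lborel) \<longlonglongrightarrow> (\<integral>w. \<theta> w * \<psi> (a - w) \<partial>lborel)"
  proof (rule integral_dominated_convergence[where w = "\<lambda>w. C * \<bar>\<theta> w\<bar>"])
    show "integrable lborel (\<lambda>w. C * \<bar>\<theta> w\<bar>)" using \<theta> by simp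
    show "AE w in lborel. (\<lambda>n. \<theta> w * \<psi> (u n - w)) \<longlonglongrightarrow> \<theta> w * \<psi> (a - w)"
    proof (rule AE_I2)
      fix w
      have "(\<lambda>n. u n - w) \<longlonglongrightarrow> a - w" by (intro tendsto_intros u)
      then have "(\<lambda>n. \<psi> (u n - w)) \<longlonglongrightarrow> \<psi> (a - w)"
        using continuous_on_tendsto_compose[OF \<psi>, of "\<lambda>n. u n - w" "a - w" sequentially] by simp
      then show "(\<lambda>n. \<theta> w * \<psi> (u n - w)) \<longlonglongrightarrow> \<theta> w * \<psi> (a - w)" by (intro tendsto_mult tendsto_const)
    qed
    show "AE w in lborel. norm (\<theta> w * \<psi> (u n - w)) \<le> C * \<bar>\<theta> w\<bar>" for n
      using C by (intro AE_I2) (simp add: abs_mult mult.commute[of C] mult_left_mono)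
  qed measurable
qed

text \<open>\<psi> need not be integrable, so \<open>continuous_convolution\<close> does not apply
  directly. It applies to the truncations of \<psi>, and by Cauchy-Schwarz their convolutions with
  \<psi> converge uniformly.\<close>

lemma continuous_autocorrelation:
  fixes \<psi> :: "'a::euclidean_space \<Rightarrow> real"
  assumes sq: "square_integrable lborel \<psi>" and \<psi>: "continuous_on UNIV \<psi>" and C: "\<And>x. \<bar>\<psi> x\<bar> \<le> C"
  shows "continuous_on UNIV (autocorrelation \<psi>)"
proof (rule uniform_limit_theorem)
  define U where "U k x = \<psi> x * indicator (ball 0 (real k)) x" for k x
  have U1: "\<And>k. integrable lborel (U k)" and U2: "\<And>k. square_integrable lborel (U k)"
    and lim: "(\<lambda>k. norm2 lborel (\<lambda>x. U k x - \<psi> x)) \<longlonglongrightarrow> 0"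
    unfolding U_def using integrable_truncation[OF sq] square_integrable_truncation[OF sq]
      norm2_truncation_tendsto[OF sq] by auto
  show "\<forall>\<^sub>F k in sequentially. continuous_on UNIV (\<lambda>x. \<integral>w. U k w * \<psi> (x - w) \<partial>lborel)"
    using continuous_convolution[OF U1 \<psi> C] by simp
  show "uniform_limit UNIV (\<lambda>k x. \<integral>w. U k w * \<psi> (x - w) \<partial>lborel) (autocorrelation \<psi>) sequentially"
  proof (rule uniform_limitI)
    fix e :: real assume e: "e > 0"
    have "(\<lambda>k. norm2 lborel (\<lambda>x. U k x - \<psi> x) * norm2 lborel \<psi>) \<longlonglongrightarrow> 0"
      by (rule tendsto_mult_left_zero[OF lim])
    then have "\<forall>\<^sub>F k in sequentially. norm2 lborel (\<lambda>x. U k x - \<psi> x) * norm2 lborel \<psi> < e"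
      using e by (rule order_tendstoD)
    then show "\<forall>\<^sub>F k in sequentially. \<forall>x\<in>UNIV. dist (\<integral>w. U k w * \<psi> (x - w) \<partial>lborel) (autocorrelation \<psi> x) < e"
    proof eventually_elim
      case (elim k)
      show ?case
      proof
        fix x
        have r: "square_integrable lborel (\<lambda>w. \<psi> (x - w))" by (rule square_integrable_reflect[OF sq])
        have "(\<integral>w. U k w * \<psi> (x - w) \<partial>lborel) - autocorrelation \<psi> x = (\<integral>w. (U k w - \<psi> w) * \<psi> (x - w) \<partial>lborel)"
          unfolding autocorrelation_def
          using square_integrable_mult(1)[OF U2 r] square_integrable_mult(1)[OF sq r]
          by (simp add: left_diff_distrib mult.commute[of "\<psi> (x - _)"])
        then show "dist (\<integral>w. U k w * \<psi> (x - w) \<partial>lborel) (autocorrelation \<psi> x) < e"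
          using square_integrable_mult(2)[OF square_integrable_diff(1)[OF U2 sq] r, of k] elim
          by (simp add: dist_norm norm2_reflect[OF sq])
      qed
    qed
  qed
qed simp

text \<open>Associativity (\<psi> * \<psi>) * G = \<psi> * (\<psi> * G). With \<psi> only in L2,
  absolute convergence comes from Cauchy-Schwarz in s and from the integrability of G in t.\<close>

lemma integral_autocorrelation_mult:
  fixes \<psi> G :: "'a::euclidean_space \<Rightarrow> real"
  assumes sq: "square_integrable lborel \<psi>" and G: "integrable lborel G"
  shows "(\<integral>t. autocorrelation \<psi> t * G (x - t) \<partial>lborel) = (\<integral>y. \<psi> y * (\<integral>s. \<psi> s * G (x - y - s) \<partial>lborel) \<partial>lborel)"
proof -
  have [measurable]: "\<psi> \<in> borel_measurable borel" using square_integrableD(1)[OF sq] by simp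
  have [measurable]: "G \<in> borel_measurable borel" using borel_measurable_integrable[OF G] by simp
  have Gr: "integrable lborel (\<lambda>t. G (x - t))" using G by (simp add: integrable_reflect)
  have r: "square_integrable lborel (\<lambda>s. \<psi> (t - s))" for t by (rule square_integrable_reflect[OF sq])
  have int: "integrable (lborel \<Otimes>\<^sub>M lborel) (\<lambda>(t, s). \<psi> (t - s) * \<psi> s * G (x - t))"
  proof (rule lborel_pair.Fubini_integrable)
    show "AE t in lborel. integrable lborel (\<lambda>s. case (t, s) of (t, s) \<Rightarrow> \<psi> (t - s) * \<psi> s * G (x - t))"
      using square_integrable_mult(1)[OF r sq] by simp
    show "integrable lborel (\<lambda>t. \<integral>s. norm (case (t, s) of (t, s) \<Rightarrow> \<psi> (t - s) * \<psi> s * G (x - t)) \<partial>lborel)"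
    proof (rule Bochner_Integration.integrable_bound)
      show "integrable lborel (\<lambda>t. (norm2 lborel \<psi>)\<^sup>2 * G (x - t))" using Gr by simp
      have "\<bar>\<integral>s. \<bar>\<psi> (t - s)\<bar> * \<bar>\<psi> s\<bar> \<partial>lborel\<bar> \<le> (norm2 lborel \<psi>)\<^sup>2" for t
        using integral_norm_mult_le_norm2[OF r sq, of t] by (simp add: norm2_reflect[OF sq] power2_eq_square)
      then show "AE t in lborel. norm (\<integral>s. norm (case (t, s) of (t, s) \<Rightarrow> \<psi> (t - s) * \<psi> s * G (x - t)) \<partial>lborel)
          \<le> norm ((norm2 lborel \<psi>)\<^sup>2 * G (x - t))"
        by (intro AE_I2) (simp add: abs_mult mult_right_mono)
    qed measurable
  qed measurable
  have inner: "(\<integral>t. \<psi> (t - s) * \<psi> s * G (x - t) \<partial>lborel) = \<psi> s * (\<integral>r. \<psi> r * G (x - s - r) \<partial>lborel)" for s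
  proof -
    have "(\<integral>t. \<psi> (t - s) * \<psi> s * G (x - t) \<partial>lborel) = (\<integral>r. \<psi> (s + r - s) * \<psi> s * G (x - (s + r)) \<partial>lborel)"
      by (rule integral_translate[symmetric]) measurable
    also have "\<dots> = \<psi> s * (\<integral>r. \<psi> r * G (x - s - r) \<partial>lborel)"
      by (simp add: algebra_simps flip: integral_mult_right_zero)
    finally show ?thesis .
  qed
  have "(\<integral>t. autocorrelation \<psi> t * G (x - t) \<partial>lborel) = (\<integral>t. (\<integral>s. \<psi> (t - s) * \<psi> s * G (x - t) \<partial>lborel) \<partial>lborel)"
    by (simp add: autocorrelation_def)
  also have "\<dots> = (\<integral>s. (\<integral>t. \<psi> (t - s) * \<psi> s * G (x - t) \<partial>lborel) \<partial>lborel)"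
    by (rule lborel_pair.Fubini_integral[OF int, symmetric])
  finally show ?thesis by (simp add: inner)
qed

text \<open>The transforms are given through arbitrary representatives \<open>v\<close> and
  \<open>r\<close>: they enter only through integrals and the almost everywhere inequality, which
  depend on the L2 classes alone.\<close>

lemma (in polar_measure) energy_autocorrelation_le:
  fixes \<psi> \<rho> :: "'a \<Rightarrow> real"
  assumes \<psi>: "square_integrable lborel \<psi>" "continuous_on UNIV \<psi>" "\<And>x. \<bar>\<psi> x\<bar> \<le> C"
    and \<rho>: "continuous_on UNIV \<rho>" "\<And>x. \<bar>\<rho> x\<bar> \<le> D"
    and v: "fourier_pair (\<lambda>x. complex_of_real (\<psi> x)) v"
    and r: "fourier_pair (\<lambda>x. complex_of_real (\<rho> x)) r"
    and le: "AE \<xi> in lborel. (v \<xi>)\<^sup>2 \<le> complex_of_real L * r \<xi>"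
  shows "energy (autocorrelation \<psi>) \<le> L * energy \<rho>"
proof -
  define h where "h x = L * \<rho> x - autocorrelation \<psi> x" for x
  define E where "E = \<bar>L\<bar> * D + (norm2 lborel \<psi>)\<^sup>2"
  have [measurable]: "\<rho> \<in> borel_measurable borel" using \<rho>(1) by (rule borel_measurable_continuous_onI)
  have [measurable]: "\<psi> \<in> borel_measurable borel" using \<psi>(2) by (rule borel_measurable_continuous_onI)
  have h: "continuous_on UNIV h" unfolding h_def
    by (intro continuous_intros \<rho> continuous_autocorrelation[OF \<psi>])
  have [measurable]: "h \<in> borel_measurable borel" using h by (rule borel_measurable_continuous_onI)
  have hE: "\<bar>h x\<bar> \<le> E" for x
    using mult_left_mono[OF \<rho>(2)[of x] abs_ge_zero[of L]] autocorrelation_bound[OF \<psi>(1), of x]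
    unfolding h_def E_def abs_mult[symmetric] by linarith
  have v2: "square_integrable lborel v" and r2: "square_integrable lborel r"
    using v r by (auto simp: fourier_pair_def)
  have vm [measurable]: "v \<in> borel_measurable borel" and rm [measurable]: "r \<in> borel_measurable borel"
    using square_integrableD(1)[OF v2] square_integrableD(1)[OF r2] by auto
  define hk where "hk \<epsilon> x = (\<integral>y. h y * gauss_kernel \<epsilon> (x - y) \<partial>lborel)" for \<epsilon> x
  have pos: "0 \<le> energy (hk \<epsilon>)" if \<epsilon>: "\<epsilon> > 0" for \<epsilon>
  proof -
    let ?K = "\<lambda>\<xi>::'a. complex_of_real (gauss \<epsilon> \<xi>)"
    \<comment> \<open>The term v^2 K is bracketed as v * (v K). Both factors are square integrable,
      which gives integrability, and v K is then an admissible \<Phi> in the multiplication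
      formula.\<close>
    let ?H = "\<lambda>\<xi>. complex_of_real L * (r \<xi> * ?K \<xi>) - v \<xi> * (v \<xi> * ?K \<xi>)"
    have K1: "integrable lborel ?K"
      using integrable_gauss[OF \<epsilon>, where 'a='a] by (simp add: complex_of_real_integrable_eq)
    have K2: "square_integrable lborel ?K" by (rule square_integrable_gauss[OF \<epsilon>])
    have vK2: "square_integrable lborel (\<lambda>\<xi>. v \<xi> * ?K \<xi>)"
      by (rule square_integrable_bounded_mult(1)[OF v2, of _ 1]) (auto simp: abs_of_pos[OF gauss_pos] gauss_le_1)
    have vK1: "integrable lborel (\<lambda>\<xi>. v \<xi> * ?K \<xi>)" by (rule square_integrable_mult(1)[OF v2 K2])
    have rK1: "integrable lborel (\<lambda>\<xi>. r \<xi> * ?K \<xi>)" by (rule square_integrable_mult(1)[OF r2 K2])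
    have vvK: "integrable lborel (\<lambda>\<xi>. v \<xi> * (v \<xi> * ?K \<xi>))" by (rule square_integrable_mult(1)[OF v2 vK2])
    have H1: "integrable lborel ?H" using rK1 vvK by simp
    have \<rho>K: "inv_fourier (\<lambda>\<xi>. r \<xi> * ?K \<xi>) x = complex_of_real (\<integral>y. \<rho> y * gauss_kernel \<epsilon> (x - y) \<partial>lborel)" for x
      using fourier_pair_integral_mult_inv_fourier[OF r K1 K2, of x]
      by (simp add: inv_fourier_gauss[OF \<epsilon>] flip: integral_complex_of_real)
    have \<psi>K: "inv_fourier (\<lambda>\<xi>. v \<xi> * ?K \<xi>) x = complex_of_real (\<integral>y. \<psi> y * gauss_kernel \<epsilon> (x - y) \<partial>lborel)" for x
      using fourier_pair_integral_mult_inv_fourier[OF v K1 K2, of x]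
      by (simp add: inv_fourier_gauss[OF \<epsilon>] flip: integral_complex_of_real)
    \<comment> \<open>The second use of the multiplication formula, with \<Phi> = v K, whose inverse
      transform is the smoothed \<psi> found just before.\<close>
    have \<psi>\<psi>K: "inv_fourier (\<lambda>\<xi>. v \<xi> * (v \<xi> * ?K \<xi>)) x
        = complex_of_real (\<integral>t. autocorrelation \<psi> t * gauss_kernel \<epsilon> (x - t) \<partial>lborel)" for x
    proof -
      have "inv_fourier (\<lambda>\<xi>. v \<xi> * (v \<xi> * ?K \<xi>)) x
          = (\<integral>y. complex_of_real (\<psi> y * (\<integral>s. \<psi> s * gauss_kernel \<epsilon> (x - y - s) \<partial>lborel)) \<partial>lborel)"
        unfolding of_real_mult \<psi>K[symmetric]
        by (rule fourier_pair_integral_mult_inv_fourier[OF v vK1 vK2, symmetric])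
      then show ?thesis
        unfolding integral_autocorrelation_mult[OF \<psi>(1) integrable_gauss_kernel[OF \<epsilon>]]
        by (simp only: integral_complex_of_real)
    qed
    show ?thesis
    proof (rule energy_nonneg[OF H1])
      show "AE \<xi> in lborel. Im (?H \<xi>) = 0 \<and> 0 \<le> Re (?H \<xi>)"
        using le
      proof eventually_elim
        case (elim \<xi>)
        have eq: "?H \<xi> = (complex_of_real L * r \<xi> - (v \<xi>)\<^sup>2) * ?K \<xi>"
          by (simp add: power2_eq_square algebra_simps)
        \<comment> \<open>The order on the complex numbers compares real parts and demands equal
          imaginary parts, so the hypothesis makes the difference both real and nonnegative.\<close>
        have "Im (complex_of_real L * r \<xi> - (v \<xi>)\<^sup>2) = 0" "0 \<le> Re (complex_of_real L * r \<xi> - (v \<xi>)\<^sup>2)"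
          using elim unfolding less_eq_complex_def by auto
        then show ?case unfolding eq
          by (simp only: Re_complex_of_real Im_complex_of_real times_complex.sel) (simp add: less_imp_le[OF gauss_pos])
      qed
      fix x
      have i1: "integrable lborel (\<lambda>y. \<rho> y * gauss_kernel \<epsilon> (x - y))"
        by (rule gauss_kernel_convolution_bound(1)[OF _ \<rho>(2) \<epsilon>]) measurable
      have i2: "integrable lborel (\<lambda>y. autocorrelation \<psi> y * gauss_kernel \<epsilon> (x - y))"
        by (rule gauss_kernel_convolution_bound(1)[OF _ autocorrelation_bound[OF \<psi>(1)] \<epsilon>]) measurable
      have "hk \<epsilon> x = L * (\<integral>y. \<rho> y * gauss_kernel \<epsilon> (x - y) \<partial>lborel)
          - (\<integral>y. autocorrelation \<psi> y * gauss_kernel \<epsilon> (x - y) \<partial>lborel)"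
        using i1 i2 by (simp add: hk_def h_def left_diff_distrib mult.assoc)
      moreover have "inv_fourier ?H x = complex_of_real L * inv_fourier (\<lambda>\<xi>. r \<xi> * ?K \<xi>) x
          - inv_fourier (\<lambda>\<xi>. v \<xi> * (v \<xi> * ?K \<xi>)) x"
        using inv_fourier_diff[of "\<lambda>\<xi>. complex_of_real L * (r \<xi> * ?K \<xi>)", OF _ vvK, of x] rK1
        by (simp add: inv_fourier_def mult.assoc)
      ultimately show "complex_of_real (hk \<epsilon> x) = inv_fourier ?H x"
        by (simp add: \<rho>K \<psi>\<psi>K)
    qed
  qed
  define \<epsilon> where "\<epsilon> k = 1 / real (Suc k)" for k
  have \<epsilon>: "\<epsilon> k > 0" "\<epsilon> \<longlonglongrightarrow> 0" for k
    unfolding \<epsilon>_def using LIMSEQ_Suc[OF lim_1_over_n] by auto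
  have "(\<lambda>k. energy (hk (\<epsilon> k))) \<longlonglongrightarrow> energy h"
  proof (rule energy_tendsto)
    show "hk (\<epsilon> k) \<in> borel_measurable borel" for k
    proof -
      have "(\<lambda>x. \<integral>y. h y * gauss_kernel (\<epsilon> k) (x - y) \<partial>lborel) \<in> borel_measurable borel" by measurable
      then show ?thesis by (simp add: hk_def[abs_def])
    qed
    show "\<bar>hk (\<epsilon> k) x\<bar> \<le> E" for k x
      unfolding hk_def by (rule gauss_kernel_convolution_bound(2)[OF _ hE \<epsilon>(1)]) measurable
    show "(\<lambda>k. hk (\<epsilon> k) x) \<longlonglongrightarrow> h x" for x
      unfolding hk_def by (rule gauss_kernel_convolution_tendsto[OF h hE \<epsilon>])
  qed measurable
  then have "0 \<le> energy h"
    by (rule LIMSEQ_le_const) (use pos \<epsilon> in auto)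
  also have "energy h = L * energy \<rho> - energy (autocorrelation \<psi>)"
    unfolding h_def by (rule energy_diff[OF _ _ \<rho>(2) autocorrelation_bound[OF \<psi>(1)]]) measurable
  finally show ?thesis by simp
qed

section \<open>Lebesgue measurable functions\<close>

lemma borel_representative_real:
  fixes f :: "'a::euclidean_space \<Rightarrow> real"
  assumes "f \<in> borel_measurable lebesgue"
  obtains f' where "f' \<in> borel_measurable borel" "AE x in lborel. f x = f' x"
  using completion_ex_borel_measurable_real[OF assms] that by auto

lemma borel_representative_complex:
  fixes f :: "'a::euclidean_space \<Rightarrow> complex"
  assumes f: "f \<in> borel_measurable lebesgue"
  obtains f' where "f' \<in> borel_measurable borel" "AE x in lborel. f x = f' x"
proof -
  have "(\<lambda>x. Re (f x)) \<in> borel_measurable lebesgue" "(\<lambda>x. Im (f x)) \<in> borel_measurable lebesgue"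
    using f by measurable
  then obtain g h where g: "g \<in> borel_measurable borel" "AE x in lborel. Re (f x) = g x"
    and h: "h \<in> borel_measurable borel" "AE x in lborel. Im (f x) = h x"
    by (elim borel_representative_real)
  show ?thesis
  proof
    show "(\<lambda>x. Complex (g x) (h x)) \<in> borel_measurable borel"
      using g(1) h(1) by (simp add: borel_measurable_complex_iff)
    show "AE x in lborel. f x = Complex (g x) (h x)"
      using g(2) h(2) by eventually_elim (simp add: complex_eq_iff)
  qed
qed

text \<open>The bridge between the definitions, which integrate against the completion
  \<open>lebesgue\<close>, and the Fubini arguments, which need Borel functions and
  \<open>lborel\<close>.\<close>

lemma
  fixes f f' :: "'a::euclidean_space \<Rightarrow> 'b::{banach,second_countable_topology}"
  assumes f: "f \<in> borel_measurable lebesgue" and f': "f' \<in> borel_measurable borel"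
    and eq: "AE x in lborel. f x = f' x"
  shows integrable_lebesgue_iff: "integrable lebesgue f \<longleftrightarrow> integrable lborel f'"
    and integral_lebesgue_eq: "(\<integral>x. f x \<partial>lebesgue) = (\<integral>x. f' x \<partial>lborel)"
proof -
  have m: "f' \<in> borel_measurable lborel" "f' \<in> borel_measurable lebesgue"
    using f' by (auto simp: measurable_completion)
  have eq': "AE x in lebesgue. f x = f' x" using eq by (rule AE_completion)
  show "integrable lebesgue f \<longleftrightarrow> integrable lborel f'"
    using integrable_cong_AE[OF f m(2) eq'] integrable_completion[OF m(1)] by simp
  show "(\<integral>x. f x \<partial>lebesgue) = (\<integral>x. f' x \<partial>lborel)"
    using integral_cong_AE[OF f m(2) eq'] integral_completion[OF m(1)] by simp
qed

lemma measurable_lebesgue: "f \<in> borel_measurable borel \<Longrightarrow> f \<in> borel_measurable lebesgue"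
  by (simp add: measurable_completion)

lemma L2_fun_iff:
  fixes u u' :: "'a::euclidean_space \<Rightarrow> 'b::{real_normed_vector,second_countable_topology}"
  assumes "u \<in> borel_measurable lebesgue" "u' \<in> borel_measurable borel" "AE x in lborel. u x = u' x"
  shows "L2_fun u \<longleftrightarrow> square_integrable lborel u'"
proof -
  have "integrable lebesgue (\<lambda>x. (norm (u x))\<^sup>2) \<longleftrightarrow> integrable lborel (\<lambda>x. (norm (u' x))\<^sup>2)"
    using assms by (intro integrable_lebesgue_iff) auto
  then show ?thesis using assms by (simp add: L2_fun_def square_integrable_def)
qed

lemma L2_dist_eq:
  fixes u u' v v' :: "'a::euclidean_space \<Rightarrow> 'b::{real_normed_vector,second_countable_topology}"
  assumes "u \<in> borel_measurable lebesgue" "u' \<in> borel_measurable borel" "AE x in lborel. u x = u' x"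
    and "v \<in> borel_measurable lebesgue" "v' \<in> borel_measurable borel" "AE x in lborel. v x = v' x"
  shows "L2_dist u v = norm2 lborel (\<lambda>x. u' x - v' x)"
proof -
  have "(\<integral>x. (norm (u x - v x))\<^sup>2 \<partial>lebesgue) = (\<integral>x. (norm (u' x - v' x))\<^sup>2 \<partial>lborel)"
    using assms by (intro integral_lebesgue_eq) auto
  then show ?thesis by (simp add: L2_dist_def norm2_def)
qed

lemma fourier_integral_eq:
  assumes U: "U \<in> borel_measurable lebesgue" "U' \<in> borel_measurable borel" "AE x in lborel. U x = U' x"
  shows "fourier_integral U \<xi> = inv_fourier U' (- \<xi>)"
proof -
  have w: "exp (- 2 * complex_of_real pi * \<i> * complex_of_real (x \<bullet> \<xi>)) = wave (- \<xi>) x" for x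
    by (simp add: wave_def cis_conv_exp inner_commute mult_ac)
  have [measurable]: "wave (- \<xi>) \<in> borel_measurable borel" by measurable
  have "wave (- \<xi>) \<in> borel_measurable lebesgue" by (intro measurable_lebesgue) measurable
  then show ?thesis unfolding fourier_integral_def inv_fourier_def w
    using U by (intro integral_lebesgue_eq) auto
qed

text \<open>Borel representatives replace v and every approximant; norms and transforms are
  integrals and do not see the change.\<close>

lemma is_fourier_L2_imp_fourier_pair:
  assumes u: "u \<in> borel_measurable borel" "square_integrable lborel u" and v: "is_fourier_L2 u v"
  obtains v' where "fourier_pair u v'" "AE \<xi> in lborel. v \<xi> = v' \<xi>"
proof -
  obtain U where U: "\<And>k::nat. integrable lebesgue (U k)" "\<And>k. L2_fun (U k)"
      "(\<lambda>k. L2_dist (U k) u) \<longlonglongrightarrow> 0" "(\<lambda>k. L2_dist (fourier_integral (U k)) v) \<longlonglongrightarrow> 0"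
    and v2: "L2_fun v"
    using v unfolding is_fourier_L2_def by blast
  have vm: "v \<in> borel_measurable lebesgue" and Um: "\<And>k. U k \<in> borel_measurable lebesgue"
    using v2 U(2) by (auto simp: L2_fun_def)
  obtain v' where v': "v' \<in> borel_measurable borel" "AE x in lborel. v x = v' x"
    using borel_representative_complex[OF vm] .
  have "\<forall>k. \<exists>f'. f' \<in> borel_measurable borel \<and> (AE x in lborel. U k x = f' x)"
    using borel_representative_complex[OF Um] by metis
  then obtain U' where U': "\<And>k. U' k \<in> borel_measurable borel" "\<And>k. AE x in lborel. U k x = U' k x"
    by metis
  have F: "fourier_integral (U k) = (\<lambda>\<xi>. inv_fourier (U' k) (- \<xi>))" for k
    using fourier_integral_eq[OF Um U', of k] by auto
  have Fm: "(\<lambda>\<xi>. inv_fourier (U' k) (- \<xi>)) \<in> borel_measurable borel" for k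
    using U'(1)[of k] by measurable
  have "fourier_pair u v'"
    unfolding fourier_pair_def
  proof (intro conjI exI allI)
    show "square_integrable lborel v'" using L2_fun_iff[OF vm v'] v2 by simp
    show "integrable lborel (U' k)" for k using integrable_lebesgue_iff[OF Um U'] U(1) by simp
    show "square_integrable lborel (U' k)" for k using L2_fun_iff[OF Um U'] U(2) by simp
    show "(\<lambda>k. norm2 lborel (\<lambda>x. U' k x - u x)) \<longlonglongrightarrow> 0"
      using U(3) L2_dist_eq[OF Um U' measurable_lebesgue[OF u(1)] u(1)] by simp
    show "(\<lambda>k. norm2 lborel (\<lambda>\<xi>. inv_fourier (U' k) (- \<xi>) - v' \<xi>)) \<longlonglongrightarrow> 0"
    proof -
      have "L2_dist (\<lambda>\<xi>. inv_fourier (U' k) (- \<xi>)) v = norm2 lborel (\<lambda>\<xi>. inv_fourier (U' k) (- \<xi>) - v' \<xi>)" for k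
        by (intro L2_dist_eq measurable_lebesgue Fm vm v') auto
      then show ?thesis using U(4) by (simp add: F)
    qed
  qed (rule u(2))
  then show ?thesis using v'(2) by (rule that)
qed

text \<open>Together with \<open>fourier_pair_exists\<close>, this direction guarantees that the
  choice in \<open>fourier\<close> has something to choose from.\<close>

lemma fourier_pair_imp_is_fourier_L2:
  assumes "fourier_pair u v"
  shows "is_fourier_L2 u v"
proof -
  obtain U where U: "\<And>k::nat. integrable lborel (U k)" "\<And>k. square_integrable lborel (U k)"
    "(\<lambda>k. norm2 lborel (\<lambda>x. U k x - u x)) \<longlonglongrightarrow> 0"
    "(\<lambda>k. norm2 lborel (\<lambda>\<xi>. inv_fourier (U k) (- \<xi>) - v \<xi>)) \<longlonglongrightarrow> 0"
    and u: "square_integrable lborel u" and v: "square_integrable lborel v"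
    using assms unfolding fourier_pair_def by blast
  have m: "u \<in> borel_measurable borel" "v \<in> borel_measurable borel" "\<And>k. U k \<in> borel_measurable borel"
    using square_integrableD(1)[OF u] square_integrableD(1)[OF v] square_integrableD(1)[OF U(2)] by auto
  note l = measurable_lebesgue
  have F: "fourier_integral (U k) = (\<lambda>\<xi>. inv_fourier (U k) (- \<xi>))" for k
    using fourier_integral_eq[OF l[OF m(3)] m(3), of k] by auto
  have Fm: "(\<lambda>\<xi>. inv_fourier (U k) (- \<xi>)) \<in> borel_measurable borel" for k
    using m(3)[of k] by measurable
  show ?thesis unfolding is_fourier_L2_def
  proof (intro conjI exI allI)
    show "L2_fun v" using L2_fun_iff[OF l[OF m(2)] m(2)] v by simp
    show "integrable lebesgue (U k)" for k
      using integrable_lebesgue_iff[OF l[OF m(3)[of k]] m(3)[of k]] U(1) by simp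
    show "L2_fun (U k)" for k using L2_fun_iff[OF l[OF m(3)[of k]] m(3)[of k]] U(2) by simp
    have "L2_dist (U k) u = norm2 lborel (\<lambda>x. U k x - u x)" for k
      by (intro L2_dist_eq l m) auto
    then show "(\<lambda>k. L2_dist (U k) u) \<longlonglongrightarrow> 0" using U(3) by simp
    have "L2_dist (\<lambda>\<xi>. inv_fourier (U k) (- \<xi>)) v = norm2 lborel (\<lambda>\<xi>. inv_fourier (U k) (- \<xi>) - v \<xi>)" for k
      by (intro L2_dist_eq l Fm m) auto
    then show "(\<lambda>k. L2_dist (fourier_integral (U k)) v) \<longlonglongrightarrow> 0" using U(4) by (simp add: F)
  qed
qed

text \<open>Brings the two branches of \<open>fourier\<close> to one form: from here on it does not
  matter whether u is integrable or which representative was chosen.\<close>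

lemma fourier_pair_fourier:
  fixes u :: "'a::euclidean_space \<Rightarrow> complex"
  assumes u: "square_integrable lborel u"
  obtains v where "fourier_pair u v" "AE \<xi> in lborel. fourier u \<xi> = v \<xi>"
proof (cases "integrable lebesgue u")
  case True
  have m: "u \<in> borel_measurable borel" using square_integrableD(1)[OF u] by simp
  have u1: "integrable lborel u" using True integrable_lebesgue_iff[OF measurable_lebesgue[OF m] m] by simp
  \<comment> \<open>An integrable u is its own approximant: the constant sequence is the
    witness.\<close>
  have "fourier_pair u (\<lambda>\<xi>. inv_fourier u (- \<xi>))"
    unfolding fourier_pair_def using u u1 norm2_fourier_le(1)[OF u1 u]
    by (auto intro!: exI[of _ "\<lambda>_. u"] simp: norm2_def)
  moreover have "AE \<xi> in lborel. fourier u \<xi> = inv_fourier u (- \<xi>)"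
    using True fourier_integral_eq[OF measurable_lebesgue[OF m] m] by (simp add: fourier_def)
  ultimately show ?thesis by (rule that)
next
  case False
  have m: "u \<in> borel_measurable borel" using square_integrableD(1)[OF u] by simp
  obtain v where "fourier_pair u v" by (rule fourier_pair_exists[OF u])
  then have "\<exists>v. is_fourier_L2 u v" using fourier_pair_imp_is_fourier_L2 by blast
  then have "is_fourier_L2 u (fourier u)"
    unfolding fourier_def using False by (simp add: someI_ex)
  from is_fourier_L2_imp_fourier_pair[OF m u this] show ?thesis using that by metis
qed

section \<open>Functions vanishing at infinity\<close>

lemma
  fixes f :: "'a::euclidean_space \<Rightarrow> real"
  assumes f: "f \<in> C0_space UNIV"
  shows C0_space_continuous: "continuous_on UNIV f"
    and C0_space_bounded: "\<exists>C. \<forall>x. \<bar>f x\<bar> \<le> C"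
    and C0_space_vanishing: "e > 0 \<Longrightarrow> \<exists>R. \<forall>x. norm x > R \<longrightarrow> \<bar>f x\<bar> \<le> e"
proof -
  have ap: "\<exists>g K. continuous_on UNIV g \<and> compact K \<and> (\<forall>x. x \<notin> K \<longrightarrow> g x = 0) \<and> (\<forall>x. \<bar>f x - g x\<bar> \<le> e)"
    if "e > 0" for e
    using f that unfolding C0_space_def Cc_space_def by (force simp: Ball_def)
  have "\<forall>n::nat. \<exists>g. continuous_on UNIV g \<and> (\<forall>x. \<bar>f x - g x\<bar> \<le> 1 / real (Suc n))"
    using ap[of "1 / real (Suc n)" for n] by fastforce
  then obtain g where g: "\<And>n::nat. continuous_on UNIV (g n)" "\<And>n x. \<bar>f x - g n x\<bar> \<le> 1 / real (Suc n)"
    by metis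
  show "continuous_on UNIV f"
  proof (rule uniform_limit_theorem)
    show "\<forall>\<^sub>F n in sequentially. continuous_on UNIV (g n)" using g by simp
    show "uniform_limit UNIV g f sequentially"
    proof (rule uniform_limitI)
      fix e :: real assume "e > 0"
      then have "\<forall>\<^sub>F n in sequentially. 1 / real (Suc n) < e"
        using order_tendstoD(2)[OF LIMSEQ_Suc[OF lim_1_over_n]] by simp
      then show "\<forall>\<^sub>F n in sequentially. \<forall>x\<in>UNIV. dist (g n x) (f x) < e"
      proof eventually_elim
        case (elim n)
        then show ?case using g(2) by (auto simp: dist_real_def abs_minus_commute intro: le_less_trans)
      qed
    qed
  qed simp
  obtain g K where gK: "continuous_on UNIV g" "compact K" "\<And>x. x \<notin> K \<Longrightarrow> g x = 0" "\<And>x. \<bar>f x - g x\<bar> \<le> 1"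
    using ap[of 1] by auto
  have "bounded (g ` K)"
    using compact_imp_bounded compact_continuous_image continuous_on_subset gK by (metis top_greatest)
  then obtain B where B: "\<And>x. x \<in> K \<Longrightarrow> \<bar>g x\<bar> \<le> B" by (auto simp: bounded_iff)
  have "\<bar>f x\<bar> \<le> max B 0 + 1" for x
    using gK(3)[of x] gK(4)[of x] B[of x] by (cases "x \<in> K") auto
  then show "\<exists>C. \<forall>x. \<bar>f x\<bar> \<le> C" by blast
  show "\<exists>R. \<forall>x. norm x > R \<longrightarrow> \<bar>f x\<bar> \<le> e" if e: "e > 0"
  proof -
    obtain g K where gK: "compact K" "\<And>x. x \<notin> K \<Longrightarrow> g x = 0" "\<And>x. \<bar>f x - g x\<bar> \<le> e"
      using ap[OF e] by auto
    obtain R where "\<And>x. x \<in> K \<Longrightarrow> norm x \<le> R"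
      using compact_imp_bounded[OF gK(1)] by (auto simp: bounded_iff)
    then have "\<bar>f x\<bar> \<le> e" if "norm x > R" for x
      using gK(2)[of x] gK(3)[of x] that by force
    then show ?thesis by blast
  qed
qed

lemma C0_spaceI:
  fixes f :: "'a::euclidean_space \<Rightarrow> real"
  assumes f: "continuous_on UNIV f" and van: "\<And>e. e > 0 \<Longrightarrow> \<exists>R. \<forall>x. norm x > R \<longrightarrow> \<bar>f x\<bar> \<le> e"
    and \<Omega>: "closed \<Omega>"
  shows "f \<in> C0_space \<Omega>"
  unfolding C0_space_def
proof (intro CollectI allI impI)
  fix e :: real assume "e > 0"
  then obtain R where R: "\<And>x. norm x > R \<Longrightarrow> \<bar>f x\<bar> \<le> e" using van by blast
  \<comment> \<open>A cutoff equal to 1 up to radius R and to 0 beyond R + 1. Closedness of \<Omega>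
    makes its intersection with the larger ball a compact subset of \<Omega>.\<close>
  define c where "c x = max 0 (min 1 (R + 1 - norm x))" for x :: 'a
  have "continuous_on UNIV c" unfolding c_def by (intro continuous_intros)
  then have "continuous_on \<Omega> (\<lambda>x. f x * c x)"
    using continuous_on_mult[OF f] continuous_on_subset by blast
  moreover have "compact (\<Omega> \<inter> cball 0 (R + 1))" using \<Omega> by (intro closed_Int_compact) auto
  moreover have "\<forall>x\<in>\<Omega> - \<Omega> \<inter> cball 0 (R + 1). f x * c x = 0" by (auto simp: c_def)
  ultimately have "(\<lambda>x. f x * c x) \<in> Cc_space \<Omega>" unfolding Cc_space_def by blast
  moreover have "\<bar>f x - f x * c x\<bar> \<le> e" for x
  proof (cases "norm x > R")
    case True
    have "\<bar>f x - f x * c x\<bar> = \<bar>f x\<bar> * \<bar>1 - c x\<bar>" by (simp add: right_diff_distrib flip: abs_mult)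
    also have "\<dots> \<le> e * 1" using R[OF True] \<open>e > 0\<close> by (intro mult_mono) (auto simp: c_def)
    finally show ?thesis by simp
  qed (use \<open>e > 0\<close> in \<open>simp add: c_def\<close>)
  ultimately show "\<exists>g\<in>Cc_space \<Omega>. \<forall>x\<in>\<Omega>. \<bar>f x - g x\<bar> \<le> e"
    by (intro bexI[of _ "\<lambda>x. f x * c x"]) auto
qed

section \<open>Convolutions with integrable weights\<close>

lemma convolution_bound:
  fixes \<theta> \<psi> :: "'a::euclidean_space \<Rightarrow> real"
  assumes \<theta>: "integrable lborel \<theta>" and [measurable]: "\<psi> \<in> borel_measurable borel" and C: "\<And>x. \<bar>\<psi> x\<bar> \<le> C"
  shows "\<bar>\<integral>w. \<theta> w * \<psi> (x - w) \<partial>lborel\<bar> \<le> C * (\<integral>w. \<bar>\<theta> w\<bar> \<partial>lborel)"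
proof -
  have [measurable]: "\<theta> \<in> borel_measurable borel" using borel_measurable_integrable[OF \<theta>] by simp
  have C\<theta>: "integrable lborel (\<lambda>w. C * \<bar>\<theta> w\<bar>)" using \<theta> by simp
  have le: "norm (\<theta> w * \<psi> (x - w)) \<le> C * \<bar>\<theta> w\<bar>" for w
    using C by (simp add: abs_mult mult.commute[of C] mult_left_mono)
  have "integrable lborel (\<lambda>w. \<theta> w * \<psi> (x - w))"
    by (rule Bochner_Integration.integrable_bound[OF C\<theta>]) (use order_trans[OF le abs_ge_self] in auto)
  from Bochner_Integration.integral_norm_bound_integral[OF this C\<theta> le] show ?thesis by simp
qed

text \<open>Otherwise points x n with norm above n keep the integral above e in modulus. For fixed
  w, however, x n - w also tends to infinity, so the integrand tends to 0 and dominated convergence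
  gives a contradiction.\<close>

lemma convolution_vanishing:
  fixes \<theta> \<psi> :: "'a::euclidean_space \<Rightarrow> real"
  assumes \<theta>: "integrable lborel \<theta>" and [measurable]: "\<psi> \<in> borel_measurable borel" and C: "\<And>x. \<bar>\<psi> x\<bar> \<le> C"
    and van: "\<And>e. e > 0 \<Longrightarrow> \<exists>R. \<forall>x. norm x > R \<longrightarrow> \<bar>\<psi> x\<bar> \<le> e" and e: "e > 0"
  shows "\<exists>R. \<forall>x. norm x > R \<longrightarrow> \<bar>\<integral>w. \<theta> w * \<psi> (x - w) \<partial>lborel\<bar> \<le> e"
proof (rule ccontr)
  assume "\<not> ?thesis"
  then have "\<forall>n::nat. \<exists>x. norm x > real n \<and> \<bar>\<integral>w. \<theta> w * \<psi> (x - w) \<partial>lborel\<bar> > e"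
    by (meson not_le)
  then obtain x where x: "\<And>n::nat. norm (x n) > real n" "\<And>n. \<bar>\<integral>w. \<theta> w * \<psi> (x n - w) \<partial>lborel\<bar> > e"
    by metis
  have [measurable]: "\<theta> \<in> borel_measurable borel" using borel_measurable_integrable[OF \<theta>] by simp
  have "(\<lambda>n. \<integral>w. \<theta> w * \<psi> (x n - w) \<partial>lborel) \<longlonglongrightarrow> (\<integral>w. \<theta> w * 0 \<partial>lborel)"
  proof (rule integral_dominated_convergence[where w = "\<lambda>w. C * \<bar>\<theta> w\<bar>"])
    show "integrable lborel (\<lambda>w. C * \<bar>\<theta> w\<bar>)" using \<theta> by simp
    show "AE w in lborel. norm (\<theta> w * \<psi> (x n - w)) \<le> C * \<bar>\<theta> w\<bar>" for n
      using C by (intro AE_I2) (simp add: abs_mult mult.commute[of C] mult_left_mono)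
    show "AE w in lborel. (\<lambda>n. \<theta> w * \<psi> (x n - w)) \<longlonglongrightarrow> \<theta> w * 0"
    proof (rule AE_I2)
      fix w
      have "(\<lambda>n. \<psi> (x n - w)) \<longlonglongrightarrow> 0"
      proof (rule LIMSEQ_I)
        fix r :: real assume r: "r > 0"
        then obtain R where R: "\<And>x. norm x > R \<Longrightarrow> \<bar>\<psi> x\<bar> \<le> r / 2" using van[of "r / 2"] by auto
        show "\<exists>no. \<forall>n\<ge>no. norm (\<psi> (x n - w) - 0) < r"
        proof (intro exI allI impI)
          fix n assume n: "n \<ge> nat \<lceil>R + norm w\<rceil>"
          have "R + norm w \<le> real n" using n by linarith
          then have "norm (x n - w) > R" using x(1)[of n] norm_triangle_ineq2[of "x n" w] by linarith
          then show "norm (\<psi> (x n - w) - 0) < r" using R[of "x n - w"] r by simp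
        qed
      qed
      then show "(\<lambda>n. \<theta> w * \<psi> (x n - w)) \<longlonglongrightarrow> \<theta> w * 0" by (intro tendsto_mult tendsto_const)
    qed
  qed measurable
  then have "(\<lambda>n. \<integral>w. \<theta> w * \<psi> (x n - w) \<partial>lborel) \<longlonglongrightarrow> 0" by simp
  then obtain N where "\<bar>\<integral>w. \<theta> w * \<psi> (x N - w) \<partial>lborel\<bar> < e"
    using LIMSEQ_D[OF _ e] by fastforce
  then show False using x(2)[of N] by linarith
qed

text \<open>Moves the shift from \<theta>, which matters only up to null sets, to \<psi>, whose
  continuity and decay the later arguments exploit.\<close>

lemma convol_eq:
  fixes \<theta> \<psi> :: "'a::euclidean_space \<Rightarrow> real"
  assumes \<theta>: "\<theta> \<in> borel_measurable lebesgue" "\<theta>' \<in> borel_measurable borel" "AE x in lborel. \<theta> x = \<theta>' x"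
    and \<psi> [measurable]: "\<psi> \<in> borel_measurable borel"
  shows "convol \<theta> \<psi> x = (\<integral>w. \<theta>' w * \<psi> (x - w) \<partial>lborel)"
proof -
  have [measurable]: "\<theta>' \<in> borel_measurable borel" by fact
  have eq: "AE y in lborel. \<theta> (x - y) = \<theta>' (x - y)" using \<theta>(3) by (rule AE_reflect)
  \<comment> \<open>Composition with a reflection does not give Lebesgue measurability of \<theta>
    (x - y) outright; it follows from almost everywhere equality with a Borel function and
    completeness of \<open>lebesgue\<close>.\<close>
  have "(\<lambda>y. \<theta>' (x - y)) \<in> borel_measurable lebesgue" by (intro measurable_lebesgue) measurable
  then have "(\<lambda>y. \<theta> (x - y)) \<in> borel_measurable lebesgue"
    by (rule borel_measurable_AE) (use AE_completion[OF eq] in \<open>eventually_elim; simp\<close>)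
  then have "convol \<theta> \<psi> x = (\<integral>y. \<theta>' (x - y) * \<psi> y \<partial>lborel)"
    unfolding convol_def using measurable_lebesgue[OF \<psi>] eq by (intro integral_lebesgue_eq) auto
  also have "\<dots> = (\<integral>w. \<theta>' (x - (x - w)) * \<psi> (x - w) \<partial>lborel)"
    by (rule integral_reflect[symmetric]) measurable
  finally show ?thesis by simp
qed

section \<open>Main inequality\<close>

text \<open>Cauchy-Schwarz for the splitting of \<theta> g into sqrt \<theta> and sqrt \<theta>
  g.\<close>

lemma integral_weighted_power2_le:
  fixes \<theta> g :: "'a \<Rightarrow> real"
  assumes \<theta>: "integrable M \<theta>" "\<And>x. 0 \<le> \<theta> x" and [measurable]: "g \<in> borel_measurable M"
    and C: "\<And>x. \<bar>g x\<bar> \<le> C"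
  shows "integrable M (\<lambda>x. \<theta> x * (g x)\<^sup>2)"
    and "(\<integral>x. \<theta> x * g x \<partial>M)\<^sup>2 \<le> (\<integral>x. \<theta> x \<partial>M) * (\<integral>x. \<theta> x * (g x)\<^sup>2 \<partial>M)"
proof -
  have [measurable]: "\<theta> \<in> borel_measurable M" using \<theta>(1) by simp
  let ?f = "\<lambda>x. sqrt (\<theta> x)"
  have f: "square_integrable M ?f" using \<theta> by (simp add: square_integrable_def)
  have h: "square_integrable M (\<lambda>x. ?f x * g x)"
    by (rule square_integrable_bounded_mult(1)[OF f, of _ C]) (use C in auto)
  have eq: "(norm (?f x * g x))\<^sup>2 = \<theta> x * (g x)\<^sup>2" for x using \<theta>(2) by (simp add: power_mult_distrib)
  show "integrable M (\<lambda>x. \<theta> x * (g x)\<^sup>2)" using square_integrableD(2)[OF h] unfolding eq .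
  have "(\<integral>x. \<theta> x * g x \<partial>M) = (\<integral>x. ?f x * (?f x * g x) \<partial>M)"
    using \<theta>(2) by (simp flip: mult.assoc)
  then have "\<bar>\<integral>x. \<theta> x * g x \<partial>M\<bar> \<le> norm2 M ?f * norm2 M (\<lambda>x. ?f x * g x)"
    using square_integrable_mult(2)[OF f h] by simp
  then have "(\<integral>x. \<theta> x * g x \<partial>M)\<^sup>2 \<le> (norm2 M ?f * norm2 M (\<lambda>x. ?f x * g x))\<^sup>2"
    using power_mono[OF _ abs_ge_zero, of _ _ 2] by (metis power2_abs)
  also have "\<dots> = (\<integral>x. \<theta> x \<partial>M) * (\<integral>x. \<theta> x * (g x)\<^sup>2 \<partial>M)"
    unfolding power_mult_distrib norm2_power2 eq using \<theta>(2) by simp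
  finally show "(\<integral>x. \<theta> x * g x \<partial>M)\<^sup>2 \<le> (\<integral>x. \<theta> x \<partial>M) * (\<integral>x. \<theta> x * (g x)\<^sup>2 \<partial>M)" .
qed

text \<open>The bound \<open>L\<close> is required only almost everywhere because the weights
  inserted here are Borel representatives of the given ones.\<close>

lemma (in polar_measure) sum_power2_convolution_le:
  fixes \<psi> :: "'a \<Rightarrow> real" and \<theta> :: "'z \<Rightarrow> 'a \<Rightarrow> real"
  assumes \<psi>: "square_integrable lborel \<psi>" and sym: "\<And>x. \<psi> (- x) = \<psi> x" and C: "\<And>x. \<bar>\<psi> x\<bar> \<le> C"
    and G: "finite G" and \<theta>: "\<And>z. z \<in> G \<Longrightarrow> integrable lborel (\<theta> z)" "\<And>z x. z \<in> G \<Longrightarrow> 0 \<le> \<theta> z x"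
    and L: "AE w in lborel. (\<Sum>z\<in>G. \<theta> z w * integral\<^sup>L lborel (\<theta> z)) \<le> L"
  shows "(\<Sum>z\<in>G. (\<integral>x. (\<integral>w. \<theta> z w * \<psi> (x - w) \<partial>lborel) * \<sigma> x \<partial>M)\<^sup>2) \<le> L * energy (autocorrelation \<psi>)"
proof -
  have [measurable]: "\<psi> \<in> borel_measurable borel" using square_integrableD(1)[OF \<psi>] by simp
  interpret pair_sigma_finite M "lborel :: 'a measure" by standard
  define g where "g w = (\<integral>x. \<psi> (x - w) * \<sigma> x \<partial>M)" for w
  have g2: "integrable lborel (\<lambda>w. (g w)\<^sup>2)" "(\<integral>w. (g w)\<^sup>2 \<partial>lborel) = energy (autocorrelation \<psi>)"
    unfolding g_def using energy_autocorrelation[OF \<psi> sym C] by auto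
  have gb: "\<bar>g w\<bar> \<le> C * measure M (space M)" for w
    unfolding g_def by (rule integral_mult_sign_bound) (use C in auto)
  have gm: "g \<in> borel_measurable lborel"
  proof -
    have "(\<lambda>w. \<integral>x. \<psi> (x - w) * \<sigma> x \<partial>M) \<in> borel_measurable lborel" by measurable
    then show ?thesis by (simp add: g_def[abs_def])
  qed
  have a: "(\<integral>x. (\<integral>w. \<theta> z w * \<psi> (x - w) \<partial>lborel) * \<sigma> x \<partial>M) = (\<integral>w. \<theta> z w * g w \<partial>lborel)" if "z \<in> G" for z
  proof -
    have "(\<integral>x. (\<integral>w. \<theta> z w * \<psi> (x - w) \<partial>lborel) * \<sigma> x \<partial>M) = (\<integral>x. \<sigma> x * (\<integral>w. \<theta> z w * \<psi> (x - w) \<partial>lborel) \<partial>M)"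
      by (simp add: mult.commute)
    also have "\<dots> = (\<integral>w. \<theta> z w * (\<integral>x. \<sigma> x * \<psi> (x - w) \<partial>M) \<partial>lborel)"
      by (rule Fubini_mult_bounded[OF integrable_sign \<theta>(1)[OF that], of _ C]) (use C in auto)
    finally show ?thesis by (simp add: g_def mult.commute)
  qed
  have \<theta>g: "integrable lborel (\<lambda>w. \<theta> z w * (g w)\<^sup>2)"
      "(\<integral>w. \<theta> z w * g w \<partial>lborel)\<^sup>2 \<le> integral\<^sup>L lborel (\<theta> z) * (\<integral>w. \<theta> z w * (g w)\<^sup>2 \<partial>lborel)"
    if "z \<in> G" for z
    using integral_weighted_power2_le[OF \<theta>(1)[OF that] \<theta>(2)[OF that] gm gb] by auto
  have "(\<Sum>z\<in>G. (\<integral>x. (\<integral>w. \<theta> z w * \<psi> (x - w) \<partial>lborel) * \<sigma> x \<partial>M)\<^sup>2)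
      \<le> (\<Sum>z\<in>G. integral\<^sup>L lborel (\<theta> z) * (\<integral>w. \<theta> z w * (g w)\<^sup>2 \<partial>lborel))"
    using \<theta>g(2) by (intro sum_mono) (simp add: a)
  also have "\<dots> = (\<integral>w. (\<Sum>z\<in>G. integral\<^sup>L lborel (\<theta> z) * (\<theta> z w * (g w)\<^sup>2)) \<partial>lborel)"
    using \<theta>g(1) by (subst Bochner_Integration.integral_sum) auto
  also have "\<dots> \<le> (\<integral>w. L * (g w)\<^sup>2 \<partial>lborel)"
  proof (rule integral_mono_AE)
    show "integrable lborel (\<lambda>w. \<Sum>z\<in>G. integral\<^sup>L lborel (\<theta> z) * (\<theta> z w * (g w)\<^sup>2))"
      using \<theta>g(1) by auto
    show "integrable lborel (\<lambda>w. L * (g w)\<^sup>2)" using g2 by simp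
    show "AE w in lborel. (\<Sum>z\<in>G. integral\<^sup>L lborel (\<theta> z) * (\<theta> z w * (g w)\<^sup>2)) \<le> L * (g w)\<^sup>2"
      using L
    proof eventually_elim
      case (elim w)
      have "(\<Sum>z\<in>G. integral\<^sup>L lborel (\<theta> z) * (\<theta> z w * (g w)\<^sup>2))
          = (\<Sum>z\<in>G. \<theta> z w * integral\<^sup>L lborel (\<theta> z)) * (g w)\<^sup>2"
        unfolding sum_distrib_right by (simp only: mult_ac)
      then show ?case using mult_right_mono[OF elim, of "(g w)\<^sup>2"] by simp
    qed
  qed
  also have "\<dots> = L * energy (autocorrelation \<psi>)" by (simp add: g2)
  finally show ?thesis .
qed

lemma radon_measures_signed_borel_measure:
  "\<mu> \<in> radon_measures \<Omega> \<Longrightarrow> closed \<Omega> \<Longrightarrow> signed_borel_measure \<Omega> \<mu>"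
  unfolding radon_measures_def by unfold_locales auto

lemma (in signed_borel_measure) polar_measureE:
  obtains M \<sigma> where "polar_measure M \<sigma>"
    "\<And>\<phi> K. \<phi> \<in> borel_measurable borel \<Longrightarrow> (\<And>x. \<bar>\<phi> x\<bar> \<le> K) \<Longrightarrow>
       dual_product \<Omega> \<phi> \<mu> = (\<integral>x. \<phi> x * \<sigma> x \<partial>M)"
proof -
  obtain M \<sigma> where M: "finite_measure M" "sets M = sets (restrict_space borel \<Omega>)"
    "\<sigma> \<in> borel_measurable M" "\<And>x. \<bar>\<sigma> x\<bar> \<le> 1"
    "\<And>\<phi> K. \<phi> \<in> borel_measurable borel \<Longrightarrow> (\<And>x. \<bar>\<phi> x\<bar> \<le> K) \<Longrightarrow>
       dual_product \<Omega> \<phi> \<mu> = (\<integral>x. \<phi> x * \<sigma> x \<partial>M)"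
    using polar_decomposition by metis
  have "(\<lambda>x. x) \<in> M \<rightarrow>\<^sub>M borel"
    using measurable_restrict_space1[OF measurable_ident_sets[OF refl], of borel \<Omega>]
      measurable_cong_sets[OF M(2) refl] by blast
  then have "polar_measure M \<sigma>"
    using M by (simp add: polar_measure_def polar_measure_axioms_def)
  then show ?thesis using M(5) by (rule that)
qed

lemma (in polar_measure) dual_product_convol_measure:
  assumes dual: "\<And>\<phi> K. \<phi> \<in> borel_measurable borel \<Longrightarrow> (\<And>x. \<bar>\<phi> x\<bar> \<le> K) \<Longrightarrow>
      dual_product \<Omega> \<phi> \<mu> = (\<integral>x. \<phi> x * \<sigma> x \<partial>M)"
    and \<rho> [measurable]: "\<rho> \<in> borel_measurable borel" and C: "\<And>x. \<bar>\<rho> x\<bar> \<le> C"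
  shows "dual_product \<Omega> (convol_measure \<Omega> \<rho> \<mu>) \<mu> = energy \<rho>"
proof -
  have "convol_measure \<Omega> \<rho> \<mu> = potential \<rho>"
  proof
    fix x
    have "(\<lambda>y. \<rho> (x - y)) \<in> borel_measurable borel" by measurable
    from dual[OF this C] show "convol_measure \<Omega> \<rho> \<mu> x = potential \<rho> x"
      by (simp add: convol_measure_def potential_def)
  qed
  then show ?thesis
    using dual[OF measurable_potential[OF \<rho>] potential_bound[OF \<rho> C]] by (simp add: energy_def)
qed

theorem theorem3p3:
  fixes \<psi> \<rho> :: "real ^ 'n \<Rightarrow> real"
    and \<theta> :: "real ^ 'n \<Rightarrow> real ^ 'n \<Rightarrow> real"
    and G \<Omega> :: "(real ^ 'n) set"
    and L0 L1 :: real
  assumes "\<psi> \<in> C0_space UNIV" and "L2_fun \<psi>"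
    and "\<rho> \<in> C0_space UNIV" and "L2_fun \<rho>"
    and "\<And>x. \<psi> (- x) = \<psi> x"
    and "L1 \<ge> 0"
    and "AE \<xi> in lebesgue. (fourier (\<lambda>x. complex_of_real (\<psi> x)) \<xi>)\<^sup>2
           \<le> complex_of_real L1 * fourier (\<lambda>x. complex_of_real (\<rho> x)) \<xi>"
    and "finite G"
    and "\<And>z x. z \<in> G \<Longrightarrow> 0 \<le> \<theta> z x"
    and "\<And>z. z \<in> G \<Longrightarrow> L2_fun (\<theta> z)"
    and "\<And>z. z \<in> G \<Longrightarrow> integrable lebesgue (\<theta> z)"
    and "L0 \<ge> 0"
    and "(SUP x. ereal (\<Sum>z\<in>G. \<theta> z x * (\<integral>w. \<theta> z w \<partial>lebesgue))) \<le> ereal L0"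
    and "closed \<Omega>"
  shows "is_preadjoint \<Omega> G (forward_op_pre G \<theta> \<psi>) (forward_op \<Omega> \<theta> \<psi>) \<and>
    (\<forall>\<mu> \<in> radon_measures \<Omega>.
       dual_product \<Omega> (forward_op_pre G \<theta> \<psi> (forward_op \<Omega> \<theta> \<psi> \<mu>)) \<mu>
         \<le> L0 * L1 * dual_product \<Omega> (convol_measure \<Omega> \<rho> \<mu>) \<mu>)"
proof -
  note \<psi>0 = assms(1) and \<rho>0 = assms(3) and G = assms(8) and \<Omega> = assms(14)
  note \<psi>c = C0_space_continuous[OF \<psi>0] and \<rho>c = C0_space_continuous[OF \<rho>0]
  have \<psi>m [measurable]: "\<psi> \<in> borel_measurable borel" and \<rho>m [measurable]: "\<rho> \<in> borel_measurable borel"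
    using \<psi>c \<rho>c by (auto intro: borel_measurable_continuous_onI)
  obtain C D where C: "\<And>x. \<bar>\<psi> x\<bar> \<le> C" and D: "\<And>x. \<bar>\<rho> x\<bar> \<le> D"
    using C0_space_bounded[OF \<psi>0] C0_space_bounded[OF \<rho>0] by metis
  have C0: "0 \<le> C" using C[of 0] by linarith
  have \<psi>2: "square_integrable lborel \<psi>" and \<rho>2: "square_integrable lborel \<rho>"
    using assms(2,4) L2_fun_iff[OF measurable_lebesgue[OF \<psi>m] \<psi>m] L2_fun_iff[OF measurable_lebesgue[OF \<rho>m] \<rho>m]
    by auto
  have "square_integrable lborel (\<lambda>x. complex_of_real (\<psi> x))" "square_integrable lborel (\<lambda>x. complex_of_real (\<rho> x))"
    using \<psi>2 \<rho>2 by (auto simp: square_integrable_def)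
  then obtain v r where v: "fourier_pair (\<lambda>x. complex_of_real (\<psi> x)) v"
      "AE \<xi> in lborel. fourier (\<lambda>x. complex_of_real (\<psi> x)) \<xi> = v \<xi>"
    and r: "fourier_pair (\<lambda>x. complex_of_real (\<rho> x)) r"
      "AE \<xi> in lborel. fourier (\<lambda>x. complex_of_real (\<rho> x)) \<xi> = r \<xi>"
    by (elim fourier_pair_fourier)
  have vr: "AE \<xi> in lborel. (v \<xi>)\<^sup>2 \<le> complex_of_real L1 * r \<xi>"
    using assms(7)[unfolded AE_completion_iff] v(2) r(2) by eventually_elim simp

  have \<theta>m: "\<theta> z \<in> borel_measurable lebesgue" if "z \<in> G" for z using assms(11)[OF that] by auto
  have "\<exists>\<theta>'. \<theta>' \<in> borel_measurable borel \<and> (AE x in lborel. \<theta> z x = \<theta>' x) \<and> (\<forall>x. 0 \<le> \<theta>' x)" if z: "z \<in> G" for z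
  proof -
    obtain \<theta>' where [measurable]: "\<theta>' \<in> borel_measurable borel" and eq: "AE x in lborel. \<theta> z x = \<theta>' x"
      using borel_representative_real[OF \<theta>m[OF z]] .
    \<comment> \<open>A representative inherits nonnegativity only almost everywhere; cutting at 0
      restores it at every point, as the square roots of the weights demand.\<close>
    have "(\<lambda>x. max 0 (\<theta>' x)) \<in> borel_measurable borel" by measurable
    moreover have "AE x in lborel. \<theta> z x = max 0 (\<theta>' x)"
      using eq by eventually_elim (metis assms(9)[OF z] max_absorb2)
    ultimately show ?thesis by (intro exI[of _ "\<lambda>x. max 0 (\<theta>' x)"]) auto
  qed
  then obtain \<theta>' where \<theta>': "\<And>z. z \<in> G \<Longrightarrow> \<theta>' z \<in> borel_measurable borel"
      "\<And>z. z \<in> G \<Longrightarrow> AE x in lborel. \<theta> z x = \<theta>' z x" "\<And>z x. z \<in> G \<Longrightarrow> 0 \<le> \<theta>' z x"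
    by metis
  have \<theta>int: "integrable lborel (\<theta>' z)" "(\<integral>w. \<theta> z w \<partial>lebesgue) = integral\<^sup>L lborel (\<theta>' z)" if "z \<in> G" for z
    using integrable_lebesgue_iff[OF \<theta>m[OF that] \<theta>'(1,2)[OF that]] integral_lebesgue_eq[OF \<theta>m[OF that] \<theta>'(1,2)[OF that]]
      assms(11)[OF that] by auto
  \<comment> \<open>The hypothesis bounds the sum at every point for \<theta>; for the
    representatives this remains true outside the union of finitely many null sets.\<close>
  have L0: "AE w in lborel. (\<Sum>z\<in>G. \<theta>' z w * integral\<^sup>L lborel (\<theta>' z)) \<le> L0"
  proof -
    have le: "(\<Sum>z\<in>G. \<theta> z x * (\<integral>w. \<theta> z w \<partial>lebesgue)) \<le> L0" for x
      using assms(13) by (simp add: SUP_le_iff)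
    have "AE w in lborel. \<forall>z\<in>G. \<theta> z w = \<theta>' z w" using \<theta>'(2) G by (simp add: AE_finite_all)
    then show ?thesis
    proof eventually_elim
      case (elim w)
      have "(\<Sum>z\<in>G. \<theta>' z w * integral\<^sup>L lborel (\<theta>' z)) = (\<Sum>z\<in>G. \<theta> z w * (\<integral>w. \<theta> z w \<partial>lebesgue))"
        using elim by (intro sum.cong) (auto simp: \<theta>int)
      then show ?case using le[of w] by simp
    qed
  qed
  have conv: "convol (\<theta> z) \<psi> x = (\<integral>w. \<theta>' z w * \<psi> (x - w) \<partial>lborel)" if "z \<in> G" for z x
    by (rule convol_eq[OF \<theta>m[OF that] \<theta>'(1,2)[OF that] \<psi>m])
  define K where "K z = C * (\<integral>w. \<bar>\<theta>' z w\<bar> \<partial>lborel)" for z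
  have K: "\<bar>convol (\<theta> z) \<psi> x\<bar> \<le> K z" if "z \<in> G" for z x
    unfolding conv[OF that] K_def by (rule convolution_bound[OF \<theta>int(1)[OF that] \<psi>m C])
  have K0: "0 \<le> K z" for z using C0 by (simp add: K_def)
  have convm: "convol (\<theta> z) \<psi> \<in> borel_measurable borel" if "z \<in> G" for z
    using continuous_convolution[OF \<theta>int(1)[OF that] \<psi>c C] conv[OF that]
    by (intro borel_measurable_continuous_onI) (simp add: fun_eq_iff cong: continuous_on_cong)

  let ?A = "forward_op \<Omega> \<theta> \<psi>" and ?T = "forward_op_pre G \<theta> \<psi>"
  \<comment> \<open>The sum of convolutions is one convolution with a combined integrable weight, so
    continuity and decay need to be proved only for a single convolution.\<close>
  have T: "?T y x = (\<integral>w. (\<Sum>z\<in>G. y z * \<theta>' z w) * \<psi> (x - w) \<partial>lborel)" for y x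
  proof -
    have i: "integrable lborel (\<lambda>w. \<theta>' z w * \<psi> (x - w))" if "z \<in> G" for z
    proof (rule Bochner_Integration.integrable_bound)
      show "integrable lborel (\<lambda>w. C * \<theta>' z w)" using \<theta>int(1)[OF that] by simp
      show "(\<lambda>w. \<theta>' z w * \<psi> (x - w)) \<in> borel_measurable lborel"
        using \<theta>'(1)[OF that] by (intro borel_measurable_times) simp_all
      show "AE w in lborel. norm (\<theta>' z w * \<psi> (x - w)) \<le> norm (C * \<theta>' z w)"
        using C C0 by (intro AE_I2) (simp add: abs_mult mult.commute[of C] mult_left_mono)
    qed
    have "?T y x = (\<Sum>z\<in>G. \<integral>w. y z * (\<theta>' z w * \<psi> (x - w)) \<partial>lborel)"
      by (simp add: forward_op_pre_def conv)
    also have "\<dots> = (\<integral>w. (\<Sum>z\<in>G. y z * (\<theta>' z w * \<psi> (x - w))) \<partial>lborel)"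
      using i by (intro Bochner_Integration.integral_sum[symmetric]) auto
    finally show ?thesis by (simp add: sum_distrib_right mult.assoc)
  qed
  have \<theta>y: "integrable lborel (\<lambda>w. \<Sum>z\<in>G. y z * \<theta>' z w)" for y
    using \<theta>int(1) by (intro Bochner_Integration.integrable_sum) auto
  have TC0: "?T y \<in> C0_space \<Omega>" for y
    unfolding T[abs_def]
    by (rule C0_spaceI[OF continuous_convolution[OF \<theta>y \<psi>c C]
          convolution_vanishing[OF \<theta>y \<psi>m C C0_space_vanishing[OF \<psi>0]] \<Omega>])
  have Tm: "?T y \<in> borel_measurable borel" for y
    unfolding T[abs_def] by (rule borel_measurable_continuous_onI[OF continuous_convolution[OF \<theta>y \<psi>c C]])
  have Tb: "\<bar>?T y x\<bar> \<le> (\<Sum>z\<in>G. \<bar>y z\<bar> * K z)" for y x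
    unfolding forward_op_pre_def
    by (rule order_trans[OF sum_abs sum_mono]) (use K in \<open>simp add: abs_mult mult_left_mono\<close>)

  have lin: "bounded_op_measures \<Omega> G ?A"
    unfolding bounded_op_measures_def
  proof (intro conjI ballI allI)
    fix \<mu> \<nu> a b z assume \<mu>: "\<mu> \<in> radon_measures \<Omega>" and \<nu>: "\<nu> \<in> radon_measures \<Omega>" and z: "z \<in> G"
    show "?A (\<lambda>B. a * \<mu> B + b * \<nu> B) z = a * ?A \<mu> z + b * ?A \<nu> z"
      unfolding forward_op_def
      by (rule dual_product_lincomb[OF radon_measures_signed_borel_measure[OF \<mu> \<Omega>]
            radon_measures_signed_borel_measure[OF \<nu> \<Omega>] convm[OF z] K[OF z]])
  next
    show "\<exists>C. \<forall>\<mu>\<in>radon_measures \<Omega>. L2_set (?A \<mu>) G \<le> C * radon_norm \<Omega> \<mu>"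
    proof (intro exI ballI)
      fix \<mu> assume \<mu>: "\<mu> \<in> radon_measures \<Omega>"
      interpret signed_borel_measure \<Omega> \<mu> by (rule radon_measures_signed_borel_measure[OF \<mu> \<Omega>])
      have "L2_set (?A \<mu>) G \<le> (\<Sum>z\<in>G. \<bar>?A \<mu> z\<bar>)" by (rule L2_set_le_sum_abs)
      also have "\<dots> \<le> (\<Sum>z\<in>G. K z * radon_norm \<Omega> \<mu>)"
        unfolding forward_op_def by (intro sum_mono dual_product_bound convm K)
      finally show "L2_set (?A \<mu>) G \<le> (\<Sum>z\<in>G. K z) * radon_norm \<Omega> \<mu>" by (simp add: sum_distrib_right)
    qed
  qed
  have bT: "bounded_op_C0 G \<Omega> ?T"
    unfolding bounded_op_C0_def
  proof (intro conjI ballI allI)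
    show "?T y \<in> C0_space \<Omega>" for y by (rule TC0)
    show "?T (\<lambda>i. a * y i + b * w i) x = a * ?T y x + b * ?T w x" for y w a b x
      by (simp add: forward_op_pre_def distrib_right sum.distrib sum_distrib_left mult.assoc)
    show "\<exists>C. \<forall>y. sup_norm \<Omega> (?T y) \<le> C * L2_set y G"
    proof (intro exI allI)
      fix y :: "real ^ 'n \<Rightarrow> real"
      have y: "\<bar>y z\<bar> \<le> L2_set y G" if "z \<in> G" for z
        using member_le_L2_set[OF G that, of "\<lambda>z. \<bar>y z\<bar>"] by (simp add: L2_set_def)
      have "\<bar>?T y x\<bar> \<le> (\<Sum>z\<in>G. K z) * L2_set y G" for x
      proof (rule order_trans[OF Tb])
        have "(\<Sum>z\<in>G. \<bar>y z\<bar> * K z) \<le> (\<Sum>z\<in>G. L2_set y G * K z)"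
          using y K0 by (intro sum_mono mult_right_mono) auto
        then show "(\<Sum>z\<in>G. \<bar>y z\<bar> * K z) \<le> (\<Sum>z\<in>G. K z) * L2_set y G"
          by (simp add: sum_distrib_right mult.commute)
      qed
      \<comment> \<open>\<open>sup_norm\<close> inserts 0 into the set of values, so the bound has
        to dominate 0 as well.\<close>
      moreover have "0 \<le> (\<Sum>z\<in>G. K z) * L2_set y G" using K0 by (simp add: sum_nonneg)
      ultimately show "sup_norm \<Omega> (?T y) \<le> (\<Sum>z\<in>G. K z) * L2_set y G"
        unfolding sup_norm_def by (intro cSup_least) auto
    qed
  qed
  have dual: "dual_product \<Omega> (?T y) \<mu> = (\<Sum>z\<in>G. ?A \<mu> z * y z)" if \<mu>: "\<mu> \<in> radon_measures \<Omega>" for y \<mu>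
  proof -
    interpret signed_borel_measure \<Omega> \<mu> by (rule radon_measures_signed_borel_measure[OF \<mu> \<Omega>])
    obtain M \<sigma> where M: "polar_measure M \<sigma>" and dual: "\<And>\<phi> K. \<phi> \<in> borel_measurable borel \<Longrightarrow>
        (\<And>x. \<bar>\<phi> x\<bar> \<le> K) \<Longrightarrow> dual_product \<Omega> \<phi> \<mu> = (\<integral>x. \<phi> x * \<sigma> x \<partial>M)"
      using polar_measureE by metis
    interpret M: polar_measure M \<sigma> by fact
    have "dual_product \<Omega> (?T y) \<mu> = (\<integral>x. ?T y x * \<sigma> x \<partial>M)"
      by (rule dual[OF Tm Tb])
    also have "\<dots> = (\<integral>x. (\<Sum>z\<in>G. y z * (convol (\<theta> z) \<psi> x * \<sigma> x)) \<partial>M)"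
      by (simp add: forward_op_pre_def sum_distrib_right mult.assoc)
    also have "\<dots> = (\<Sum>z\<in>G. y z * (\<integral>x. convol (\<theta> z) \<psi> x * \<sigma> x \<partial>M))"
      using M.integrable_mult_sign[OF M.measurable_comp_id[OF convm] K]
      by (subst Bochner_Integration.integral_sum) auto
    also have "\<dots> = (\<Sum>z\<in>G. ?A \<mu> z * y z)"
      using dual[OF convm K] by (intro sum.cong) (auto simp: forward_op_def)
    finally show ?thesis .
  qed
  have ineq: "dual_product \<Omega> (?T (?A \<mu>)) \<mu> \<le> L0 * L1 * dual_product \<Omega> (convol_measure \<Omega> \<rho> \<mu>) \<mu>"
    if \<mu>: "\<mu> \<in> radon_measures \<Omega>" for \<mu>
  proof -
    interpret signed_borel_measure \<Omega> \<mu> by (rule radon_measures_signed_borel_measure[OF \<mu> \<Omega>])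
    obtain M \<sigma> where M: "polar_measure M \<sigma>" and dualM: "\<And>\<phi> K. \<phi> \<in> borel_measurable borel \<Longrightarrow>
        (\<And>x. \<bar>\<phi> x\<bar> \<le> K) \<Longrightarrow> dual_product \<Omega> \<phi> \<mu> = (\<integral>x. \<phi> x * \<sigma> x \<partial>M)"
      using polar_measureE by metis
    interpret M: polar_measure M \<sigma> by fact
    \<comment> \<open>The pre-adjoint identity with y = A \<mu> turns the left side into the squared
      Euclidean norm of A \<mu>.\<close>
    have "dual_product \<Omega> (?T (?A \<mu>)) \<mu> = (\<Sum>z\<in>G. (?A \<mu> z)\<^sup>2)"
      by (simp add: dual[OF \<mu>] power2_eq_square)
    also have "\<dots> = (\<Sum>z\<in>G. (\<integral>x. (\<integral>w. \<theta>' z w * \<psi> (x - w) \<partial>lborel) * \<sigma> x \<partial>M)\<^sup>2)"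
    proof (rule sum.cong[OF refl])
      fix z assume z: "z \<in> G"
      show "(?A \<mu> z)\<^sup>2 = (\<integral>x. (\<integral>w. \<theta>' z w * \<psi> (x - w) \<partial>lborel) * \<sigma> x \<partial>M)\<^sup>2"
        unfolding forward_op_def dualM[OF convm[OF z] K[OF z]] unfolding conv[OF z] ..
    qed
    also have "\<dots> \<le> L0 * M.energy (autocorrelation \<psi>)"
      by (rule M.sum_power2_convolution_le[OF \<psi>2 assms(5) C G \<theta>int(1) \<theta>'(3) L0])
    also have "\<dots> \<le> L0 * (L1 * M.energy \<rho>)"
      using M.energy_autocorrelation_le[OF \<psi>2 \<psi>c C \<rho>c D v(1) r(1) vr] assms(12)
      by (rule mult_left_mono)
    also have "\<dots> = L0 * L1 * dual_product \<Omega> (convol_measure \<Omega> \<rho> \<mu>) \<mu>"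
    proof -
      have "dual_product \<Omega> (convol_measure \<Omega> \<rho> \<mu>) \<mu> = M.energy \<rho>"
        by (rule M.dual_product_convol_measure[OF _ \<rho>m D]) (rule dualM)
      then show ?thesis by simp
    qed
    finally show ?thesis .
  qed
  show ?thesis
    unfolding is_preadjoint_def using lin bT dual ineq by blast
qed

end
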